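(* Let $n_1,\ldots,n_m$ be positive integers, let $\underline{P}=\{(P^{n_i},* )\}_{i=1}^m$ be the corresponding family of based real projective spaces, and let $K$ be a simplicial complex with vertex set $[m]=\{1,\ldots,m\}$. If all $n_i$ are even, then there is an integer $R$ such that for all $r\ge R$, $$\mathrm{TC}_r(\underline{P}^K)=r\,\mathrm{cat}(\underline{P}^K)=\max_{\sigma=[i_1,\ldots,i_\ell]}\left\{\mathrm{TC}_r(P^{n_{i_1}})+\cdots+\mathrm{TC}_r(P^{n_{i_\ell}})\right\},$$ where the maximum is taken over all simplices $\sigma$ of $K$.
   Context: $P^n$ denotes $n$-dimensional real projective space. For a fibration $p\colon E\to B$, the sectional category $\mathrm{secat}(p)$ is the smallest $n$ such that $B$ is covered by $n+1$ open sets on each of which $p$ admits a continuous local section (and $\infty$ if no such $n$ exists). The Lusternik–Schnirelmann category is $\mathrm{cat}(X)=\mathrm{secat}(PX\to X)$, where $PX$ is the space of based paths in $X$ and the map takes a path to its endpoint. For $r\ge 2$, $\mathrm{TC}_r(X)=\mathrm{secat}(p_r)$, where $p_r\colon X^{[0,1]}\to X^r$ is $p_r(\alpha)=\left(\alpha(0),\alpha(\tfrac1{r-1}),\ldots,\alpha(\tfrac{r-2}{r-1}),\alpha(1)\right)$. The polyhedral product $\underline{P}^K$ is the subspace $\bigcup_{\sigma\in K}P^\sigma$ of $\prod_{i=1}^m P^{n_i}$, where $P^\sigma=\prod_{i=1}^m Y_i$ with $Y_i=P^{n_i}$ if $i\in\sigma$ and $Y_i=\{*\}$ if $i\notin\sigma$.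 *)

theory Defs
  imports "HOL-Analysis.Analysis"
begin

subsection \<open>Sectional category\<close>

definition local_section :: "'e topology \<Rightarrow> 'b topology \<Rightarrow> ('e \<Rightarrow> 'b) \<Rightarrow> 'b set \<Rightarrow> ('b \<Rightarrow> 'e) \<Rightarrow> bool"
  where "local_section E B p U s \<longleftrightarrow>
    continuous_map (subtopology B U) E s \<and> (\<forall>x\<in>U. p (s x) = x)"

text \<open>
  The set is empty if no finite cover exists, and then the infimum is \<open>\<infinity>\<close>. The definition
  makes sense for every map \<open>p\<close>; it is only used below for the path fibrations.
\<close>

definition secat :: "'e topology \<Rightarrow> 'b topology \<Rightarrow> ('e \<Rightarrow> 'b) \<Rightarrow> enat"
  where "secat E B p = Inf {enat n | n. \<exists>U :: nat \<Rightarrow> 'b set.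
    (\<forall>i\<le>n. openin B (U i)) \<and> (\<Union>i\<le>n. U i) = topspace B \<and>
    (\<forall>i\<le>n. \<exists>s. local_section E B p (U i) s)}"


subsection \<open>Path spaces, LS category and higher topological complexity\<close>

text \<open>
  Points of the mapping space are functions restricted to \<open>topspace X\<close> (with value
  \<open>undefined\<close> elsewhere), so that two maps are equal iff they agree on \<open>topspace X\<close>.
\<close>

definition maps_into :: "'a topology \<Rightarrow> 'b topology \<Rightarrow> ('a \<Rightarrow> 'b) set"
  where "maps_into X Y = {f \<in> extensional (topspace X). continuous_map X Y f}"

definition compact_open_topology :: "'a topology \<Rightarrow> 'b topology \<Rightarrow> ('a \<Rightarrow> 'b) topology"
  where "compact_open_topology X Y = topology_generated_by
    {{f \<in> maps_into X Y. f ` C \<subseteq> U} | C U. compactin X C \<and> openin Y U}"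

lemma topspace_compact_open_topology [simp]:
  "topspace (compact_open_topology X Y) = maps_into X Y"
proof -
  have "{f \<in> maps_into X Y. f ` {} \<subseteq> {}} = maps_into X Y"
    by simp
  moreover have "compactin X {}" "openin Y {}"
    by simp_all
  ultimately have "maps_into X Y \<in> {{f \<in> maps_into X Y. f ` C \<subseteq> U} | C U. compactin X C \<and> openin Y U}"
    by blast
  then show ?thesis
    unfolding compact_open_topology_def topology_generated_by_topspace by blast
qed

definition path_space :: "'a topology \<Rightarrow> (real \<Rightarrow> 'a) topology"
  where "path_space X = compact_open_topology (top_of_set {0..1}) X"

lemma topspace_path_space:
  "topspace (path_space X) = {\<alpha> \<in> extensional {0..1}. pathin X \<alpha>}"
  by (simp add: path_space_def maps_into_def pathin_def)

definition based_path_space :: "'a topology \<Rightarrow> 'a \<Rightarrow> (real \<Rightarrow> 'a) topology"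
  where "based_path_space X x0 = subtopology (path_space X) {\<alpha>. \<alpha> 0 = x0}"

definition LS_cat :: "'a topology \<Rightarrow> 'a \<Rightarrow> enat"
  where "LS_cat X x0 = secat (based_path_space X x0) X (\<lambda>\<alpha>. \<alpha> 1)"

text \<open>The coordinates of \<open>X\<^sup>r\<close> are indexed by \<open>0, \<dots>, r - 1\<close>.\<close>

definition multi_eval :: "nat \<Rightarrow> (real \<Rightarrow> 'a) \<Rightarrow> nat \<Rightarrow> 'a"
  where "multi_eval r \<alpha> = (\<lambda>j\<in>{..<r}. \<alpha> (real j / (real r - 1)))"

text \<open>Meaningful for \<open>r \<ge> 2\<close> only.\<close>

definition TC :: "nat \<Rightarrow> 'a topology \<Rightarrow> enat"
  where "TC r X = secat (path_space X) (product_topology (\<lambda>_. X) {..<r}) (multi_eval r)"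


subsection \<open>Real projective spaces\<close>

definition quotient_topology :: "'a topology \<Rightarrow> ('a \<Rightarrow> 'b) \<Rightarrow> 'b topology"
  where "quotient_topology X q = topology
    (\<lambda>U. U \<subseteq> q ` topspace X \<and> openin X {x \<in> topspace X. q x \<in> U})"

lemma openin_quotient_topology:
  "openin (quotient_topology X q) U \<longleftrightarrow>
     U \<subseteq> q ` topspace X \<and> openin X {x \<in> topspace X. q x \<in> U}"
proof -
  have "openin X {x \<in> topspace X. q x \<in> S \<inter> T}"
    if "openin X {x \<in> topspace X. q x \<in> S}" "openin X {x \<in> topspace X. q x \<in> T}" for S T
  proof -
    have "{x \<in> topspace X. q x \<in> S \<inter> T} = {x \<in> topspace X. q x \<in> S} \<inter> {x \<in> topspace X. q x \<in> T}"
      by blast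
    with that show ?thesis by auto
  qed
  moreover have "openin X {x \<in> topspace X. q x \<in> \<Union>\<K>}"
    if "\<forall>S\<in>\<K>. openin X {x \<in> topspace X. q x \<in> S}" for \<K>
  proof -
    have "{x \<in> topspace X. q x \<in> \<Union>\<K>} = (\<Union>S\<in>\<K>. {x \<in> topspace X. q x \<in> S})"
      by blast
    with that show ?thesis by auto
  qed
  ultimately have "istopology (\<lambda>U. U \<subseteq> q ` topspace X \<and> openin X {x \<in> topspace X. q x \<in> U})"
    unfolding istopology_def by (intro conjI allI impI) blast+
  then show ?thesis
    by (simp add: quotient_topology_def)
qed

lemma topspace_quotient_topology [simp]:
  "topspace (quotient_topology X q) = q ` topspace X"
proof -
  have "{x \<in> topspace X. q x \<in> q ` topspace X} = topspace X"
    by blast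
  then have "openin (quotient_topology X q) (q ` topspace X)"
    by (simp add: openin_quotient_topology)
  then show ?thesis
    using openin_quotient_topology [THEN iffD1, THEN conjunct1, OF openin_topspace]
    by (intro subset_antisym openin_subset)
qed

lemma quotient_map_quotient_topology: "quotient_map X (quotient_topology X q) q"
  by (auto simp: quotient_map_def openin_quotient_topology)

definition antipodal_class :: "(nat \<Rightarrow> real) \<Rightarrow> (nat \<Rightarrow> real) set"
  where "antipodal_class x = {x, \<lambda>i. - x i}"

definition real_projective_space :: "nat \<Rightarrow> (nat \<Rightarrow> real) set topology"
  where "real_projective_space n = quotient_topology (nsphere n) antipodal_class"


subsection \<open>Simplicial complexes and polyhedral products\<close>

text \<open>The empty set counts as a simplex, and every element of \<open>V\<close> is a vertex.\<close>

definition abstract_simplicial_complex :: "'i set \<Rightarrow> 'i set set \<Rightarrow> bool"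
  where "abstract_simplicial_complex V K \<longleftrightarrow>
    K \<subseteq> {\<sigma>. finite \<sigma> \<and> \<sigma> \<subseteq> V} \<and> {} \<in> K \<and> (\<forall>v\<in>V. {v} \<in> K) \<and>
    (\<forall>\<sigma>\<in>K. \<forall>\<tau>. \<tau> \<subseteq> \<sigma> \<longrightarrow> \<tau> \<in> K)"

definition polyhedral_product ::
    "'i set \<Rightarrow> ('i \<Rightarrow> 'a topology) \<Rightarrow> ('i \<Rightarrow> 'a) \<Rightarrow> 'i set set \<Rightarrow> ('i \<Rightarrow> 'a) topology"
  where "polyhedral_product V X b K = subtopology (product_topology X V)
    (\<Union>\<sigma>\<in>K. \<Pi>\<^sub>E i\<in>V. if i \<in> \<sigma> then topspace (X i) else {b i})"

end

theory Submission
  imports Defs "HOL-Library.Z2"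
begin

text \<open>
  Let \<open>N\<close> be the largest value of \<open>\<Sum>i\<in>\<sigma>. n i\<close> over the simplices \<open>\<sigma>\<close>. All quantities in the theorem equal
  \<open>r * N\<close>.

  Upper bounds: linear forms adapted to the base point filter every projective space, hence powers of the
  polyhedral product, by cells indexed by multi-indices. Cells of equal dimension have disjoint open
  neighbourhoods that contract to the base point inside the polyhedral product, which leaves one open
  set for each dimension.

  Lower bounds: the polyhedral product contains \<open>\<Prod>i\<in>\<sigma>. P\<^sup>n\<^sup>i\<close>. On an open set with a section,
  lifting the paths to spheres yields sign functions that are locally constant and equivariant for a
  character of the group of antipodes. If fewer than \<open>r * N\<close> open sets covered everything, one could choose characters
  whose product of mod 2 Euler classes is the top class, that is, a product of linear forms in which
  \<open>\<Prod>a. x\<^sub>a ^ n a\<close> has an odd coefficient. Instead of cohomology we use a direct parity argument: on fine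
  triangulations of products of spheres by spherical coordinates, the number of simplices along
  whose \<open>k\<close>-th edge the \<open>k\<close>-th sign changes for every \<open>k\<close> satisfies, by Stokes, the same recursion as that
  coefficient. So such simplices exist at every scale, although a small simplex lies in one of the open
  sets, on which one of the signs does not change. For \<open>TC\<close> the forms are \<open>x\<^sub>j + y\<close> with \<open>y\<close> belonging to the last factor, and evenness of \<open>n\<close> makes
  \<open>n + 1\<close> odd.
\<close>

subsection \<open>Chains of subdivided cubes modulo 2\<close>

text \<open>The recursion for the count arises as follows. With all angles restricted to half a
  turn, spherical coordinates parametrise a hemisphere, a fundamental domain of the antipode. Modulo
  2 its boundary consists of two hemispheres of one dimension less, which the antipode exchanges.
  When Stokes is applied to the first sign \<open>v\<close>, these two faces contribute
  \<open>v\<close> and \<open>v\<close> after the antipode, each multiplied by the same remaining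
  coboundaries. Only the constant by which the antipode shifts \<open>v\<close> survives: this
  strikes one linear form and lowers one exponent. The threshold for \<open>r\<close> comes from the
  coefficient. Each factor \<open>(x + y)^(n+1)\<close> from which \<open>x^n\<close> is taken
  leaves a single \<open>y\<close>, so collecting \<open>y^n\<close> takes \<open>n\<close> indices
  besides the last one; hence the condition \<open>n i < r\<close>. In the upper bound the dimension
  of a cell has to be bounded by the face containing the point, and the contraction must not leave
  that face. Both follow from one choice: all linear forms but number 0 vanish at the base point. A
  coordinate at the base point therefore has index 0, and the contraction in chart 0 keeps it
  fixed.\<close>

declare add_bit_eq_xor [simp del] mult_bit_eq_and [simp del]

lemma bit_add_self [simp]: "a + a = (0::bit)"
  by (cases a) simp_all

lemma bit_add_eq_0_iff: "a + b = 0 \<longleftrightarrow> a = (b::bit)"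
  by (cases a; cases b) simp_all

text \<open>The terms at \<open>(s, t)\<close> and \<open>(t, s)\<close> cancel. Typically
  \<open>s\<close> and \<open>t\<close> are two successive coordinate changes whose order is
  irrelevant.\<close>

lemma sum_offdiag_eq_0:
  fixes h :: "'s \<Rightarrow> 's \<Rightarrow> bit"
  assumes "finite S" "\<And>s t. s \<in> S \<Longrightarrow> t \<in> S \<Longrightarrow> h s t = h t s"
  shows "(\<Sum>s\<in>S. \<Sum>t\<in>S - {s}. h s t) = 0"
  using assms
proof (induction S rule: finite_induct)
  case empty
  then show ?case by simp
next
  case (insert a S)
  have 1: "(\<Sum>t\<in>insert a S - {a}. h a t) = (\<Sum>t\<in>S. h a t)"
    using insert.hyps by simp
  have 2: "(\<Sum>t\<in>insert a S - {s}. h s t) = h s a + (\<Sum>t\<in>S - {s}. h s t)" if "s \<in> S" for s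
  proof -
    have "insert a S - {s} = insert a (S - {s})"
      using that insert.hyps by auto
    then show ?thesis using insert.hyps by simp
  qed
  have "(\<Sum>s\<in>insert a S. \<Sum>t\<in>insert a S - {s}. h s t)
      = (\<Sum>t\<in>S. h a t) + (\<Sum>s\<in>S. h s a + (\<Sum>t\<in>S - {s}. h s t))"
    using insert.hyps 1 2 by simp
  also have "\<dots> = (\<Sum>t\<in>S. h a t) + (\<Sum>s\<in>S. h s a)"
    using insert.IH insert.prems by (simp add: sum.distrib)
  also have "(\<Sum>s\<in>S. h s a) = (\<Sum>t\<in>S. h a t)"
    using insert.prems by (intro sum.cong) auto
  finally show ?case by simp
qed

text \<open>The cup product \<open>\<delta>u\<^sub>1 \<union> \<delta>u\<^sub>2 \<union> \<dots>\<close> of coboundaries, evaluated on the sum of the simplices that lead from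
  \<open>x\<close> to \<open>y\<close> by changing one coordinate in \<open>S\<close> at a time.\<close>

primrec path_sum :: "'s set \<Rightarrow> (('s \<Rightarrow> 'v) \<Rightarrow> bit) list \<Rightarrow> ('s \<Rightarrow> 'v) \<Rightarrow> ('s \<Rightarrow> 'v) \<Rightarrow> bit" where
  "path_sum S [] x y = 1"
| "path_sum S (u # us) x y =
     (\<Sum>s\<in>S. (u x + u (x(s := y s))) * path_sum (S - {s}) us (x(s := y s)) y)"

text \<open>A cup product of coboundaries is a cocycle: its values on all faces of a cube, those
  through \<open>x\<close> and those through \<open>y\<close>, add up to 0.\<close>

lemma path_sum_closed:
  fixes us :: "(('s \<Rightarrow> 'v) \<Rightarrow> bit) list"
  assumes "finite S" "card S = Suc (length us)"
  shows "(\<Sum>s\<in>S. path_sum (S - {s}) us (x(s := y s)) y) = (\<Sum>s\<in>S. path_sum (S - {s}) us x y)"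
  using assms
proof (induction us arbitrary: S x)
  case Nil
  then show ?case by simp
next
  case (Cons u us)
  let ?W = "\<lambda>s t z. path_sum (S - {s} - {t}) us z y"
  have IH: "(\<Sum>t\<in>S - {s}. ?W s t (z(t := y t))) = (\<Sum>t\<in>S - {s}. ?W s t z)" if "s \<in> S" for s z
    by (rule Cons.IH) (use Cons.prems that in auto)
  have sw: "S - {s} - {t} = S - {t} - {s}" for s t by blast
  have tw: "x(s := y s, t := y t) = x(t := y t, s := y s)" for s t
    by (cases "s = t") (auto simp: fun_upd_twist)
  have "(\<Sum>s\<in>S. path_sum (S - {s}) (u # us) (x(s := y s)) y) =
      (\<Sum>s\<in>S. \<Sum>t\<in>S - {s}. u (x(s := y s)) * ?W s t (x(s := y s, t := y t))) +
      (\<Sum>s\<in>S. \<Sum>t\<in>S - {s}. u (x(s := y s, t := y t)) * ?W s t (x(s := y s, t := y t)))"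
    by (simp add: distrib_right sum.distrib)
  \<comment> \<open>Once both coordinates have changed, the order of the changes is no longer
    visible, so this part is symmetric.\<close>
  also have "(\<Sum>s\<in>S. \<Sum>t\<in>S - {s}. u (x(s := y s, t := y t)) * ?W s t (x(s := y s, t := y t))) = 0"
    using Cons.prems by (intro sum_offdiag_eq_0) (auto simp: sw tw)
  also have "(\<Sum>s\<in>S. \<Sum>t\<in>S - {s}. u (x(s := y s)) * ?W s t (x(s := y s, t := y t)))
      = (\<Sum>s\<in>S. \<Sum>t\<in>S - {s}. u (x(s := y s)) * ?W s t (x(s := y s)))"
  proof (rule sum.cong[OF refl])
    fix s assume s: "s \<in> S"
    show "(\<Sum>t\<in>S - {s}. u (x(s := y s)) * ?W s t (x(s := y s, t := y t)))
        = (\<Sum>t\<in>S - {s}. u (x(s := y s)) * ?W s t (x(s := y s)))"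
      unfolding sum_distrib_left[symmetric] using IH[OF s] by (rule arg_cong)
  qed
  also have "\<dots> = (\<Sum>s\<in>S. \<Sum>t\<in>S - {s}. u (x(t := y t)) * ?W s t (x(t := y t)))"
  proof -
    have "(\<Sum>s\<in>S. \<Sum>t\<in>S - {s}. u (x(s := y s)) * ?W s t (x(s := y s)) + u (x(t := y t)) * ?W s t (x(t := y t))) = 0"
      using Cons.prems by (intro sum_offdiag_eq_0) (auto simp: sw add.commute)
    then show ?thesis
      by (simp add: sum.distrib bit_add_eq_0_iff)
  qed
  \<comment> \<open>The right-hand side has additional terms with the factor \<open>u x\<close>;
    they sum to 0 by the induction hypothesis and symmetry.\<close>
  also have "\<dots> = (\<Sum>s\<in>S. path_sum (S - {s}) (u # us) x y)"
  proof -
    have "(\<Sum>s\<in>S. \<Sum>t\<in>S - {s}. ?W s t (x(t := y t))) = (\<Sum>s\<in>S. \<Sum>t\<in>S - {s}. ?W s t x)"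
      by (intro sum.cong refl IH)
    also have "\<dots> = 0"
      using Cons.prems by (intro sum_offdiag_eq_0) (auto simp: sw)
    finally have "(\<Sum>s\<in>S. \<Sum>t\<in>S - {s}. u x * ?W s t (x(t := y t))) = 0"
      by (simp flip: sum_distrib_left)
    then show ?thesis
      by (simp add: distrib_right sum.distrib)
  qed
  finally show ?case by simp
qed

text \<open>There are as many functions as coordinates, so every path changes \<open>t\<close> at
  some step, and the factor of that step is 0.\<close>

lemma path_sum_eq_0:
  assumes "t \<in> S" "finite S" "length us = card S"
    and "\<And>u z. u \<in> set us \<Longrightarrow> (\<And>s. s \<notin> S \<Longrightarrow> z s = x s) \<Longrightarrow> u (z(t := y t)) = u z"
  shows "path_sum S us x y = 0"
  using assms
proof (induction us arbitrary: S x)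
  case Nil
  then show ?case by auto
next
  case (Cons u us)
  have "(u x + u (x(s := y s))) * path_sum (S - {s}) us (x(s := y s)) y = 0" if s: "s \<in> S" for s
  proof (cases "s = t")
    case True
    have "u (x(t := y t)) = u x"
      by (rule Cons.prems(4)) auto
    then show ?thesis using True by (simp add: bit_add_eq_0_iff)
  next
    case False
    have "path_sum (S - {s}) us (x(s := y s)) y = 0"
    proof (rule Cons.IH)
      show "length us = card (S - {s})"
        using Cons.prems s by simp
    next
      fix u' z assume u': "u' \<in> set us" and z: "\<And>s'. s' \<notin> S - {s} \<Longrightarrow> z s' = (x(s := y s)) s'"
      show "u' (z(t := y t)) = u' z"
        using Cons.prems(4)[of u' z] u' z s by fastforce
    qed (use Cons.prems s False in auto)
    then show ?thesis by simp
  qed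
  then show ?case unfolding path_sum.simps by (intro sum.neutral) blast
qed

text \<open>Some path has only nonzero factors, and the factor of \<open>u\<close> compares two
  vertices of the cube. This extracts sign changes inside one small cube from a nonzero
  count.\<close>

lemma path_sum_nonzero_imp:
  assumes "path_sum S us x y \<noteq> 0" "u \<in> set us"
  shows "\<exists>z z'. (\<forall>s. z s \<in> {x s, y s}) \<and> (\<forall>s. z' s \<in> {x s, y s}) \<and> (\<forall>s. s \<notin> S \<longrightarrow> z s = x s \<and> z' s = x s) \<and> u z \<noteq> u z'"
  using assms
proof (induction us arbitrary: S x)
  case Nil
  then show ?case by simp
next
  case (Cons v us)
  then obtain s where s: "s \<in> S" "(v x + v (x(s := y s))) * path_sum (S - {s}) us (x(s := y s)) y \<noteq> 0"
    by (metis (no_types, lifting) path_sum.simps(2) sum.neutral)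
  show ?case
  proof (cases "u = v")
    case True
    have "u x \<noteq> u (x(s := y s))"
      using s(2) True by (metis bit_add_self mult_zero_left)
    then show ?thesis
      using s(1) by (metis fun_upd_apply insertCI)
  next
    case False
    with Cons.prems have "u \<in> set us" by simp
    moreover have "path_sum (S - {s}) us (x(s := y s)) y \<noteq> 0"
      using s by auto
    ultimately obtain z z' where "\<forall>t. z t \<in> {(x(s := y s)) t, y t}" "\<forall>t. z' t \<in> {(x(s := y s)) t, y t}"
      "\<forall>t. t \<notin> S - {s} \<longrightarrow> z t = (x(s := y s)) t \<and> z' t = (x(s := y s)) t" "u z \<noteq> u z'"
      using Cons.IH by blast
    then show ?thesis
      using s(1) by (smt (verit, best) Diff_iff fun_upd_apply insertCI insertE singletonD)
  qed
qed

lemma sum_PiE_insert: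
  assumes "s \<notin> S"
  shows "(\<Sum>k\<in>PiE (insert s S) F. g k) = (\<Sum>k\<in>PiE S F. \<Sum>j\<in>F s. g (k(s := j)))"
proof -
  have "(\<Sum>k\<in>PiE (insert s S) F. g k) = (\<Sum>(j, k)\<in>F s \<times> PiE S F. g (k(s := j)))"
    unfolding PiE_insert_eq
    by (subst sum.reindex[OF inj_combinator[OF assms]]) (simp add: case_prod_beta comp_def)
  also have "\<dots> = (\<Sum>j\<in>F s. \<Sum>k\<in>PiE S F. g (k(s := j)))"
    by (simp flip: sum.cartesian_product)
  also have "\<dots> = (\<Sum>k\<in>PiE S F. \<Sum>j\<in>F s. g (k(s := j)))"
    by (rule sum.swap)
  finally show ?thesis .
qed

text \<open>The interval \<open>[k, k + 1]\<close> is oriented from its even to its odd end. The resulting triangulation of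
  the cube with side \<open>2 * L\<close> is invariant under reflections, as the antipodes require.\<close>

definition even_end :: "nat \<Rightarrow> nat" where "even_end k = (if even k then k else Suc k)"
definition odd_end :: "nat \<Rightarrow> nat" where "odd_end k = (if even k then Suc k else k)"

text \<open>An even number strictly between \<open>0\<close> and \<open>2*L\<close> is the even end
  of two adjacent intervals, so its two contributions cancel.\<close>

lemma sum_even_end:
  fixes f :: "nat \<Rightarrow> bit"
  shows "(\<Sum>k<2*L. f (even_end k)) = f 0 + f (2*L)"
proof (induction L)
  case (Suc L)
  have "(\<Sum>k<2*Suc L. f (even_end k)) = (\<Sum>k<2*L. f (even_end k)) + f (2*L) + f (2 * Suc L)"
    by (simp add: even_end_def)
  then show ?case using Suc by (simp add: add.assoc[symmetric])
qed simp

lemma sum_odd_end: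
  fixes f :: "nat \<Rightarrow> bit"
  shows "(\<Sum>k<2*L. f (odd_end k)) = 0"
proof (induction L)
  case (Suc L)
  have "(\<Sum>k<2*Suc L. f (odd_end k)) = (\<Sum>k<2*L. f (odd_end k)) + f (Suc (2*L)) + f (Suc (2*L))"
    by (simp add: odd_end_def)
  then show ?case using Suc by (simp add: add.assoc)
qed simp

text \<open>Coordinates outside \<open>S\<close> are 0, so that the face at level 0 in direction
  \<open>s\<close> is literally the grid over \<open>S - {s}\<close>.\<close>

definition grid_even :: "nat \<Rightarrow> 's set \<Rightarrow> ('s \<Rightarrow> nat) \<Rightarrow> 's \<Rightarrow> real" where
  "grid_even L S k = (\<lambda>s. if s \<in> S then real (even_end (k s)) / real (2*L) else 0)"

definition grid_odd :: "nat \<Rightarrow> 's set \<Rightarrow> ('s \<Rightarrow> nat) \<Rightarrow> 's \<Rightarrow> real" where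
  "grid_odd L S k = (\<lambda>s. if s \<in> S then real (odd_end (k s)) / real (2*L) else 0)"

definition cube_sum :: "nat \<Rightarrow> 's set \<Rightarrow> (('s \<Rightarrow> real) \<Rightarrow> bit) list \<Rightarrow> bit" where
  "cube_sum L S us = (\<Sum>k\<in>PiE S (\<lambda>_. {..<2*L}). path_sum S us (grid_even L S k) (grid_odd L S k))"

lemma path_sum_cong_target:
  "(\<And>s. s \<in> S \<Longrightarrow> y s = y' s) \<Longrightarrow> path_sum S us x y = path_sum S us x y'"
proof (induction us arbitrary: S x)
  case Nil
  then show ?case by simp
next
  case (Cons u us)
  have "path_sum (S - {s}) us (x(s := y s)) y = path_sum (S - {s}) us (x(s := y s)) y'" for s
    by (rule Cons.IH) (use Cons.prems in auto)
  then have "(u x + u (x(s := y s))) * path_sum (S - {s}) us (x(s := y s)) y =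
      (u x + u (x(s := y' s))) * path_sum (S - {s}) us (x(s := y' s)) y'" if "s \<in> S" for s
    using Cons.prems[OF that] by (metis (no_types))
  then show ?case
    unfolding path_sum.simps by (intro sum.cong) auto
qed

text \<open>Only differences of values enter a path sum, so each function may be shifted by a
  constant. In the application \<open>\<rho>\<close> reflects angles and the shift is the effect of
  the antipode on a sign.\<close>

lemma path_sum_transform:
  assumes "list_all2 (\<lambda>u u'. \<exists>d. \<forall>z. (\<forall>t. t \<notin> S \<longrightarrow> z t = x t) \<longrightarrow> u z = d + u' (\<lambda>t. \<rho> t (z t))) us us'"
  shows "path_sum S us x y = path_sum S us' (\<lambda>t. \<rho> t (x t)) (\<lambda>t. \<rho> t (y t))"
  using assms
proof (induction us arbitrary: us' S x)
  case Nil
  then show ?case by simp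
next
  case (Cons u us u's)
  then obtain u' us' where u's: "u's = u' # us'"
    by (cases u's) auto
  obtain d where d: "\<And>z. (\<And>t. t \<notin> S \<Longrightarrow> z t = x t) \<Longrightarrow> u z = d + u' (\<lambda>t. \<rho> t (z t))"
    using Cons.prems u's by auto
  have upd: "(\<lambda>t. \<rho> t ((x(s := y s)) t)) = (\<lambda>t. \<rho> t (x t))(s := \<rho> s (y s))" for s
    by auto
  have "(u x + u (x(s := y s))) * path_sum (S - {s}) us (x(s := y s)) y =
     (u' (\<lambda>t. \<rho> t (x t)) + u' ((\<lambda>t. \<rho> t (x t))(s := \<rho> s (y s)))) *
       path_sum (S - {s}) us' ((\<lambda>t. \<rho> t (x t))(s := \<rho> s (y s))) (\<lambda>t. \<rho> t (y t))" if s: "s \<in> S" for s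
  proof -
    have 1: "u x = d + u' (\<lambda>t. \<rho> t (x t))" by (rule d) simp
    have 2: "u (x(s := y s)) = d + u' ((\<lambda>t. \<rho> t (x t))(s := \<rho> s (y s)))"
      unfolding upd[symmetric] by (rule d) (use s in auto)
    have "path_sum (S - {s}) us (x(s := y s)) y =
        path_sum (S - {s}) us' (\<lambda>t. \<rho> t ((x(s := y s)) t)) (\<lambda>t. \<rho> t (y t))"
    proof (rule Cons.IH, rule list.rel_mono_strong)
      show "list_all2 (\<lambda>u u'. \<exists>d. \<forall>z. (\<forall>t. t \<notin> S \<longrightarrow> z t = x t) \<longrightarrow> u z = d + u' (\<lambda>t. \<rho> t (z t))) us us'"
        using Cons.prems u's by simp
    qed (use s in \<open>fastforce split: if_splits\<close>)
    then show ?thesis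
      unfolding 1 2 upd by (simp add: ac_simps)
  qed
  then show ?case
    unfolding path_sum.simps u's by (intro sum.cong) auto
qed

text \<open>A discrete Stokes theorem: the integrand is the coboundary of \<open>u \<union> \<delta>u\<^sub>1 \<union> \<delta>u\<^sub>2 \<union> \<dots>\<close>, and the
  interior faces cancel in pairs.\<close>

lemma cube_sum_Cons:
  assumes "finite S" "card S = Suc (length us)" "L > 0"
  shows "cube_sum L S (u # us) = (\<Sum>s\<in>S. \<Sum>c\<in>{0, 1}. \<Sum>k\<in>PiE (S - {s}) (\<lambda>_. {..<2*L}).
    u ((grid_even L (S - {s}) k)(s := c)) *
    path_sum (S - {s}) us ((grid_even L (S - {s}) k)(s := c)) (grid_odd L (S - {s}) k))"
proof -
  let ?P = "\<lambda>S. PiE S (\<lambda>_. {..<2*L}) :: ('a \<Rightarrow> nat) set"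
  let ?e = "grid_even L S" and ?o = "grid_odd L S"
  \<comment> \<open>By \<open>path_sum_closed\<close> the second factors of the \<open>u x\<close>
    terms may be moved to the faces through \<open>x\<close>. Afterwards every term lives on a
    single face of the small cube.\<close>
  have split: "path_sum S (u # us) x y =
      (\<Sum>s\<in>S. u x * path_sum (S - {s}) us x y) + (\<Sum>s\<in>S. u (x(s := y s)) * path_sum (S - {s}) us (x(s := y s)) y)" for x y
    using path_sum_closed[OF assms(1,2), of x y]
    by (simp only: path_sum.simps distrib_right sum.distrib flip: sum_distrib_left)
  have ins: "?e (k(s := j)) = (grid_even L (S - {s}) k)(s := real (even_end j) / real (2*L))"
    "?o (k(s := j)) = (grid_odd L (S - {s}) k)(s := real (odd_end j) / real (2*L))" if "s \<in> S" for s k j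
    using that by (auto simp: grid_even_def grid_odd_def)
  have yc: "path_sum (S - {s}) us x (y(s := c)) = path_sum (S - {s}) us x y" for s x y and c :: real
    by (rule path_sum_cong_target) auto
  have sumP: "(\<Sum>k\<in>?P S. g k) = (\<Sum>k\<in>?P (S - {s}). \<Sum>j<2*L. g (k(s := j)))" if "s \<in> S" for s and g :: "('a \<Rightarrow> nat) \<Rightarrow> bit"
    using sum_PiE_insert[of s "S - {s}" g "\<lambda>_. {..<2*L}"] that by (simp add: insert_absorb)
  \<comment> \<open>Odd levels are all interior, and a face at such a level is shared by two
    adjacent subcubes.\<close>
  have odd0: "(\<Sum>k\<in>?P S. u ((?e k)(s := ?o k s)) * path_sum (S - {s}) us ((?e k)(s := ?o k s)) (?o k)) = 0" if s: "s \<in> S" for s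
  proof -
    have "(\<Sum>j<2*L. u ((?e (k(s := j)))(s := ?o (k(s := j)) s)) * path_sum (S - {s}) us ((?e (k(s := j)))(s := ?o (k(s := j)) s)) (?o (k(s := j)))) = 0" for k
      using sum_odd_end[of "\<lambda>j. u ((grid_even L (S - {s}) k)(s := real j / real (2*L))) * path_sum (S - {s}) us ((grid_even L (S - {s}) k)(s := real j / real (2*L))) (grid_odd L (S - {s}) k)" L]
      unfolding ins[OF s] yc fun_upd_upd fun_upd_same .
    then show ?thesis
      unfolding sumP[OF s] by simp
  qed
  \<comment> \<open>Interior even levels cancel likewise; only the outer faces at levels 0 and 1
    remain.\<close>
  have even1: "(\<Sum>k\<in>?P S. u (?e k) * path_sum (S - {s}) us (?e k) (?o k)) =
    (\<Sum>c\<in>{0, 1}. \<Sum>k\<in>?P (S - {s}).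
    u ((grid_even L (S - {s}) k)(s := c)) *
    path_sum (S - {s}) us ((grid_even L (S - {s}) k)(s := c)) (grid_odd L (S - {s}) k))" if s: "s \<in> S" for s
  proof -
    define f where "f k c = u ((grid_even L (S - {s}) k)(s := c)) * path_sum (S - {s}) us ((grid_even L (S - {s}) k)(s := c)) (grid_odd L (S - {s}) k)" for k c
    have "(\<Sum>k\<in>?P S. u (?e k) * path_sum (S - {s}) us (?e k) (?o k)) = (\<Sum>k\<in>?P (S - {s}). \<Sum>j<2*L. f k (real (even_end j) / real (2*L)))"
      unfolding sumP[OF s] ins[OF s] yc f_def ..
    also have "\<dots> = (\<Sum>k\<in>?P (S - {s}). f k 0 + f k 1)"
      using sum_even_end[of "\<lambda>j. f k (real j / real (2*L))" L for k] \<open>L > 0\<close> by simp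
    also have "\<dots> = (\<Sum>c\<in>{0, 1}. \<Sum>k\<in>?P (S - {s}). f k c)"
      by (simp add: sum.distrib)
    finally show ?thesis unfolding f_def .
  qed
  have "cube_sum L S (u # us) = (\<Sum>s\<in>S. \<Sum>k\<in>?P S. u (?e k) * path_sum (S - {s}) us (?e k) (?o k))
    + (\<Sum>s\<in>S. \<Sum>k\<in>?P S. u ((?e k)(s := ?o k s)) * path_sum (S - {s}) us ((?e k)(s := ?o k s)) (?o k))"
    unfolding cube_sum_def split sum.distrib by (simp only: sum.swap[of _ "?P S" S])
  then show ?thesis
    using odd0 even1 by simp
qed

text \<open>The angles are \<open>pi * t i\<close>. On the unit cube all sines are nonnegative, so
  the image lies in the hemisphere on which coordinate \<open>p\<close> is nonnegative.\<close>

definition sphere_coords :: "nat \<Rightarrow> (nat \<Rightarrow> real) \<Rightarrow> nat \<Rightarrow> real" where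
  "sphere_coords p t i = (\<Prod>l<i. sin (pi * t l)) * (if i < p then cos (pi * t i) else if i = p then 1 else 0)"

text \<open>A vanishing sine kills all later coordinates. Faces of the cube in any angle but the
  last thus drop in dimension and will not contribute.\<close>

lemma sphere_coords_degenerate:
  assumes "i < j" "t i \<in> {0, 1}" "p = Suc j"
  shows "sphere_coords p (t(j := c)) = sphere_coords p t"
proof
  fix l
  show "sphere_coords p (t(j := c)) l = sphere_coords p t l"
  proof (cases "l \<le> i")
    case True
    then show ?thesis using assms by (auto simp: sphere_coords_def intro!: prod.cong)
  next
    case False
    then have "(\<Prod>l<l. sin (pi * (t(j := c)) l)) = 0" "(\<Prod>l<l. sin (pi * t l)) = 0"
      using assms by (auto intro!: prod_zero bexI[of _ i])
    then show ?thesis unfolding sphere_coords_def by (simp only: mult_zero_left)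
  qed
qed

lemma sphere_coords_face_0:
  assumes "t j = 0"
  shows "sphere_coords (Suc j) t = sphere_coords j t"
proof
  fix l
  have "(\<Prod>l<l. sin (pi * t l)) = 0" if "j < l"
    using assms that by (auto intro!: prod_zero bexI[of _ j])
  then show "sphere_coords (Suc j) t l = sphere_coords j t l"
    using assms by (cases l j rule: linorder_cases) (auto simp: sphere_coords_def)
qed

text \<open>Replacing an angle by its supplement negates the cosine and keeps the sine, so
  reflecting all angles negates every coordinate. Together with \<open>sphere_coords_face_0\<close>
  this identifies the two faces of the last angle up to the antipode.\<close>

lemma sphere_coords_face_1:
  assumes "t j = 1"
  shows "sphere_coords (Suc j) t = (\<lambda>l. - sphere_coords j (\<lambda>l. if l \<le> j then 1 - t l else t l) l)"
proof
  fix l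
  have c: "cos (pi * (1 - x)) = - cos (pi * x)" "sin (pi * (1 - x)) = sin (pi * x)" for x
    by (simp_all add: right_diff_distrib cos_diff sin_diff)
  have z: "(\<Prod>l<l. sin (pi * t l)) = 0" "(\<Prod>l<l. sin (pi * (if l \<le> j then 1 - t l else t l))) = 0" if "j < l"
    using assms that by (auto intro!: prod_zero bexI[of _ j])
  have p: "(\<Prod>l<l. sin (pi * (if l \<le> j then 1 - t l else t l))) = (\<Prod>l<l. sin (pi * t l))" if "l \<le> j"
    using that by (intro prod.cong) (auto simp: c)
  show "sphere_coords (Suc j) t l = - sphere_coords j (\<lambda>l. if l \<le> j then 1 - t l else t l) l"
  proof (cases l j rule: linorder_cases)
    case less
    then show ?thesis using p by (simp add: sphere_coords_def c)
  next
    case equal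
    then show ?thesis using p assms by (simp add: sphere_coords_def)
  next
    case greater
    then show ?thesis using z by (simp add: sphere_coords_def)
  qed
qed

subsection \<open>Parity counts on products of spheres\<close>

definition sphere_product_map :: "'a set \<Rightarrow> ('a \<Rightarrow> nat) \<Rightarrow> ('a \<times> nat \<Rightarrow> real) \<Rightarrow> 'a \<Rightarrow> nat \<Rightarrow> real" where
  "sphere_product_map A p z = (\<lambda>a\<in>A. sphere_coords (p a) (\<lambda>i. z (a, i)))"

definition antipode_at :: "'a \<Rightarrow> ('a \<Rightarrow> nat \<Rightarrow> real) \<Rightarrow> 'a \<Rightarrow> nat \<Rightarrow> real" where
  "antipode_at a w = w(a := (\<lambda>i. - w a i))"

definition block_indices :: "'a set \<Rightarrow> ('a \<Rightarrow> nat) \<Rightarrow> ('a \<times> nat) set" where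
  "block_indices A p = Sigma A (\<lambda>a. {..<p a})"

definition sphere_count :: "nat \<Rightarrow> 'a set \<Rightarrow> ('a \<Rightarrow> nat) \<Rightarrow> (('a \<Rightarrow> nat \<Rightarrow> real) \<Rightarrow> bit) list \<Rightarrow> bit" where
  "sphere_count L A p vs = cube_sum L (block_indices A p) (map (\<lambda>v z. v (sphere_product_map A p z)) vs)"

text \<open>The coefficient of \<open>\<Prod>a. x\<^sub>a ^ p a\<close> in the product of the linear forms \<open>\<Sum>a\<in>X. x\<^sub>a\<close>, \<open>X\<close> in the list.\<close>

primrec forms_coeff :: "'a set \<Rightarrow> ('a \<Rightarrow> nat) \<Rightarrow> 'a set list \<Rightarrow> bit" where
  "forms_coeff A p [] = of_bool (\<forall>a\<in>A. p a = 0)"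
| "forms_coeff A p (X # Xs) = (\<Sum>a | a \<in> A \<and> a \<in> X \<and> p a > 0. forms_coeff A (p(a := p a - 1)) Xs)"

lemma finite_block_indices [simp]: "finite A \<Longrightarrow> finite (block_indices A p)"
  by (simp add: block_indices_def)

lemma card_block_indices: "finite A \<Longrightarrow> card (block_indices A p) = (\<Sum>a\<in>A. p a)"
  by (simp add: block_indices_def)

lemma sphere_count_Nil:
  assumes "\<forall>a\<in>A. p a = 0"
  shows "sphere_count L A p [] = 1"
proof -
  have "block_indices A p = {}" using assms by (auto simp: block_indices_def)
  then show ?thesis by (simp add: sphere_count_def cube_sum_def)
qed

lemma sphere_product_map_cong:
  "(\<And>a. a \<in> A \<Longrightarrow> sphere_coords (p a) (\<lambda>i. z (a, i)) = sphere_coords (q a) (\<lambda>i. w (a, i))) \<Longrightarrow>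
    sphere_product_map A p z = sphere_product_map A q w"
  by (auto simp: sphere_product_map_def)

text \<open>Stokes leaves the two faces of the last angle of each factor \<open>a\<close>, namely a
  lower hemisphere and its antipode. Their contributions differ by the shift of \<open>v\<close>
  times the count of the remaining functions; the shifts of the latter disappear in their
  coboundaries.\<close>

lemma sphere_count_Cons:
  fixes v :: "('a \<Rightarrow> nat \<Rightarrow> real) \<Rightarrow> bit"
  assumes A: "finite A" and L: "L > 0" and card: "(\<Sum>a\<in>A. p a) = Suc (length vs)"
    and len: "length Xs = length vs"
    and eqv: "\<And>i a q z. i < Suc (length vs) \<Longrightarrow> a \<in> A \<Longrightarrow> (\<And>a. q a \<le> p a) \<Longrightarrow>
      ((v # vs) ! i) (antipode_at a (sphere_product_map A q z)) =
      ((v # vs) ! i) (sphere_product_map A q z) + of_bool (a \<in> (X # Xs) ! i)"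
  shows "sphere_count L A p (v # vs) =
    (\<Sum>a | a \<in> A \<and> a \<in> X \<and> p a > 0. sphere_count L A (p(a := p a - 1)) vs)"
proof -
  define S where "S = block_indices A p"
  define us where "us = map (\<lambda>v z. v (sphere_product_map A p z)) vs"
  define u where "u z = v (sphere_product_map A p z)" for z
  define P where "P S = PiE S (\<lambda>_. {..<2*L})" for S :: "('a \<times> nat) set"
  define F where "F s c = (\<Sum>k\<in>P (S - {s}).
    u ((grid_even L (S - {s}) k)(s := c)) *
    path_sum (S - {s}) us ((grid_even L (S - {s}) k)(s := c)) (grid_odd L (S - {s}) k))" for s and c :: real
  have finS: "finite S" and cardS: "card S = Suc (length us)"
    using A card by (simp_all add: S_def us_def card_block_indices)
  have "sphere_count L A p (v # vs) = cube_sum L S (u # us)"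
    by (simp add: sphere_count_def S_def us_def u_def[abs_def])
  also have "\<dots> = (\<Sum>s\<in>S. F s 0 + F s 1)"
    using cube_sum_Cons[OF finS cardS L, of u] by (simp add: F_def P_def)
  also have "\<dots> = (\<Sum>a\<in>A. \<Sum>i<p a. F (a, i) 0 + F (a, i) 1)"
    using A by (simp add: S_def block_indices_def sum.Sigma)
  also have "\<dots> = (\<Sum>a\<in>A. if p a > 0 then F (a, p a - 1) 0 + F (a, p a - 1) 1 else 0)"
  proof (intro sum.cong refl)
    fix a assume a: "a \<in> A"
    \<comment> \<open>Faces in an earlier angle are degenerate: there the functions no longer depend
      on the last angle of the factor.\<close>
    have F0: "F (a, i) c = 0" if i: "i < p a - 1" and c: "c \<in> {0, 1}" for i c
    proof -
      let ?s = "(a, i)" and ?t = "(a, p a - 1)"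
      have st: "?t \<in> S - {?s}" using a i by (auto simp: S_def block_indices_def)
      have "path_sum (S - {?s}) us ((grid_even L (S - {?s}) k)(?s := c)) (grid_odd L (S - {?s}) k) = 0" for k
      proof (rule path_sum_eq_0[OF st])
        fix u' and z :: "'a \<times> nat \<Rightarrow> real"
        assume u': "u' \<in> set us"
          and z: "\<And>s. s \<notin> S - {?s} \<Longrightarrow> z s = ((grid_even L (S - {?s}) k)(?s := c)) s"
        have zs: "z ?s = c" using z[of ?s] by simp
        have "sphere_product_map A p (z(?t := d)) = sphere_product_map A p z" for d
        proof (rule sphere_product_map_cong)
          fix b assume "b \<in> A"
          show "sphere_coords (p b) (\<lambda>i. (z(?t := d)) (b, i)) = sphere_coords (p b) (\<lambda>i. z (b, i))"
          proof (cases "b = a")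
            case True
            have e: "(\<lambda>i. (z(?t := d)) (a, i)) = (\<lambda>i. z (a, i))(p a - 1 := d)" by auto
            show ?thesis
              unfolding True e using i zs c by (intro sphere_coords_degenerate[of i]) auto
          qed auto
        qed
        then show "u' (z(?t := grid_odd L (S - {?s}) k ?t)) = u' z"
          using u' by (auto simp: us_def)
      qed (use finS cardS a i in \<open>auto simp: S_def block_indices_def\<close>)
      then show ?thesis by (simp add: F_def)
    qed
    show "(\<Sum>i<p a. F (a, i) 0 + F (a, i) 1) = (if p a > 0 then F (a, p a - 1) 0 + F (a, p a - 1) 1 else 0)"
    proof (cases "p a")
      case (Suc j)
      then show ?thesis using F0 by simp
    qed simp
  qed
  also have "\<dots> = (\<Sum>a\<in>A. if a \<in> X \<and> p a > 0 then sphere_count L A (p(a := p a - 1)) vs else 0)"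
  proof (intro sum.cong refl)
    fix a assume a: "a \<in> A"
    show "(if p a > 0 then F (a, p a - 1) 0 + F (a, p a - 1) 1 else 0) =
      (if a \<in> X \<and> p a > 0 then sphere_count L A (p(a := p a - 1)) vs else 0)"
    proof (cases "p a > 0")
      case pa: True
      define j where "j = p a - 1"
      have pj: "p a = Suc j" using pa by (simp add: j_def)
      let ?s = "(a, j)"
      define q where "q = p(a := j)"
      define S' where "S' = S - {?s}"
      define us' where "us' = map (\<lambda>v z. v (sphere_product_map A q z)) vs"
      define u' where "u' z = v (sphere_product_map A q z)" for z
      \<comment> \<open>The reflection in \<open>sphere_coords_face_1\<close>, applied to factor
        \<open>a\<close> only.\<close>
      define \<rho> where "\<rho> = (\<lambda>(b, i) c. if b = a \<and> i \<le> j then 1 - c else c :: real)"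
      \<comment> \<open>\<open>G\<close> occurs on both faces and cancels; \<open>C\<close> is
        multiplied by the shift of \<open>v\<close>.\<close>
      define G where "G = (\<Sum>k\<in>P S'. u' (grid_even L S' k) * path_sum S' us' (grid_even L S' k) (grid_odd L S' k))"
      define C where "C = (\<Sum>k\<in>P S'. path_sum S' us' (grid_even L S' k) (grid_odd L S' k))"
      have S'q: "S' = block_indices A q"
        using pj by (auto simp: S'_def S_def block_indices_def q_def split: if_splits)
      have face0: "sphere_product_map A p z = sphere_product_map A q z" if "z ?s = 0" for z
        using that by (intro sphere_product_map_cong) (auto simp: q_def pj sphere_coords_face_0)
      have face1: "sphere_product_map A p z = antipode_at a (sphere_product_map A q (\<lambda>t. \<rho> t (z t)))" if z: "z ?s = 1" for z
      proof
        fix b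
        show "sphere_product_map A p z b = antipode_at a (sphere_product_map A q (\<lambda>t. \<rho> t (z t))) b"
        proof (cases "b = a")
          case True
          then show ?thesis
            using a sphere_coords_face_1[of "\<lambda>i. z (a, i)" j] z
            by (simp add: sphere_product_map_def antipode_at_def q_def pj \<rho>_def)
        next
          case False
          then show ?thesis
            by (simp add: sphere_product_map_def antipode_at_def q_def \<rho>_def)
        qed
      qed
      have eqv': "((v # vs) ! i) (antipode_at a (sphere_product_map A q z)) =
        ((v # vs) ! i) (sphere_product_map A q z) + of_bool (a \<in> (X # Xs) ! i)" if "i < Suc (length vs)" for i z
        using eqv[OF that a, of q] by (simp add: q_def pj)
      have "F ?s 0 = G"
        unfolding F_def G_def S'_def[symmetric]
      proof (intro sum.cong refl)
        fix k
        have id: "(grid_even L S' k)(?s := 0) = grid_even L S' k"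
          by (auto simp: grid_even_def S'_def)
        have z0: "grid_even L S' k ?s = 0" by (simp add: grid_even_def S'_def)
        have "path_sum S' us (grid_even L S' k) (grid_odd L S' k) = path_sum S' us' (grid_even L S' k) (grid_odd L S' k)"
        proof (rule path_sum_transform[where \<rho> = "\<lambda>_ c. c"], unfold list_all2_conv_all_nth, intro conjI allI impI)
          fix i assume "i < length us"
          then have i: "i < length vs" by (simp add: us_def)
          show "\<exists>d. \<forall>z. (\<forall>t. t \<notin> S' \<longrightarrow> z t = grid_even L S' k t) \<longrightarrow> (us ! i) z = d + (us' ! i) (\<lambda>t. z t)"
          proof (intro exI allI impI)
            fix z assume "\<forall>t. t \<notin> S' \<longrightarrow> z t = grid_even L S' k t"
            then have "z ?s = 0" using z0 by (simp add: S'_def)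
            then show "(us ! i) z = 0 + (us' ! i) (\<lambda>t. z t)"
              using i face0 by (simp add: us_def us'_def)
          qed
        qed (simp add: us_def us'_def)
        then show "u ((grid_even L S' k)(?s := 0)) * path_sum S' us ((grid_even L S' k)(?s := 0)) (grid_odd L S' k) =
          u' (grid_even L S' k) * path_sum S' us' (grid_even L S' k) (grid_odd L S' k)"
          unfolding id u_def u'_def using face0[of "grid_even L S' k", OF z0] by simp
      qed
      moreover have "F ?s 1 = G + of_bool (a \<in> X) * C"
      proof -
        \<comment> \<open>The mirror image of subinterval \<open>k\<close> is number
          \<open>2*L - 1 - k\<close>; since \<open>2*L\<close> is even, even ends are sent to even
          ends.\<close>
        define r where "r k = (\<lambda>t\<in>S'. if fst t = a then 2*L - 1 - k t else k t)" for k :: "'a \<times> nat \<Rightarrow> nat"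
        have rP: "r k \<in> P S'" and rr: "r (r k) = k" if "k \<in> P S'" for k
        proof -
          have "k t < 2*L" if "t \<in> S'" for t
            using \<open>k \<in> P S'\<close> that by (auto simp: P_def)
          note lt = this
          show "r k \<in> P S'"
            unfolding P_def r_def by (rule restrict_PiE_iff[THEN iffD2]) (use lt L in auto)
          show "r (r k) = k"
          proof
            fix t
            show "r (r k) t = k t"
              using lt[of t] PiE_arb[OF that[unfolded P_def], of t] by (cases "t \<in> S'") (auto simp: r_def)
          qed
        qed
        have reflect: "(\<lambda>t. \<rho> t (((grid_even L S' k)(?s := 1)) t)) = grid_even L S' (r k)"
          "\<forall>t\<in>S'. \<rho> t (grid_odd L S' k t) = grid_odd L S' (r k) t" if k: "k \<in> P S'" for k
        proof -
          have lt: "k t < 2*L" if "t \<in> S'" for t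
            using k that by (auto simp: P_def)
          have ee: "real (even_end (2*L - 1 - i)) = 2*L - real (even_end i)"
            "real (odd_end (2*L - 1 - i)) = 2*L - real (odd_end i)" if "i < 2*L" for i
            using that by (auto simp: even_end_def odd_end_def of_nat_diff)
          have jj: "i \<le> j" if "(a, i) \<in> S'" for i
            using that pj by (auto simp: S'_def S_def block_indices_def)
          have jj': "(a, i) \<in> S'" if "i \<le> j" "i \<noteq> j" for i
            using that pj a by (auto simp: S'_def S_def block_indices_def)
          show "(\<lambda>t. \<rho> t (((grid_even L S' k)(?s := 1)) t)) = grid_even L S' (r k)"
          proof
            fix t :: "'a \<times> nat"
            obtain b i where t: "t = (b, i)" by (cases t)
            show "\<rho> t (((grid_even L S' k)(?s := 1)) t) = grid_even L S' (r k) t"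
            proof (cases "t \<in> S'")
              case True
              then have "t \<noteq> ?s" by (simp add: S'_def)
              then show ?thesis
                using True L ee(1)[OF lt[OF True]] jj[of i]
                by (auto simp: t \<rho>_def grid_even_def r_def diff_divide_distrib)
            next
              case False
              then show ?thesis
                using jj'[of i] by (auto simp: t \<rho>_def grid_even_def)
            qed
          qed
          show "\<forall>t\<in>S'. \<rho> t (grid_odd L S' k t) = grid_odd L S' (r k) t"
          proof
            fix t assume t: "t \<in> S'"
            obtain b i where bi: "t = (b, i)" by (cases t)
            show "\<rho> t (grid_odd L S' k t) = grid_odd L S' (r k) t"
              using t L ee(2)[OF lt[OF t]] jj[of i]
              by (auto simp: bi \<rho>_def grid_odd_def r_def diff_divide_distrib)
          qed
        qed
        have "F ?s 1 = (\<Sum>k\<in>P S'. (u' (grid_even L S' (r k)) + of_bool (a \<in> X)) * path_sum S' us' (grid_even L S' (r k)) (grid_odd L S' (r k)))"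
          unfolding F_def S'_def[symmetric]
        proof (intro sum.cong refl)
          fix k assume k: "k \<in> P S'"
          let ?x = "(grid_even L S' k)(?s := 1)"
          have z1: "?x ?s = 1" by simp
          have "path_sum S' us ?x (grid_odd L S' k) = path_sum S' us' (\<lambda>t. \<rho> t (?x t)) (\<lambda>t. \<rho> t (grid_odd L S' k t))"
          proof (rule path_sum_transform, unfold list_all2_conv_all_nth, intro conjI allI impI)
            fix i assume "i < length us"
            then have i: "i < length vs" by (simp add: us_def)
            show "\<exists>d. \<forall>z. (\<forall>t. t \<notin> S' \<longrightarrow> z t = ?x t) \<longrightarrow> (us ! i) z = d + (us' ! i) (\<lambda>t. \<rho> t (z t))"
            proof (intro exI allI impI)
              fix z assume "\<forall>t. t \<notin> S' \<longrightarrow> z t = ?x t"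
              then have "z ?s = 1" by (simp add: S'_def)
              then show "(us ! i) z = of_bool (a \<in> Xs ! i) + (us' ! i) (\<lambda>t. \<rho> t (z t))"
                using i eqv'[of "Suc i"] face1 by (simp add: us_def us'_def add.commute)
            qed
          qed (simp add: us_def us'_def)
          also have "\<dots> = path_sum S' us' (grid_even L S' (r k)) (grid_odd L S' (r k))"
            unfolding reflect(1)[OF k] by (rule path_sum_cong_target) (use reflect(2)[OF k] in auto)
          finally show "u ?x * path_sum S' us ?x (grid_odd L S' k) =
            (u' (grid_even L S' (r k)) + of_bool (a \<in> X)) * path_sum S' us' (grid_even L S' (r k)) (grid_odd L S' (r k))"
            using face1[of ?x, OF z1] eqv'[of 0] reflect(1)[OF k] by (simp add: u_def u'_def)
        qed
        also have "\<dots> = (\<Sum>k\<in>P S'. (u' (grid_even L S' k) + of_bool (a \<in> X)) * path_sum S' us' (grid_even L S' k) (grid_odd L S' k))"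
          by (rule sum.reindex_bij_witness[where i = r and j = r]) (use rP rr in auto)
        also have "\<dots> = G + of_bool (a \<in> X) * C"
          by (simp add: G_def C_def distrib_right sum.distrib sum_distrib_left)
        finally show ?thesis .
      qed
      moreover have "C = sphere_count L A q vs"
        by (simp add: C_def sphere_count_def cube_sum_def S'q us'_def P_def)
      ultimately show ?thesis
        unfolding j_def[symmetric] q_def using pa by simp
    qed simp
  qed
  also have "\<dots> = (\<Sum>a | a \<in> A \<and> a \<in> X \<and> p a > 0. sphere_count L A (p(a := p a - 1)) vs)"
    using A by (simp add: sum.inter_filter[symmetric])
  finally show ?thesis .
qed

text \<open>Both sides obey the same recursion. Equivariance is demanded for all \<open>q\<close>
  below \<open>p\<close> because the recursion descends through the lower hemispheres.\<close>

theorem sphere_count_eq_forms_coeff: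
  assumes A: "finite A" and L: "L > 0" and card: "(\<Sum>a\<in>A. p a) = length vs"
    and len: "length Xs = length vs"
    and eqv: "\<And>i a q z. i < length vs \<Longrightarrow> a \<in> A \<Longrightarrow> (\<And>a. q a \<le> p a) \<Longrightarrow>
      (vs ! i) (antipode_at a (sphere_product_map A q z)) =
      (vs ! i) (sphere_product_map A q z) + of_bool (a \<in> Xs ! i)"
  shows "sphere_count L A p vs = forms_coeff A p Xs"
  using card len eqv
proof (induction vs arbitrary: p Xs)
  case Nil
  then show ?case using A by (simp add: sphere_count_Nil)
next
  case (Cons v vs)
  obtain X Xs' where Xs: "Xs = X # Xs'" using Cons.prems by (cases Xs) auto
  have "sphere_count L A p (v # vs) = (\<Sum>a | a \<in> A \<and> a \<in> X \<and> p a > 0. sphere_count L A (p(a := p a - 1)) vs)"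
    using Cons.prems by (intro sphere_count_Cons[OF A L]) (auto simp: Xs)
  also have "\<dots> = (\<Sum>a | a \<in> A \<and> a \<in> X \<and> p a > 0. forms_coeff A (p(a := p a - 1)) Xs')"
  proof (intro sum.cong refl Cons.IH)
    fix a assume a: "a \<in> {a. a \<in> A \<and> a \<in> X \<and> p a > 0}"
    have "(\<Sum>b\<in>A. (p(a := p a - 1)) b) = (p a - 1) + (\<Sum>b\<in>A - {a}. p b)"
      using sum.remove[OF A, of a "p(a := p a - 1)"] a by simp
    moreover have "(\<Sum>b\<in>A. p b) = p a + (\<Sum>b\<in>A - {a}. p b)"
      using A a by (simp add: sum.remove)
    ultimately show "(\<Sum>b\<in>A. (p(a := p a - 1)) b) = length vs"
      using Cons.prems(1) a by simp
    show "length Xs' = length vs" using Cons.prems Xs by simp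
    fix i b q z assume "i < length vs" "b \<in> A" and q: "\<And>c. q c \<le> (p(a := p a - 1)) c"
    moreover have "q c \<le> p c" for c using q[of c] by (auto split: if_splits)
    ultimately show "(vs ! i) (antipode_at b (sphere_product_map A q z)) =
      (vs ! i) (sphere_product_map A q z) + of_bool (b \<in> Xs' ! i)"
      using Cons.prems(3)[of "Suc i" b q z] Xs by simp
  qed
  finally show ?case by (simp add: Xs)
qed

subsection \<open>Lifting homotopies from projective spaces\<close>

lemma in_nsphere_iff: "x \<in> topspace (nsphere n) \<longleftrightarrow> (\<Sum>i\<le>n. (x i)\<^sup>2) = 1 \<and> (\<forall>i>n. x i = 0)"
  by (simp add: nsphere)

lemma continuous_map_nsphere_iff:
  "continuous_map Z (nsphere n) f \<longleftrightarrow>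
    (\<forall>i. continuous_map Z euclideanreal (\<lambda>z. f z i)) \<and> (\<forall>z\<in>topspace Z. f z \<in> topspace (nsphere n))"
  unfolding nsphere continuous_map_in_subtopology continuous_map_componentwise_UNIV by auto

lemma uminus_in_nsphere [simp]: "(\<lambda>i. - x i) \<in> topspace (nsphere n) \<longleftrightarrow> x \<in> topspace (nsphere n)"
  by (simp add: in_nsphere_iff)

lemma continuous_map_nsphere_uminus:
  "continuous_map Z (nsphere n) f \<Longrightarrow> continuous_map Z (nsphere n) (\<lambda>z i. - f z i)"
  by (auto simp: continuous_map_nsphere_iff intro: continuous_intros)

lemma antipodal_class_eq_iff: "antipodal_class x = antipodal_class y \<longleftrightarrow> y = x \<or> y = (\<lambda>i. - x i)"
  by (auto simp: antipodal_class_def doubleton_eq_iff)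

lemma antipodal_class_uminus [simp]: "antipodal_class (\<lambda>i. - x i) = antipodal_class x"
  by (auto simp: antipodal_class_eq_iff)

lemma quotient_map_antipodal_class: "quotient_map (nsphere n) (real_projective_space n) antipodal_class"
  unfolding real_projective_space_def by (rule quotient_map_quotient_topology)

lemma continuous_map_antipodal_class: "continuous_map (nsphere n) (real_projective_space n) antipodal_class"
  by (rule quotient_imp_continuous_map[OF quotient_map_antipodal_class])

lemma topspace_real_projective_space: "topspace (real_projective_space n) = antipodal_class ` topspace (nsphere n)"
  by (simp add: real_projective_space_def)

lemma real_projective_spaceE:
  assumes "c \<in> topspace (real_projective_space n)"
  obtains v where "v \<in> topspace (nsphere n)" "c = antipodal_class v"
  using assms by (auto simp: topspace_real_projective_space)

lemma nsphere_ne_uminus: "x \<in> topspace (nsphere n) \<Longrightarrow> x \<noteq> (\<lambda>i. - x i)"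
proof
  assume x: "x \<in> topspace (nsphere n)" and "x = (\<lambda>i. - x i)"
  then have "x i = 0" for i by (metis eq_numeral_extra(2) equal_neg_zero)
  then show False using x by (simp add: in_nsphere_iff)
qed

text \<open>The entries of the matrix \<open>v v^T\<close>. They are insensitive to the sign of
  \<open>v\<close>, hence independent of the choice and continuous on the quotient; further real
  functions on projective space are built from them.\<close>

definition proj_matrix :: "(nat \<Rightarrow> real) set \<Rightarrow> nat \<Rightarrow> nat \<Rightarrow> real" where
  "proj_matrix c i j = (SOME v. v \<in> c) i * (SOME v. v \<in> c) j"

lemma proj_matrix_class [simp]: "proj_matrix (antipodal_class v) i j = v i * v j"
proof -
  have "(SOME w. w \<in> antipodal_class v) \<in> antipodal_class v"
    by (rule someI[of _ v]) (simp add: antipodal_class_def)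
  then show ?thesis by (auto simp: proj_matrix_def antipodal_class_def)
qed

lemma continuous_map_proj_matrix: "continuous_map (real_projective_space n) euclideanreal (\<lambda>c. proj_matrix c i j)"
proof -
  have "continuous_map (nsphere n) euclideanreal ((\<lambda>c. proj_matrix c i j) \<circ> antipodal_class)"
    unfolding comp_def proj_matrix_class
    by (intro continuous_map_real_mult continuous_map_nsphere_projection)
  then show ?thesis
    using continuous_compose_quotient_map_eq[OF quotient_map_antipodal_class] by blast
qed

text \<open>The representative of \<open>c\<close> on the same side as \<open>w\<close>, that is, \<open>v\<langle>v,w\<rangle>/\<bar>\<langle>v,w\<rangle>\<bar>\<close> for \<open>c = {v, -v}\<close>.\<close>

definition nearest_rep :: "nat \<Rightarrow> (nat \<Rightarrow> real) set \<Rightarrow> (nat \<Rightarrow> real) \<Rightarrow> nat \<Rightarrow> real" where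
  "nearest_rep n c w i = (\<Sum>j\<le>n. proj_matrix c i j * w j) / sqrt (\<Sum>i\<le>n. \<Sum>j\<le>n. proj_matrix c i j * w i * w j)"

lemma quadratic_form_class:
  "(\<Sum>i\<le>n. \<Sum>j\<le>n. proj_matrix (antipodal_class v) i j * w i * w j) = (\<Sum>j\<le>n. v j * w j)\<^sup>2"
  by (simp add: power2_eq_square sum_product algebra_simps)

lemma nearest_rep_class:
  "nearest_rep n (antipodal_class v) w = (\<lambda>i. v i * sgn (\<Sum>j\<le>n. v j * w j))"
proof
  fix i
  have "(\<Sum>j\<le>n. v i * v j * w j) = v i * (\<Sum>j\<le>n. v j * w j)"
    by (simp add: sum_distrib_left mult.assoc)
  then show "nearest_rep n (antipodal_class v) w i = v i * sgn (\<Sum>j\<le>n. v j * w j)"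
    unfolding nearest_rep_def quadratic_form_class by (simp add: sgn_if)
qed

lemma nearest_rep_props:
  assumes "c \<in> topspace (real_projective_space n)" "(\<Sum>i\<le>n. \<Sum>j\<le>n. proj_matrix c i j * w i * w j) \<noteq> 0"
  shows "antipodal_class (nearest_rep n c w) = c" "nearest_rep n c w \<in> topspace (nsphere n)"
    "(\<Sum>j\<le>n. nearest_rep n c w j * w j) > 0"
proof -
  obtain v where v: "v \<in> topspace (nsphere n)" "c = antipodal_class v"
    using assms(1) by (rule real_projective_spaceE)
  define s where "s = (\<Sum>j\<le>n. v j * w j)"
  have "s \<noteq> 0" using assms(2) unfolding v quadratic_form_class s_def by auto
  have e: "nearest_rep n c w = (if s > 0 then v else (\<lambda>i. - v i))"
    using \<open>s \<noteq> 0\<close> unfolding v nearest_rep_class by (auto simp: s_def[symmetric] fun_eq_iff)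
  then show "antipodal_class (nearest_rep n c w) = c" "nearest_rep n c w \<in> topspace (nsphere n)"
    using v by auto
  have "(\<Sum>j\<le>n. nearest_rep n c w j * w j) = \<bar>s\<bar>"
    unfolding e using \<open>s \<noteq> 0\<close> by (auto simp: s_def sum_negf)
  then show "(\<Sum>j\<le>n. nearest_rep n c w j * w j) > 0" using \<open>s \<noteq> 0\<close> by simp
qed

lemma nearest_rep_self: "v \<in> topspace (nsphere n) \<Longrightarrow> nearest_rep n (antipodal_class v) v = v"
  unfolding nearest_rep_class in_nsphere_iff by (simp flip: power2_eq_square)

text \<open>The inner product of the two lifts is continuous with values 1 and -1 only.\<close>

lemma lifts_agree_or_opposite:
  assumes "connectedin Z (topspace Z)"
    and f: "continuous_map Z (nsphere n) f" and g: "continuous_map Z (nsphere n) g"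
    and eq: "\<And>z. z \<in> topspace Z \<Longrightarrow> antipodal_class (f z) = antipodal_class (g z)"
  shows "(\<forall>z\<in>topspace Z. g z = f z) \<or> (\<forall>z\<in>topspace Z. g z = (\<lambda>i. - f z i))"
proof -
  define h where "h z = (\<Sum>i\<le>n. f z i * g z i)" for z
  have fS: "(\<Sum>i\<le>n. f z i * f z i) = 1" if "z \<in> topspace Z" for z
    using f that by (auto simp: continuous_map_nsphere_iff in_nsphere_iff power2_eq_square)
  have cm: "continuous_map Z euclideanreal h"
    unfolding h_def using f g by (intro continuous_map_sum continuous_map_real_mult) (auto simp: continuous_map_nsphere_iff)
  have pm: "g z = f z \<and> h z = 1 \<or> g z = (\<lambda>i. - f z i) \<and> h z = -1" if "z \<in> topspace Z" for z
    using eq[OF that] fS[OF that] by (auto simp: antipodal_class_eq_iff h_def sum_negf)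
  have "connectedin euclideanreal (h ` topspace Z)"
    using assms(1) cm by (rule connectedin_continuous_map_image[rotated])
  then have "connected (h ` topspace Z)" by simp
  then have "\<not> (1 \<in> h ` topspace Z \<and> -1 \<in> h ` topspace Z)"
  proof (intro notI, elim conjE)
    assume "connected (h ` topspace Z)" "1 \<in> h ` topspace Z" "-1 \<in> h ` topspace Z"
    then have "0 \<in> h ` topspace Z"
      by (meson connectedD_interval neg_le_0_iff_le zero_le_one)
    then show False using pm by force
  qed
  then show ?thesis using pm by (metis image_eqI)
qed

text \<open>For orthogonal unit vectors the matrices \<open>v v^T\<close> have squared distance 2,
  while uniform continuity keeps the matrices at nearby times close, with one step size for all
  \<open>w\<close>.\<close>

lemma uniform_angle:
  fixes W :: "'w::metric_space set" and H :: "'w \<Rightarrow> real \<Rightarrow> (nat \<Rightarrow> real) set"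
  assumes "compact W"
    and H: "continuous_map (top_of_set (W \<times> {0..1})) (real_projective_space n) (\<lambda>(w, t). H w t)"
  obtains N :: nat where "N > 0"
    "\<And>w t t' v v'. w \<in> W \<Longrightarrow> t \<in> {0..1} \<Longrightarrow> t' \<in> {0..1} \<Longrightarrow> \<bar>t - t'\<bar> \<le> 1 / N \<Longrightarrow>
      H w t = antipodal_class v \<Longrightarrow> H w t' = antipodal_class v' \<Longrightarrow>
      v \<in> topspace (nsphere n) \<Longrightarrow> v' \<in> topspace (nsphere n) \<Longrightarrow> (\<Sum>j\<le>n. v j * v' j) \<noteq> 0"
proof -
  define e where "e = (\<lambda>i j (w, t). proj_matrix (H w t) i j)"
  \<comment> \<open>There are \<open>(n + 1)\<^sup>2\<close> matrix entries, so this bound on each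
    keeps the squared distance at most 1, which is less than 2.\<close>
  define \<epsilon> where "\<epsilon> = 1 / (real n + 1)"
  have \<epsilon>: "\<epsilon> > 0" by (simp add: \<epsilon>_def)
  have "continuous_on (W \<times> {0..1}) (e i j)" for i j
    using continuous_map_compose[OF H continuous_map_proj_matrix[of n i j]]
    by (simp add: comp_def e_def case_prod_unfold)
  then have "uniformly_continuous_on (W \<times> {0..1}) (e i j)" for i j
    by (intro compact_uniformly_continuous compact_Times assms(1)) auto
  then have "\<exists>d>0. \<forall>x\<in>W \<times> {0..1}. \<forall>x'\<in>W \<times> {0..1}. dist x' x < d \<longrightarrow> dist (e i j x') (e i j x) < \<epsilon>" for i j
    using \<epsilon> unfolding uniformly_continuous_on_def by blast
  then obtain d where d: "\<And>i j. d i j > 0"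
    "\<And>i j x x'. x \<in> W \<times> {0..1} \<Longrightarrow> x' \<in> W \<times> {0..1} \<Longrightarrow> dist x' x < d i j \<Longrightarrow> dist (e i j x') (e i j x) < \<epsilon>"
    by metis
  define D where "D = Min ((\<lambda>(i, j). d i j) ` ({..n} \<times> {..n}))"
  have "D > 0" unfolding D_def by (subst Min_gr_iff) (auto simp: d)
  have Dle: "D \<le> d i j" if "i \<le> n" "j \<le> n" for i j
    unfolding D_def by (intro Min_le) (use that in auto)
  obtain N :: nat where N: "N > 0" "1 / N < D"
    using \<open>D > 0\<close> by (metis nat_approx_posE zero_less_Suc)
  show ?thesis
  proof (rule that[OF N(1)])
    fix w t t' v v'
    assume w: "w \<in> W" and t: "t \<in> {0..1}" "t' \<in> {0..1}" "\<bar>t - t'\<bar> \<le> 1 / N"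
      and v: "H w t = antipodal_class v" "H w t' = antipodal_class v'"
        "v \<in> topspace (nsphere n)" "v' \<in> topspace (nsphere n)"
    show "(\<Sum>j\<le>n. v j * v' j) \<noteq> 0"
    proof
      assume 0: "(\<Sum>j\<le>n. v j * v' j) = 0"
      have norm: "(\<Sum>i\<le>n. \<Sum>j\<le>n. (x i * x j) * (x i * x j)) = 1" if "x \<in> topspace (nsphere n)" for x
      proof -
        have "(\<Sum>i\<le>n. \<Sum>j\<le>n. (x i * x j) * (x i * x j)) = (\<Sum>i\<le>n. (x i)\<^sup>2) * (\<Sum>j\<le>n. (x j)\<^sup>2)"
          by (simp add: sum_product power2_eq_square ac_simps)
        then show ?thesis using that by (simp add: in_nsphere_iff)
      qed
      have "(\<Sum>i\<le>n. \<Sum>j\<le>n. (v i * v j) * (v' i * v' j)) = (\<Sum>j\<le>n. v j * v' j) * (\<Sum>j\<le>n. v j * v' j)"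
        by (simp add: sum_product ac_simps)
      then have cross: "(\<Sum>i\<le>n. \<Sum>j\<le>n. (v i * v j) * (v' i * v' j)) = 0" using 0 by simp
      have "(\<Sum>i\<le>n. \<Sum>j\<le>n. (v i * v j - v' i * v' j)\<^sup>2) =
        (\<Sum>i\<le>n. \<Sum>j\<le>n. (v i * v j) * (v i * v j)) + (\<Sum>i\<le>n. \<Sum>j\<le>n. (v' i * v' j) * (v' i * v' j))
        - 2 * (\<Sum>i\<le>n. \<Sum>j\<le>n. (v i * v j) * (v' i * v' j))"
        by (simp add: sum.distrib sum_subtractf sum_distrib_left power2_eq_square algebra_simps)
      also have "\<dots> = 2" using norm[OF v(3)] norm[OF v(4)] cross by simp
      finally have two: "(\<Sum>i\<le>n. \<Sum>j\<le>n. (v i * v j - v' i * v' j)\<^sup>2) = 2" .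
      have small: "(v i * v j - v' i * v' j)\<^sup>2 \<le> \<epsilon>\<^sup>2" if ij: "i \<le> n" "j \<le> n" for i j
      proof -
        have "dist (w, t) (w, t') < d i j"
          using t(3) N(2) Dle[OF ij] by (simp add: dist_Pair_Pair dist_real_def)
        then have "dist (e i j (w, t)) (e i j (w, t')) < \<epsilon>"
          using w t by (intro d(2)) auto
        then have "\<bar>v i * v j - v' i * v' j\<bar> \<le> \<epsilon>"
          by (simp add: e_def v dist_real_def)
        then show ?thesis
          using \<epsilon> by (simp add: abs_le_square_iff[symmetric])
      qed
      have "(\<Sum>i\<le>n. \<Sum>j\<le>n. (v i * v j - v' i * v' j)\<^sup>2) \<le> (\<Sum>i\<le>n. \<Sum>j\<le>n. \<epsilon>\<^sup>2)"
        using small by (intro sum_mono) auto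
      also have "\<dots> = (real n + 1) * (real n + 1) * \<epsilon>\<^sup>2" by (simp add: algebra_simps)
      also have "\<dots> = 1"
        by (simp add: \<epsilon>_def power2_eq_square)
      finally show False using two by simp
    qed
  qed
qed

text \<open>On a time slice of length \<open>1 / N\<close> no class is orthogonal to the lift at the
  start of the slice. The nearest representative is thus unambiguous and extends the lift
  continuously, for all \<open>w\<close> at once.\<close>

theorem projective_homotopy_lifting:
  fixes W :: "'w::metric_space set" and H :: "'w \<Rightarrow> real \<Rightarrow> (nat \<Rightarrow> real) set"
  assumes W: "compact W"
    and H: "continuous_map (top_of_set (W \<times> {0..1})) (real_projective_space n) (\<lambda>(w, t). H w t)"
    and h0: "continuous_map (top_of_set W) (nsphere n) h0"
    and H0: "\<And>w. w \<in> W \<Longrightarrow> antipodal_class (h0 w) = H w 0"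
  shows "\<exists>h. continuous_map (top_of_set (W \<times> {0..1})) (nsphere n) (\<lambda>(w, t). h w t) \<and>
    (\<forall>w\<in>W. h w 0 = h0 w) \<and> (\<forall>w\<in>W. \<forall>t\<in>{0..1}. antipodal_class (h w t) = H w t)"
proof -
  obtain N :: nat where N: "N > 0"
    and angle: "\<And>w t t' v v'. w \<in> W \<Longrightarrow> t \<in> {0..1} \<Longrightarrow> t' \<in> {0..1} \<Longrightarrow> \<bar>t - t'\<bar> \<le> 1 / N \<Longrightarrow>
      H w t = antipodal_class v \<Longrightarrow> H w t' = antipodal_class v' \<Longrightarrow>
      v \<in> topspace (nsphere n) \<Longrightarrow> v' \<in> topspace (nsphere n) \<Longrightarrow> (\<Sum>j\<le>n. v j * v' j) \<noteq> 0"
    using uniform_angle[OF W H] by blast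
  have HP: "H w t \<in> topspace (real_projective_space n)" if "w \<in> W" "t \<in> {0..1}" for w t
    using funcset_mem[OF continuous_map_funspace[OF H], of "(w, t)"] that by simp
  have ce: "continuous_on (W \<times> {0..1}) (\<lambda>(w, t). proj_matrix (H w t) i j)" for i j
    using continuous_map_compose[OF H continuous_map_proj_matrix[of n i j]]
    by (simp add: comp_def case_prod_unfold)
  have "\<exists>h. (\<forall>i. continuous_on (W \<times> {0..real k / N}) (\<lambda>(w, t). h w t i)) \<and>
    (\<forall>w\<in>W. h w 0 = h0 w) \<and> (\<forall>w\<in>W. \<forall>t\<in>{0..real k / N}. h w t \<in> topspace (nsphere n) \<and> antipodal_class (h w t) = H w t)"
    if "k \<le> N" for k
    using that
  proof (induction k)
    case 0
    have "continuous_on W (\<lambda>w. h0 w i)" for i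
      using h0 by (simp add: continuous_map_nsphere_iff)
    then have "continuous_on (W \<times> {0}) (\<lambda>x. h0 (fst x) i)" for i
      by (rule continuous_on_compose2[OF _ continuous_on_fst[OF continuous_on_id]]) auto
    then have "continuous_on (W \<times> {0}) (\<lambda>(w, t). h0 w i)" for i
      by (simp add: case_prod_unfold)
    moreover have "h0 w \<in> topspace (nsphere n)" if "w \<in> W" for w
      using h0 that by (auto simp: continuous_map_nsphere_iff)
    ultimately show ?case
      using H0 by (intro exI[of _ "\<lambda>w t. h0 w"]) auto
  next
    case (Suc k)
    define T where "T = real k / N"
    define T' where "T' = real (Suc k) / N"
    have TT: "0 \<le> T" "T \<le> T'" "T' \<le> 1" "T' - T = 1 / N"
      using N Suc.prems by (auto simp: T_def T'_def divide_simps)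
    obtain h where "(\<forall>i. continuous_on (W \<times> {0..T}) (\<lambda>(w, t). h w t i)) \<and>
      (\<forall>w\<in>W. h w 0 = h0 w) \<and> (\<forall>w\<in>W. \<forall>t\<in>{0..T}. h w t \<in> topspace (nsphere n) \<and> antipodal_class (h w t) = H w t)"
      using Suc.IH Suc.prems unfolding T_def by (meson Suc_leD)
    then have h: "\<And>i. continuous_on (W \<times> {0..T}) (\<lambda>(w, t). h w t i)"
      "\<And>w. w \<in> W \<Longrightarrow> h w 0 = h0 w" "\<And>w t. w \<in> W \<Longrightarrow> t \<in> {0..T} \<Longrightarrow> h w t \<in> topspace (nsphere n)"
      "\<And>w t. w \<in> W \<Longrightarrow> t \<in> {0..T} \<Longrightarrow> antipodal_class (h w t) = H w t"
      by simp_all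
    define g where "g w t = nearest_rep n (H w t) (h w T)" for w t
    define h' where "h' w t = (if t \<le> T then h w t else g w t)" for w t
    have nz: "(\<Sum>i\<le>n. \<Sum>j\<le>n. proj_matrix (H w t) i j * h w T i * h w T j) \<noteq> 0" if w: "w \<in> W" and t: "t \<in> {T..T'}" for w t
    proof -
      obtain v where v: "v \<in> topspace (nsphere n)" "H w t = antipodal_class v"
        using HP[of w t] w t TT by (auto elim: real_projective_spaceE)
      have "(\<Sum>j\<le>n. v j * h w T j) \<noteq> 0"
        by (rule angle[OF w, of t T]) (use v h w t TT in auto)
      then show ?thesis unfolding v quadratic_form_class by simp
    qed
    have gT: "g w T = h w T" if "w \<in> W" for w
      using nearest_rep_self[OF h(3)[OF that, of T]] h(4)[OF that, of T] TT by (simp add: g_def)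
    have cont_g: "continuous_on (W \<times> {T..T'}) (\<lambda>(w, t). g w t i)" for i
    proof -
      have 1: "continuous_on (W \<times> {T..T'}) (\<lambda>x. proj_matrix (H (fst x) (snd x)) i j)" for i j
        by (rule continuous_on_subset[OF ce[of i j, unfolded case_prod_unfold]]) (use TT in auto)
      have "continuous_on (W \<times> {T..T'}) (\<lambda>x. (\<lambda>(w, t). h w t j) (fst x, T))" for j
        by (rule continuous_on_compose2[OF h(1)]) (use TT in \<open>auto intro!: continuous_intros\<close>)
      then have 2: "continuous_on (W \<times> {T..T'}) (\<lambda>x. h (fst x) T j)" for j by simp
      show ?thesis
        unfolding g_def nearest_rep_def case_prod_unfold
        by (intro continuous_intros 1 2) (use nz in auto)
    qed
    have un: "W \<times> {0..T'} = W \<times> {0..T} \<union> W \<times> {T..T'}" using TT by auto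
    have "continuous_on (W \<times> {0..T'}) (\<lambda>(w, t). h' w t i)" for i
    proof -
      have "continuous_on (W \<times> {0..T} \<union> W \<times> {T..T'}) (\<lambda>x. if snd x \<le> T then h (fst x) (snd x) i else g (fst x) (snd x) i)"
      proof (rule continuous_on_cases)
        show "closed (W \<times> {0..T})" "closed (W \<times> {T..T'})"
          using W by (simp_all add: closed_Times compact_imp_closed)
      qed (use h(1) cont_g gT in \<open>auto simp: case_prod_unfold\<close>)
      then show ?thesis unfolding un h'_def by (simp add: case_prod_unfold if_distrib[of "\<lambda>f. f i"])
    qed
    moreover have "h' w 0 = h0 w" if "w \<in> W" for w
      using TT h(2)[OF that] by (simp add: h'_def)
    moreover have "h' w t \<in> topspace (nsphere n) \<and> antipodal_class (h' w t) = H w t" if "w \<in> W" "t \<in> {0..T'}" for w t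
    proof (cases "t \<le> T")
      case True
      then show ?thesis using h(3,4)[of w t] that by (simp add: h'_def)
    next
      case False
      then show ?thesis
        using nearest_rep_props(1,2)[OF HP nz, of w t] that TT by (simp add: h'_def g_def)
    qed
    ultimately show ?case unfolding T'_def[symmetric] by blast
  qed
  from this[of N] obtain h where "\<forall>i. continuous_on (W \<times> {0..1}) (\<lambda>(w, t). h w t i)"
    "\<forall>w\<in>W. h w 0 = h0 w" "\<forall>w\<in>W. \<forall>t\<in>{0..1}. h w t \<in> topspace (nsphere n) \<and> antipodal_class (h w t) = H w t"
    using N by auto
  then show ?thesis
    by (intro exI[of _ h]) (auto simp: continuous_map_nsphere_iff case_prod_unfold)
qed

text \<open>Parallel transport along \<open>\<alpha>\<close> in the double covering by the sphere,
  as a relation between the fibres over the two ends.\<close>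

definition lifts_to :: "nat \<Rightarrow> (real \<Rightarrow> (nat \<Rightarrow> real) set) \<Rightarrow> (nat \<Rightarrow> real) \<Rightarrow> (nat \<Rightarrow> real) \<Rightarrow> bool" where
  "lifts_to n \<alpha> v w \<longleftrightarrow> (\<exists>\<gamma>. continuous_map (top_of_set {0..1}) (nsphere n) \<gamma> \<and> \<gamma> 0 = v \<and> \<gamma> 1 = w \<and>
    (\<forall>t\<in>{0..1}. antipodal_class (\<gamma> t) = \<alpha> t))"

lemma lifts_to_uminus: "lifts_to n \<alpha> (\<lambda>i. - v i) (\<lambda>i. - w i) \<longleftrightarrow> lifts_to n \<alpha> v w"
proof -
  have "lifts_to n \<alpha> (\<lambda>i. - v i) (\<lambda>i. - w i)" if l: "lifts_to n \<alpha> v w" for v w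
  proof -
    obtain \<gamma> where "continuous_map (top_of_set {0..1}) (nsphere n) \<gamma>" "\<gamma> 0 = v" "\<gamma> 1 = w"
      "\<forall>t\<in>{0..1}. antipodal_class (\<gamma> t) = \<alpha> t"
      using l by (auto simp: lifts_to_def)
    then show ?thesis
      unfolding lifts_to_def by (intro exI[of _ "\<lambda>t i. - \<gamma> t i"]) (auto simp: continuous_map_nsphere_uminus)
  qed
  from this[of v w] this[of "\<lambda>i. - v i" "\<lambda>i. - w i"] show ?thesis by auto
qed

lemma lifts_to_unique:
  assumes "lifts_to n \<alpha> v w" "lifts_to n \<alpha> v w'"
  shows "w = w'"
proof -
  obtain \<gamma> \<gamma>' where g: "continuous_map (top_of_set {0..1}) (nsphere n) \<gamma>" "\<gamma> 0 = v" "\<gamma> 1 = w" "\<forall>t\<in>{0..1}. antipodal_class (\<gamma> t) = \<alpha> t"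
    and g': "continuous_map (top_of_set {0..1}) (nsphere n) \<gamma>'" "\<gamma>' 0 = v" "\<gamma>' 1 = w'" "\<forall>t\<in>{0..1}. antipodal_class (\<gamma>' t) = \<alpha> t"
    using assms unfolding lifts_to_def by blast
  have "(\<forall>t\<in>topspace (top_of_set {0..1}). \<gamma>' t = \<gamma> t) \<or> (\<forall>t\<in>topspace (top_of_set {0..1}). \<gamma>' t = (\<lambda>i. - \<gamma> t i))"
    using g g' by (intro lifts_agree_or_opposite) (auto simp: connectedin_subtopology)
  moreover have "v \<in> topspace (nsphere n)"
    using g(1,2) by (force simp: continuous_map_nsphere_iff)
  ultimately show ?thesis
    using g(2,3) g'(2,3) nsphere_ne_uminus[of v n] by auto
qed

text \<open>The end points of the lifted family and \<open>g\<close> lift the same map on the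
  connected set \<open>W\<close>, so they differ by one global sign.\<close>

lemma lifts_to_constant:
  fixes W :: "'w::metric_space set"
  assumes W: "compact W" "connected W"
    and H: "continuous_map (top_of_set (W \<times> {0..1})) (real_projective_space n) (\<lambda>(w, t). H w t)"
    and f: "continuous_map (top_of_set W) (nsphere n) f" "\<And>w. w \<in> W \<Longrightarrow> antipodal_class (f w) = H w 0"
    and g: "continuous_map (top_of_set W) (nsphere n) g" "\<And>w. w \<in> W \<Longrightarrow> antipodal_class (g w) = H w 1"
  shows "(\<forall>w\<in>W. lifts_to n (H w) (f w) (g w) \<and> \<not> lifts_to n (H w) (f w) (\<lambda>i. - g w i)) \<or>
         (\<forall>w\<in>W. \<not> lifts_to n (H w) (f w) (g w) \<and> lifts_to n (H w) (f w) (\<lambda>i. - g w i))"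
proof -
  obtain h where h: "continuous_map (top_of_set (W \<times> {0..1})) (nsphere n) (\<lambda>(w, t). h w t)"
    "\<forall>w\<in>W. h w 0 = f w" "\<forall>w\<in>W. \<forall>t\<in>{0..1}. antipodal_class (h w t) = H w t"
    using projective_homotopy_lifting[OF W(1) H f] by blast
  have "continuous_map (top_of_set W) (top_of_set (W \<times> {0..1})) (\<lambda>w. (w, 1::real))"
    by (auto intro!: continuous_intros)
  from continuous_map_compose[OF this h(1)]
  have h1: "continuous_map (top_of_set W) (nsphere n) (\<lambda>w. h w 1)"
    by (simp add: comp_def)
  have lift: "lifts_to n (H w) (f w) (h w 1)" if w: "w \<in> W" for w
  proof -
    have "continuous_map (top_of_set {0..1}) (top_of_set (W \<times> {0..1})) (\<lambda>t. (w, t::real))"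
      using w by (auto intro!: continuous_intros)
    from continuous_map_compose[OF this h(1)] show ?thesis
      unfolding lifts_to_def using h w by (intro exI[of _ "h w"]) (auto simp: comp_def)
  qed
  have "(\<forall>w\<in>topspace (top_of_set W). h w 1 = g w) \<or> (\<forall>w\<in>topspace (top_of_set W). h w 1 = (\<lambda>i. - g w i))"
    using W g h h1 by (intro lifts_agree_or_opposite) (auto simp: connectedin_subtopology)
  then have cases: "(\<forall>w\<in>W. h w 1 = g w) \<or> (\<forall>w\<in>W. h w 1 = (\<lambda>i. - g w i))" by simp
  have ne: "g w \<noteq> (\<lambda>i. - g w i)" if "w \<in> W" for w
    using g(1) that nsphere_ne_uminus by (auto simp: continuous_map_nsphere_iff)
  from cases show ?thesis
  proof
    assume *: "\<forall>w\<in>W. h w 1 = g w"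
    then show ?thesis using lift lifts_to_unique ne by metis
  next
    assume *: "\<forall>w\<in>W. h w 1 = (\<lambda>i. - g w i)"
    then show ?thesis using lift lifts_to_unique ne by metis
  qed
qed

lemma lifts_to_dichotomy:
  assumes \<alpha>: "continuous_map (top_of_set {0..1}) (real_projective_space n) \<alpha>"
    and "v \<in> topspace (nsphere n)" "w \<in> topspace (nsphere n)"
    and "antipodal_class v = \<alpha> 0" "antipodal_class w = \<alpha> 1"
  shows "lifts_to n \<alpha> v (\<lambda>i. - w i) \<longleftrightarrow> \<not> lifts_to n \<alpha> v w"
    "lifts_to n \<alpha> (\<lambda>i. - v i) w \<longleftrightarrow> \<not> lifts_to n \<alpha> v w"
proof -
  \<comment> \<open>A single path is treated as a family over the one-point set
    \<open>{0}\<close>.\<close>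
  have "continuous_map (top_of_set ({0::real} \<times> {0..1})) (top_of_set {0..1::real}) snd"
    by (auto intro!: continuous_intros)
  from continuous_map_compose[OF this \<alpha>]
  have "continuous_map (top_of_set ({0::real} \<times> {0..1})) (real_projective_space n) (\<lambda>(w, t). \<alpha> t)"
    by (simp add: comp_def case_prod_unfold)
  from lifts_to_constant[OF _ _ this, of "\<lambda>_. v" "\<lambda>_. w"] assms
  show 1: "lifts_to n \<alpha> v (\<lambda>i. - w i) \<longleftrightarrow> \<not> lifts_to n \<alpha> v w" by auto
  then show "lifts_to n \<alpha> (\<lambda>i. - v i) w \<longleftrightarrow> \<not> lifts_to n \<alpha> v w"
    using lifts_to_uminus[of n \<alpha> "\<lambda>i. - v i" w] by simp
qed

subsection \<open>A Borsuk--Ulam theorem for products of spheres\<close>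

lemma sphere_coords_in_nsphere: "sphere_coords p t \<in> topspace (nsphere p)"
proof -
  have "(\<Sum>i<q. (sphere_coords p t i)\<^sup>2) = 1 - (\<Prod>l<q. sin (pi * t l))\<^sup>2" if "q \<le> p" for q
    using that
  proof (induction q)
    case (Suc q)
    then show ?case
      by (simp add: sphere_coords_def power_mult_distrib sin_squared_eq algebra_simps)
  qed simp
  from this[of p] have "(\<Sum>i\<le>p. (sphere_coords p t i)\<^sup>2) = 1"
    by (simp add: lessThan_Suc_atMost[symmetric] sphere_coords_def)
  then show ?thesis by (simp add: in_nsphere_iff sphere_coords_def)
qed

lemma topspace_nsphere_mono: "p \<le> q \<Longrightarrow> topspace (nsphere p) \<subseteq> topspace (nsphere q)"
proof
  fix x assume "p \<le> q" and x: "x \<in> topspace (nsphere p)"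
  then have "(\<Sum>i\<le>q. (x i)\<^sup>2) = (\<Sum>i\<le>p. (x i)\<^sup>2)"
    by (intro sum.mono_neutral_right) (auto simp: in_nsphere_iff)
  then show "x \<in> topspace (nsphere q)" using x \<open>p \<le> q\<close> by (simp add: in_nsphere_iff)
qed

abbreviation sphere_product :: "'a set \<Rightarrow> ('a \<Rightarrow> nat) \<Rightarrow> ('a \<Rightarrow> nat \<Rightarrow> real) topology" where
  "sphere_product A n \<equiv> product_topology (\<lambda>a. nsphere (n a)) A"

lemma sphere_product_map_in:
  "(\<And>a. q a \<le> n a) \<Longrightarrow> sphere_product_map A q z \<in> topspace (sphere_product A n)"
  using sphere_coords_in_nsphere topspace_nsphere_mono
  by (fastforce simp: sphere_product_map_def topspace_product_topology)

lemma continuous_map_sphere_product_map: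
  "continuous_map euclidean (sphere_product A n) (sphere_product_map A n)"
proof -
  have p: "continuous_on UNIV (\<lambda>z :: 'a \<times> nat \<Rightarrow> real. pi * z s)" for s
    by (rule continuous_on_mult_left, rule continuous_on_product_coordinates)
  note c = continuous_on_compose2[OF continuous_on_sin[OF continuous_on_id] p subset_UNIV]
    continuous_on_compose2[OF continuous_on_cos[OF continuous_on_id] p subset_UNIV]
  have "continuous_on UNIV (\<lambda>z. sphere_coords (n a) (\<lambda>i. z (a, i)) l)" for a l
    unfolding sphere_coords_def
    by (cases "l < n a"; cases "l = n a") (auto intro!: continuous_on_mult continuous_on_prod c)
  then show ?thesis
    by (auto simp: continuous_map_componentwise continuous_map_nsphere_iff sphere_product_map_def sphere_coords_in_nsphere)
qed

section \<open>Boxes in countable products of metric spaces\<close>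

lemma compact_PiE_UNIV:
  fixes F :: "'s \<Rightarrow> 'b::topological_space set"
  assumes "\<And>s. compact (F s)"
  shows "compact (PiE UNIV F)"
proof -
  have "compactin (product_topology (\<lambda>_. euclidean) UNIV) (PiE UNIV F)"
    using assms by (simp add: compactin_PiE)
  then show ?thesis by (simp add: euclidean_product_topology)
qed

lemma connected_PiE_UNIV:
  fixes F :: "'s \<Rightarrow> 'b::topological_space set"
  assumes "\<And>s. connected (F s)"
  shows "connected (PiE UNIV F)"
proof -
  have "connectedin (product_topology (\<lambda>_. euclidean) UNIV) (PiE UNIV F)"
    using assms by (simp add: connectedin_PiE)
  then show ?thesis by (simp add: euclidean_product_topology)
qed

text \<open>The product metric weights the coordinates by \<open>(1/2)^n\<close>, and these weights
  add up to 2.\<close>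

lemma dist_fun_le:
  fixes x y :: "'s::countable \<Rightarrow> 'b::metric_space"
  assumes "\<And>s. dist (x s) (y s) \<le> c"
  shows "dist x y \<le> 2 * c"
proof -
  have s: "summable (\<lambda>n. (1/2)^n * c)" by (intro summable_mult2) auto
  have le: "(1/2)^n * min (dist (x (from_nat n)) (y (from_nat n))) 1 \<le> (1/2)^n * c" for n
    using assms[of "from_nat n"] by (intro mult_left_mono) auto
  have "dist x y \<le> (\<Sum>n. (1/2)^n * c)"
    unfolding dist_fun_def
    by (intro suminf_le le s summable_comparison_test'[OF s, of 0]) (use le in auto)
  also have "\<dots> = 2 * c" by (simp add: suminf_mult2[symmetric] suminf_geometric)
  finally show ?thesis .
qed

text \<open>A discontinuous choice of one point from each antipodal pair, for use where only
  equivariance under the antipode matters.\<close>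

definition negative :: "(nat \<Rightarrow> real) \<Rightarrow> bool" where
  "negative x \<longleftrightarrow> x (LEAST i. x i \<noteq> 0) < 0"

lemma negative_uminus:
  assumes "x \<in> topspace (nsphere n)"
  shows "negative (\<lambda>i. - x i) \<longleftrightarrow> \<not> negative x"
proof -
  have "\<exists>i. x i \<noteq> 0"
    using nsphere_ne_uminus[OF assms] by (metis add.inverse_neutral)
  then have "x (LEAST i. x i \<noteq> 0) \<noteq> 0" by (rule LeastI_ex)
  then show ?thesis by (auto simp: negative_def)
qed

definition flips :: "'a \<Rightarrow> ('a \<Rightarrow> nat \<Rightarrow> real) set \<Rightarrow> bool \<Rightarrow> (('a \<Rightarrow> nat \<Rightarrow> real) \<Rightarrow> nat \<Rightarrow> real) \<Rightarrow> bool" where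
  "flips a M d f \<longleftrightarrow> (\<forall>m\<in>M. f (antipode_at a m) = (if d then (\<lambda>i. - f m i) else f m))"

text \<open>A family of paths in a projective space, parametrised by \<open>U\<close>, which trivialises over \<open>U\<close> the
  double covering given by the character \<open>X\<close> of the group of antipodes.\<close>

definition trivialises ::
  "'a set \<Rightarrow> ('a \<Rightarrow> nat) \<Rightarrow> 'b topology \<Rightarrow> (('a \<Rightarrow> nat \<Rightarrow> real) \<Rightarrow> 'b) \<Rightarrow> 'b set \<Rightarrow> 'a set \<Rightarrow> bool" where
  "trivialises A n B \<psi> U X \<longleftrightarrow> (\<exists>N f g H.
     continuous_map (sphere_product A n) (nsphere N) f \<and>
     continuous_map (sphere_product A n) (nsphere N) g \<and>
     continuous_map (prod_topology (subtopology B U) (top_of_set {0..1})) (real_projective_space N) (\<lambda>(b, t). H b t) \<and>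
     (\<forall>m\<in>topspace (sphere_product A n). \<psi> m \<in> U \<longrightarrow> antipodal_class (f m) = H (\<psi> m) 0 \<and> antipodal_class (g m) = H (\<psi> m) (1::real)) \<and>
     (\<forall>a\<in>A. \<exists>d d'. (a \<in> X \<longleftrightarrow> d \<noteq> d') \<and> flips a (topspace (sphere_product A n)) d f \<and> flips a (topspace (sphere_product A n)) d' g))"

text \<open>The sign records whether the lift of the path starting at \<open>f m\<close> ends at
  \<open>g m\<close> or at its antipode. It toggles exactly when an antipode flips one of
  \<open>f\<close> and \<open>g\<close> but not the other.\<close>

lemma trivialises_sign:
  assumes "trivialises A n B \<psi> U X"
    and \<psi>: "continuous_map (sphere_product A n) B \<psi>"
    and inv: "\<And>a m. a \<in> A \<Longrightarrow> m \<in> topspace (sphere_product A n) \<Longrightarrow> \<psi> (antipode_at a m) = \<psi> m"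
  obtains u :: "('a \<Rightarrow> nat \<Rightarrow> real) \<Rightarrow> bit" where
    "\<And>a m. a \<in> A \<Longrightarrow> m \<in> topspace (sphere_product A n) \<Longrightarrow> u (antipode_at a m) = u m + of_bool (a \<in> X)"
    "\<And>(W :: 'w::metric_space set) \<phi> w w'. compact W \<Longrightarrow> connected W \<Longrightarrow> continuous_map (top_of_set W) (sphere_product A n) \<phi> \<Longrightarrow>
       \<psi> ` \<phi> ` W \<subseteq> U \<Longrightarrow> w \<in> W \<Longrightarrow> w' \<in> W \<Longrightarrow> u (\<phi> w) = u (\<phi> w')"
proof -
  let ?M = "sphere_product A n"
  obtain N f g H where
     f: "continuous_map ?M (nsphere N) f" and g: "continuous_map ?M (nsphere N) g"
     and H: "continuous_map (prod_topology (subtopology B U) (top_of_set {0..1})) (real_projective_space N) (\<lambda>(b, t). H b t)"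
     and HH: "\<And>m. m \<in> topspace ?M \<Longrightarrow> \<psi> m \<in> U \<Longrightarrow> antipodal_class (f m) = H (\<psi> m) 0 \<and> antipodal_class (g m) = H (\<psi> m) (1::real)"
     and fl: "\<And>a. a \<in> A \<Longrightarrow> \<exists>d d'. (a \<in> X \<longleftrightarrow> d \<noteq> d') \<and> flips a (topspace ?M) d f \<and> flips a (topspace ?M) d' g"
    using assms(1) unfolding trivialises_def by metis
  \<comment> \<open>Outside \<open>U\<close> there is no path to lift; \<open>negative\<close>
    supplies a value with the same equivariance.\<close>
  define u :: "('a \<Rightarrow> nat \<Rightarrow> real) \<Rightarrow> bit" where
    "u m = (if \<psi> m \<in> U then of_bool (\<not> lifts_to N (H (\<psi> m)) (f m) (g m)) else of_bool (negative (f m) \<noteq> negative (g m)))" for m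
  have fM: "f m \<in> topspace (nsphere N)" "g m \<in> topspace (nsphere N)" if "m \<in> topspace ?M" for m
    using f g that by (simp_all add: continuous_map_nsphere_iff)
  have path: "continuous_map (top_of_set {0..1}) (real_projective_space N) (H b)" if "b \<in> topspace B" "b \<in> U" for b
  proof -
    have "continuous_map (top_of_set {0..1}) (prod_topology (subtopology B U) (top_of_set {0..1})) (\<lambda>t. (b, t::real))"
      using that by (auto intro!: continuous_intros)
    from continuous_map_compose[OF this H] show ?thesis by (simp add: comp_def)
  qed
  have \<psi>B: "\<psi> m \<in> topspace B" if "m \<in> topspace ?M" for m
    using funcset_mem[OF continuous_map_funspace[OF \<psi>] that] .
  show ?thesis
  proof (rule that[of u])
    fix a m assume a: "a \<in> A" and m: "m \<in> topspace ?M"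
    from fl[OF a] obtain d d' where "(a \<in> X \<longleftrightarrow> d \<noteq> d') \<and> flips a (topspace ?M) d f \<and> flips a (topspace ?M) d' g"
      by (elim exE)
    then have dd: "a \<in> X \<longleftrightarrow> d \<noteq> d'" "flips a (topspace ?M) d f" "flips a (topspace ?M) d' g"
      by simp_all
    have d: "a \<in> X \<longleftrightarrow> d \<noteq> d'" "f (antipode_at a m) = (if d then (\<lambda>i. - f m i) else f m)"
      "g (antipode_at a m) = (if d' then (\<lambda>i. - g m i) else g m)"
      by (rule dd(1), rule bspec[OF dd(2)[unfolded flips_def] m], rule bspec[OF dd(3)[unfolded flips_def] m])
    have lifts: "lifts_to N (H (\<psi> m)) (f m) (\<lambda>i. - g m i) \<longleftrightarrow> \<not> lifts_to N (H (\<psi> m)) (f m) (g m)"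
      "lifts_to N (H (\<psi> m)) (\<lambda>i. - f m i) (g m) \<longleftrightarrow> \<not> lifts_to N (H (\<psi> m)) (f m) (g m)" if U: "\<psi> m \<in> U"
      by (rule lifts_to_dichotomy[OF path[OF \<psi>B[OF m] U] fM[OF m] HH[OF m U, THEN conjunct1] HH[OF m U, THEN conjunct2]])+
    show "u (antipode_at a m) = u m + of_bool (a \<in> X)"
    proof (cases "\<psi> m \<in> U")
      case True
      then show ?thesis
        unfolding u_def inv[OF a m] d(2,3) d(1)
        by (cases d; cases d') (simp_all add: lifts lifts_to_uminus)
    next
      case False
      then show ?thesis
        using negative_uminus[OF fM(1)[OF m]] negative_uminus[OF fM(2)[OF m]]
        unfolding u_def inv[OF a m] d(2,3) d(1)
        by (cases d; cases d') simp_all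
    qed
  next
    fix W :: "'w set" and \<phi> w w'
    assume W: "compact W" "connected W" and \<phi>: "continuous_map (top_of_set W) ?M \<phi>"
      and U: "\<psi> ` \<phi> ` W \<subseteq> U" and w: "w \<in> W" "w' \<in> W"
    have \<phi>M: "\<phi> x \<in> topspace ?M" if "x \<in> W" for x
      using \<phi> that by (auto simp: continuous_map_def)
    have 1: "continuous_map (top_of_set W) (subtopology B U) (\<lambda>w. \<psi> (\<phi> w))"
      using continuous_map_compose[OF \<phi> \<psi>] U by (auto simp: continuous_map_in_subtopology comp_def)
    have 2: "continuous_map (prod_topology (top_of_set W) (top_of_set {0..1::real})) (prod_topology (subtopology B U) (top_of_set {0..1})) (\<lambda>(w, t). (\<psi> (\<phi> w), t))"
      unfolding case_prod_unfold
      by (intro continuous_map_pairedI continuous_map_compose[OF continuous_map_fst 1, unfolded comp_def] continuous_map_snd)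
    have "continuous_map (top_of_set (W \<times> {0..1})) (real_projective_space N) (\<lambda>(w, t). H (\<psi> (\<phi> w)) t)"
      using continuous_map_compose[OF 2 H] by (simp add: comp_def case_prod_unfold prod_topology_subtopology_eu)
    note const = lifts_to_constant[OF W this, of "\<lambda>w. f (\<phi> w)" "\<lambda>w. g (\<phi> w)"]
    have "(\<forall>w\<in>W. lifts_to N (H (\<psi> (\<phi> w))) (f (\<phi> w)) (g (\<phi> w))) \<or> (\<forall>w\<in>W. \<not> lifts_to N (H (\<psi> (\<phi> w))) (f (\<phi> w)) (g (\<phi> w)))"
      using const continuous_map_compose[OF \<phi> f] continuous_map_compose[OF \<phi> g] HH \<phi>M U
      by (auto simp: comp_def image_subset_iff)
    moreover have "\<psi> (\<phi> w) \<in> U" "\<psi> (\<phi> w') \<in> U" using U w by auto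
    ultimately show "u (\<phi> w) = u (\<phi> w')" using w by (auto simp: u_def)
  qed
qed

theorem no_small_trivialising_cover:
  fixes A :: "'a::countable set"
  assumes A: "finite A" and len: "length Xs = (\<Sum>a\<in>A. n a)" and coeff: "forms_coeff A n Xs = 1"
    and \<psi>: "continuous_map (sphere_product A n) B \<psi>"
    and inv: "\<And>a m. a \<in> A \<Longrightarrow> m \<in> topspace (sphere_product A n) \<Longrightarrow> \<psi> (antipode_at a m) = \<psi> m"
    and U: "\<And>i. i \<le> q \<Longrightarrow> openin B (U i)" "(\<Union>i\<le>q. U i) = topspace B"
    and q: "q < length Xs"
    and triv: "\<And>i X. i \<le> q \<Longrightarrow> X \<in> set Xs \<Longrightarrow> trivialises A n B \<psi> (U i) X"
  shows False
proof -
  let ?M = "sphere_product A n"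
  define \<Phi> where "\<Phi> = sphere_product_map A n"
  have \<Phi>: "continuous_map euclidean ?M \<Phi>"
    unfolding \<Phi>_def by (rule continuous_map_sphere_product_map)
  \<comment> \<open>Sets and forms are matched by position. As \<open>q < length Xs\<close>, every
    set gets a sign of its own; \<open>min k q\<close> assigns the last set to the surplus
    forms.\<close>
  have "\<exists>u :: ('a \<Rightarrow> nat \<Rightarrow> real) \<Rightarrow> bit.
    (\<forall>a m. a \<in> A \<longrightarrow> m \<in> topspace ?M \<longrightarrow> u (antipode_at a m) = u m + of_bool (a \<in> Xs ! k)) \<and>
    (\<forall>(W :: ('a \<times> nat \<Rightarrow> real) set) \<phi> w w'. compact W \<longrightarrow> connected W \<longrightarrow> continuous_map (top_of_set W) ?M \<phi> \<longrightarrow>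
       \<psi> ` \<phi> ` W \<subseteq> U (min k q) \<longrightarrow> w \<in> W \<longrightarrow> w' \<in> W \<longrightarrow> u (\<phi> w) = u (\<phi> w'))" if "k < length Xs" for k
    using trivialises_sign[where 'w = "'a \<times> nat \<Rightarrow> real", OF triv \<psi> inv, of "min k q" "Xs ! k"] that
    by (metis min.cobounded2 nth_mem)
  then obtain u :: "nat \<Rightarrow> ('a \<Rightarrow> nat \<Rightarrow> real) \<Rightarrow> bit" where
    u1: "\<And>k a m. k < length Xs \<Longrightarrow> a \<in> A \<Longrightarrow> m \<in> topspace ?M \<Longrightarrow> u k (antipode_at a m) = u k m + of_bool (a \<in> Xs ! k)" and
    u2: "\<And>k (W :: ('a \<times> nat \<Rightarrow> real) set) \<phi> w w'. k < length Xs \<Longrightarrow> compact W \<Longrightarrow> connected W \<Longrightarrow> continuous_map (top_of_set W) ?M \<phi> \<Longrightarrow>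
       \<psi> ` \<phi> ` W \<subseteq> U (min k q) \<Longrightarrow> w \<in> W \<Longrightarrow> w' \<in> W \<Longrightarrow> u k (\<phi> w) = u k (\<phi> w')"
    by metis
  define vs where "vs = map u [0..<length Xs]"
  \<comment> \<open>The coordinates outside \<open>block_indices A n\<close> are confined to the
    unit interval as well, so that the cube is compact.\<close>
  define Q :: "('a \<times> nat \<Rightarrow> real) set" where "Q = PiE UNIV (\<lambda>_. {0..1})"
  define G where "G i = {z. \<psi> (\<Phi> z) \<in> U i}" for i
  have "compact Q" unfolding Q_def by (rule compact_PiE_UNIV) simp
  have openG: "open (G i)" if "i \<le> q" for i
    using openin_continuous_map_preimage[OF continuous_map_compose[OF \<Phi> \<psi>] U(1)[OF that]]
    by (simp add: G_def)
  have coverG: "\<exists>i\<le>q. z \<in> G i" for z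
  proof -
    have "\<psi> (\<Phi> z) \<in> topspace B"
      using funcset_mem[OF continuous_map_funspace[OF continuous_map_compose[OF \<Phi> \<psi>]], of z] by simp
    then show ?thesis unfolding U(2)[symmetric] by (auto simp: G_def)
  qed
  have "Q \<subseteq> \<Union>(G ` {..q})" using coverG by blast
  moreover have "open V" if "V \<in> G ` {..q}" for V
    using that openG by auto
  ultimately obtain e where "e > 0" and e: "\<And>x. x \<in> Q \<Longrightarrow> \<exists>V\<in>G ` {..q}. ball x e \<subseteq> V"
    using Heine_Borel_lemma[OF \<open>compact Q\<close>, of "G ` {..q}"] by blast
  \<comment> \<open>Subcubes have side \<open>1 / (2*L)\<close>, so by \<open>dist_fun_le\<close>
    they lie within distance \<open>1 / L\<close> of the corner \<open>x\<close>, below the Lebesgue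
    number \<open>e\<close>.\<close>
  obtain L' where "1 / real (Suc L') < e" using \<open>e > 0\<close> by (rule nat_approx_posE)
  define L where "L = Suc L'"
  have L: "L > 0" "1 / real L < e" using \<open>1 / real (Suc L') < e\<close> by (simp_all add: L_def)
  have "sphere_count L A n vs = forms_coeff A n Xs"
  proof (rule sphere_count_eq_forms_coeff[OF A L(1)])
    fix i a p z assume "i < length vs" "a \<in> A" "\<And>a. p a \<le> n a"
    then show "(vs ! i) (antipode_at a (sphere_product_map A p z)) =
      (vs ! i) (sphere_product_map A p z) + of_bool (a \<in> Xs ! i)"
      using u1 sphere_product_map_in[of p n A z] by (simp add: vs_def)
  qed (use len in \<open>simp_all add: vs_def\<close>)
  then have "sphere_count L A n vs \<noteq> 0" using coeff by simp
  define S where "S = block_indices A n"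
  define us where "us = map (\<lambda>v z. v (\<Phi> z)) vs"
  obtain k where k: "k \<in> PiE S (\<lambda>_. {..<2*L})"
    "path_sum S us (grid_even L S k) (grid_odd L S k) \<noteq> 0"
    using \<open>sphere_count L A n vs \<noteq> 0\<close>
    unfolding sphere_count_def cube_sum_def S_def us_def \<Phi>_def by (meson sum.neutral)
  define x y where "x = grid_even L S k" and "y = grid_odd L S k"
  define R where "R = PiE UNIV (\<lambda>s. {min (x s) (y s)..max (x s) (y s)})"
  have xy: "\<bar>x s - y s\<bar> \<le> 1 / (2*L)" "0 \<le> x s" "x s \<le> 1" "0 \<le> y s" "y s \<le> 1" for s
  proof -
    have "s \<in> S \<Longrightarrow> k s < 2*L" using k(1) by auto
    then show "\<bar>x s - y s\<bar> \<le> 1 / (2*L)" "0 \<le> x s" "x s \<le> 1" "0 \<le> y s" "y s \<le> 1"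
      using L(1) by (auto simp: x_def y_def grid_even_def grid_odd_def even_end_def odd_end_def field_simps)
  qed
  have "x \<in> Q" using xy by (simp add: Q_def PiE_iff)
  then obtain i where i: "i \<le> q" "ball x e \<subseteq> G i" using e by blast
  have "R \<subseteq> ball x e"
  proof
    fix z assume z: "z \<in> R"
    have "dist (x s) (z s) \<le> 1 / (2*L)" for s
    proof -
      have "z s \<in> {min (x s) (y s)..max (x s) (y s)}"
        using PiE_mem[OF z[unfolded R_def], of s] by simp
      then show ?thesis
        using xy(1)[of s] by (auto simp: dist_real_def min_def max_def split: if_splits)
    qed
    then have "dist x z \<le> 2 * (1 / (2*L))" by (rule dist_fun_le)
    then show "z \<in> ball x e" using L by simp
  qed
  then have RG: "R \<subseteq> G i" using i by blast
  have R: "compact R" "connected R"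
    unfolding R_def by (auto intro!: compact_PiE_UNIV connected_PiE_UNIV)
  have iX: "i < length Xs" using i q by simp
  have "(\<lambda>z. u i (\<Phi> z)) \<in> set us"
    using iX by (auto simp: us_def vs_def)
  from path_sum_nonzero_imp[OF k(2) this]
  obtain z z' where zz: "\<And>s. z s \<in> {x s, y s}" "\<And>s. z' s \<in> {x s, y s}" "u i (\<Phi> z) \<noteq> u i (\<Phi> z')"
    unfolding x_def y_def by blast
  have "z \<in> R" "z' \<in> R"
  proof -
    have "v s \<in> {min (x s) (y s)..max (x s) (y s)}" if "v s \<in> {x s, y s}" for v s
      using that by auto
    then show "z \<in> R" "z' \<in> R"
      unfolding R_def PiE_UNIV_domain using zz(1,2) by blast+
  qed
  moreover have "continuous_map (top_of_set R) ?M \<Phi>"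
    using \<Phi> by (rule continuous_map_from_subtopology)
  moreover have "\<psi> ` \<Phi> ` R \<subseteq> U (min i q)"
    using RG i(1) by (auto simp: G_def min_def)
  ultimately show False
    using u2[OF iX R, of \<Phi> z z'] zz(3) by blast
qed

subsection \<open>Coefficients of products of linear forms\<close>

lemma forms_coeff_cong:
  "(\<And>a. a \<in> A \<Longrightarrow> p a = q a) \<Longrightarrow> forms_coeff A p Xs = forms_coeff A q Xs"
proof (induction Xs arbitrary: p q)
  case Nil
  then show ?case by simp
next
  case (Cons X Xs)
  have "{a \<in> A. a \<in> X \<and> 0 < p a} = {a \<in> A. a \<in> X \<and> 0 < q a}"
    using Cons.prems by auto
  moreover have "forms_coeff A (p(a := p a - 1)) Xs = forms_coeff A (q(a := q a - 1)) Xs" if "a \<in> A" for a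
    by (rule Cons.IH) (use Cons.prems that in auto)
  ultimately show ?case
    unfolding forms_coeff.simps by (intro sum.cong) auto
qed

text \<open>Every factor \<open>a\<close> in the monomial must be taken from a form containing
  \<open>a\<close>, and there are too few of them.\<close>

lemma forms_coeff_eq_0:
  assumes "a \<in> A" "length (filter (\<lambda>X. a \<in> X) Xs) < p a"
  shows "forms_coeff A p Xs = 0"
  using assms(2)
proof (induction Xs arbitrary: p)
  case Nil
  then show ?case using assms(1) by auto
next
  case (Cons X Xs)
  have "forms_coeff A (p(b := p b - 1)) Xs = 0" if "b \<in> X" for b
    by (rule Cons.IH) (use Cons.prems that in \<open>auto split: if_splits\<close>)
  then show ?case by simp
qed

lemma forms_coeff_replicate_singleton:
  assumes "a \<in> A" "k \<le> p a"
  shows "forms_coeff A p (replicate k {a} @ Xs) = forms_coeff A (p(a := p a - k)) Xs"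
  using assms(2)
proof (induction k arbitrary: p)
  case (Suc k)
  have "{b \<in> A. b = a \<and> 0 < p b} = {a}" using assms(1) Suc.prems by auto
  moreover have "forms_coeff A (p(a := p a - 1)) (replicate k {a} @ Xs) =
      forms_coeff A ((p(a := p a - 1))(a := (p(a := p a - 1)) a - k)) Xs"
    by (rule Suc.IH) (use Suc.prems in simp)
  ultimately show "forms_coeff A p (replicate (Suc k) {a} @ Xs) = forms_coeff A (p(a := p a - Suc k)) Xs"
    by simp
qed simp

lemma forms_coeff_singletons:
  assumes "set as \<subseteq> A" "distinct as"
  shows "forms_coeff A p (concat (map (\<lambda>a. replicate (p a) {a}) as) @ Xs) = forms_coeff A (\<lambda>a. if a \<in> set as then 0 else p a) Xs"
  using assms
proof (induction as arbitrary: p)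
  case (Cons a as)
  define q where "q = p(a := 0)"
  have "concat (map (\<lambda>a. replicate (p a) {a}) as) = concat (map (\<lambda>a. replicate (q a) {a}) as)"
    using Cons.prems by (intro arg_cong[of _ _ concat] map_cong) (auto simp: q_def)
  then have "forms_coeff A p (concat (map (\<lambda>a. replicate (p a) {a}) (a # as)) @ Xs) =
    forms_coeff A q (concat (map (\<lambda>a. replicate (q a) {a}) as) @ Xs)"
    using forms_coeff_replicate_singleton[of a A "p a" p] Cons.prems by (simp add: q_def)
  also have "\<dots> = forms_coeff A (\<lambda>b. if b \<in> set as then 0 else q b) Xs"
    by (rule Cons.IH) (use Cons.prems in auto)
  also have "(\<lambda>b. if b \<in> set as then 0 else q b) = (\<lambda>b. if b \<in> set (a # as) then 0 else p b)"
    by (auto simp: q_def)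
  finally show ?case .
qed simp

lemma forms_coeff_Cons_pair:
  assumes "x \<in> A" "y \<in> A" "x \<noteq> y"
  shows "forms_coeff A p ({x, y} # Xs) =
    (if p x > 0 then forms_coeff A (p(x := p x - 1)) Xs else 0) +
    (if p y > 0 then forms_coeff A (p(y := p y - 1)) Xs else 0)"
proof -
  have "{a. a \<in> A \<and> a \<in> {x, y} \<and> p a > 0} = (if p x > 0 then {x} else {}) \<union> (if p y > 0 then {y} else {})"
    using assms by auto
  then show ?thesis
    unfolding forms_coeff.simps using assms(3) by simp
qed

text \<open>No later form contains \<open>x\<close>, so all \<open>k\<close> pairs must contribute
  \<open>x\<close>.\<close>

lemma forms_coeff_replicate_pair:
  assumes "x \<in> A" "y \<in> A" "x \<noteq> y" and rest: "\<forall>X\<in>set Xs. x \<notin> X"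
  shows "p x = k \<Longrightarrow> forms_coeff A p (replicate k {x, y} @ Xs) = forms_coeff A (p(x := 0)) Xs"
proof (induction k arbitrary: p)
  case 0
  then have "p(x := 0) = p" by (intro fun_upd_idem)
  then show "forms_coeff A p (replicate 0 {x, y} @ Xs) = forms_coeff A (p(x := 0)) Xs" by simp
next
  case (Suc k)
  have "forms_coeff A (p(y := p y - 1)) (replicate k {x, y} @ Xs) = 0"
    by (rule forms_coeff_eq_0[OF assms(1)]) (use assms Suc.prems in \<open>simp add: filter_replicate filter_False\<close>)
  moreover have "forms_coeff A (p(x := p x - 1)) (replicate k {x, y} @ Xs) = forms_coeff A ((p(x := p x - 1))(x := 0)) Xs"
    by (rule Suc.IH) (use Suc.prems in simp)
  ultimately show "forms_coeff A p (replicate (Suc k) {x, y} @ Xs) = forms_coeff A (p(x := 0)) Xs"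
    unfolding replicate_Suc append_Cons forms_coeff_Cons_pair[OF assms(1-3)] using Suc.prems by simp
qed

text \<open>Exactly one of the \<open>k + 1\<close> pairs contributes \<open>y\<close>, and it can
  be any of them.\<close>

lemma forms_coeff_replicate_pair_Suc:
  assumes "x \<in> A" "y \<in> A" "x \<noteq> y" and rest: "\<forall>X\<in>set Xs. x \<notin> X" and "p y > 0"
  shows "p x = k \<Longrightarrow> forms_coeff A p (replicate (Suc k) {x, y} @ Xs) =
    of_nat (Suc k) * forms_coeff A (p(x := 0, y := p y - 1)) Xs"
  using \<open>p y > 0\<close>
proof (induction k arbitrary: p)
  case 0
  then have "p(x := 0) = p" by (intro fun_upd_idem)
  then show "forms_coeff A p (replicate (Suc 0) {x, y} @ Xs) = of_nat (Suc 0) * forms_coeff A (p(x := 0, y := p y - 1)) Xs"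
    unfolding replicate_Suc append_Cons forms_coeff_Cons_pair[OF assms(1-3)] using 0 by simp
next
  case (Suc k)
  have tw: "p(y := d, x := 0) = p(x := 0, y := d)" for d
    using assms(3) by (simp add: fun_upd_twist)
  have "forms_coeff A (p(y := p y - 1)) (replicate (Suc k) {x, y} @ Xs) = forms_coeff A (p(x := 0, y := p y - 1)) Xs"
    using forms_coeff_replicate_pair[OF assms(1-4), of "p(y := p y - 1)" "Suc k"] assms(3) Suc.prems
    by (simp add: tw)
  moreover have "forms_coeff A (p(x := p x - 1)) (replicate (Suc k) {x, y} @ Xs) = of_nat (Suc k) * forms_coeff A (p(x := 0, y := p y - 1)) Xs"
  proof -
    have "forms_coeff A (p(x := p x - 1)) (replicate (Suc k) {x, y} @ Xs) =
      of_nat (Suc k) * forms_coeff A ((p(x := p x - 1))(x := 0, y := (p(x := p x - 1)) y - 1)) Xs"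
      by (rule Suc.IH) (use Suc.prems assms(3) in auto)
    then show ?thesis using assms(3) by (simp only: fun_upd_upd fun_upd_other[OF assms(3)[symmetric]])
  qed
  ultimately show "forms_coeff A p (replicate (Suc (Suc k)) {x, y} @ Xs) =
      of_nat (Suc (Suc k)) * forms_coeff A (p(x := 0, y := p y - 1)) Xs"
    unfolding replicate_Suc[of "Suc k"] append_Cons forms_coeff_Cons_pair[OF assms(1-3)]
    using Suc.prems by (simp add: distrib_right)
qed

text \<open>The exponents come from \<open>\<Prod>\<^sub>j (x\<^sub>j + y) ^ e\<^sub>j\<close>, where \<open>e\<^sub>j\<close> is \<open>k + 1\<close> for exactly \<open>k\<close> of the
  indices and \<open>k\<close> for the others: each of the former contributes the odd factor \<open>k + 1\<close> and one \<open>y\<close>.\<close>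

definition star_forms :: "'i \<Rightarrow> nat \<Rightarrow> nat \<Rightarrow> nat list \<Rightarrow> (nat \<times> 'i) set list" where
  "star_forms i k c js = concat (map (\<lambda>j. replicate (if j < k then Suc k else k) {(j, i), (c, i)}) js)"

text \<open>The power of the variable \<open>(j, i)\<close> can only come from its own block. A
  block with \<open>j < k\<close> has the odd factor \<open>k + 1\<close> and lowers the exponent of
  \<open>(c, i)\<close> by one; the last hypothesis makes these deductions exhaust that
  exponent.\<close>

lemma forms_coeff_star_forms:
  assumes "even k" "(c, i) \<in> A" "distinct js" "c \<notin> set js" "(\<lambda>j. (j, i)) ` set js \<subseteq> A"
    and "\<forall>X\<in>set Xs. \<forall>j\<in>set js. (j, i) \<notin> X"
    and "\<And>j. j \<in> set js \<Longrightarrow> p (j, i) = k"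
    and "p (c, i) = length (filter (\<lambda>j. j < k) js)"
  shows "forms_coeff A p (star_forms i k c js @ Xs) =
    forms_coeff A (\<lambda>(j, i'). if i' = i \<and> (j = c \<or> j \<in> set js) then 0 else p (j, i')) Xs"
  using assms(3-)
proof (induction js arbitrary: p)
  case Nil
  then have "(\<lambda>(j, i'). if i' = i \<and> (j = c \<or> j \<in> set []) then 0 else p (j, i')) = p" by auto
  then show ?case by (simp add: star_forms_def)
next
  case (Cons j js)
  define q where "q = (if j < k then p((j, i) := 0, (c, i) := p (c, i) - 1) else p((j, i) := 0))"
  have ne: "(j, i) \<noteq> (c, i)" "(j, i) \<in> A" using Cons.prems by auto
  have avoid: "\<forall>X\<in>set (star_forms i k c js @ Xs). (j, i) \<notin> X"
    using Cons.prems by (auto simp: star_forms_def)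
  have pj: "p (j, i) = k" using Cons.prems by simp
  have "forms_coeff A p (star_forms i k c (j # js) @ Xs) = forms_coeff A q (star_forms i k c js @ Xs)"
  proof (cases "j < k")
    case True
    then have "p (c, i) > 0" using Cons.prems by simp
    moreover have "star_forms i k c (j # js) @ Xs = replicate (Suc k) {(j, i), (c, i)} @ (star_forms i k c js @ Xs)"
      using True by (simp add: star_forms_def)
    moreover have "of_nat (Suc k) = (1 :: bit)"
      using \<open>even k\<close> by (auto elim!: evenE)
    ultimately show ?thesis
      using forms_coeff_replicate_pair_Suc[OF ne(2) assms(2) ne(1) avoid, of p k] pj True by (simp add: q_def)
  next
    case False
    then have "star_forms i k c (j # js) @ Xs = replicate k {(j, i), (c, i)} @ (star_forms i k c js @ Xs)"
      by (simp add: star_forms_def)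
    then show ?thesis
      using forms_coeff_replicate_pair[OF ne(2) assms(2) ne(1) avoid, of p k] pj False by (simp add: q_def)
  qed
  also have "\<dots> = forms_coeff A (\<lambda>(j, i'). if i' = i \<and> (j = c \<or> j \<in> set js) then 0 else q (j, i')) Xs"
    by (rule Cons.IH) (use Cons.prems in \<open>auto simp: q_def\<close>)
  also have "(\<lambda>(j, i'). if i' = i \<and> (j = c \<or> j \<in> set js) then 0 else q (j, i')) =
    (\<lambda>(j', i'). if i' = i \<and> (j' = c \<or> j' \<in> set (j # js)) then 0 else p (j', i'))"
    by (auto simp: q_def fun_eq_iff)
  finally show ?case .
qed

lemma length_star_forms: "length (star_forms i k c js) = length js * k + length (filter (\<lambda>j. j < k) js)"
  by (induction js) (auto simp: star_forms_def)

lemma length_filter_less_upt: "k \<le> c \<Longrightarrow> length (filter (\<lambda>j. j < k) [0..<c]) = k"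
proof -
  assume "k \<le> c"
  have "length (filter (\<lambda>j. j < k) [0..<c]) = card {j. j < c \<and> j < k}"
    by (simp add: length_filter_conv_card cong: conj_cong)
  also have "{j. j < c \<and> j < k} = {..<k}" using \<open>k \<le> c\<close> by auto
  finally show ?thesis by simp
qed

definition TC_forms :: "('i \<Rightarrow> nat) \<Rightarrow> nat \<Rightarrow> 'i list \<Rightarrow> (nat \<times> 'i) set list" where
  "TC_forms n c is = concat (map (\<lambda>i. star_forms i (n i) c [0..<c]) is)"

text \<open>Each \<open>i\<close> has \<open>c\<close> blocks of \<open>n i\<close> forms and one
  extra form for every index below \<open>n i\<close>. All these indices occur because
  \<open>n i \<le> c\<close>.\<close>

lemma length_TC_forms:
  "(\<And>i. i \<in> set is \<Longrightarrow> n i \<le> c) \<Longrightarrow> distinct is \<Longrightarrow> length (TC_forms n c is) = Suc c * (\<Sum>i\<in>set is. n i)"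
  by (induction "is") (simp_all add: TC_forms_def length_star_forms length_filter_less_upt distrib_left)

lemma forms_coeff_TC_forms:
  assumes "\<And>i. i \<in> set is \<Longrightarrow> n i \<le> c \<and> even (n i)" "distinct is" "A = {..<Suc c} \<times> B" "set is \<subseteq> B"
    and "\<And>i j. i \<in> set is \<Longrightarrow> p (j, i) = n i" "\<And>i j. i \<notin> set is \<Longrightarrow> p (j, i) = 0"
  shows "forms_coeff A p (TC_forms n c is) = 1"
  using assms(1,2,4-)
proof (induction "is" arbitrary: p)
  case Nil
  then show ?case by (auto simp: TC_forms_def)
next
  case (Cons i "is")
  define q where "q = (\<lambda>(j, i'). if i' = i \<and> (j = c \<or> j \<in> set [0..<c]) then 0 else p (j, i'))"
  define q' where "q' = (\<lambda>(j, i'). if i' = i then 0 else p (j, i'))"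
  have "forms_coeff A p (star_forms i (n i) c [0..<c] @ TC_forms n c is) = forms_coeff A q (TC_forms n c is)"
    unfolding q_def
  proof (rule forms_coeff_star_forms)
    show "\<forall>X\<in>set (TC_forms n c is). \<forall>j\<in>set [0..<c]. (j, i) \<notin> X"
      using Cons.prems(2) by (auto simp: TC_forms_def star_forms_def)
  qed (use Cons.prems assms(3) in \<open>auto simp: length_filter_less_upt\<close>)
  also have "\<dots> = forms_coeff A q' (TC_forms n c is)"
  proof -
    show ?thesis by (rule forms_coeff_cong) (auto simp: q_def q'_def assms(3))
  qed
  also have "\<dots> = 1"
    by (rule Cons.IH) (use Cons.prems in \<open>auto simp: q'_def\<close>)
  finally show ?case by (simp add: TC_forms_def)
qed

subsection \<open>Path spaces and lower bounds\<close>

text \<open>Half of the exponential law. The interval is locally compact, and mapping a compact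
  neighbourhood of \<open>t\<close> into \<open>V\<close> is an open condition on paths.\<close>

lemma continuous_map_path_space_eval:
  assumes s: "continuous_map Z (path_space X) s"
  shows "continuous_map (prod_topology Z (top_of_set {0..1})) X (\<lambda>(z, t). s z t)"
proof -
  let ?I = "top_of_set {0..1::real}"
  have path: "continuous_map ?I X (s z)" if "z \<in> topspace Z" for z
    using continuous_map_funspace[OF s] that by (auto simp: topspace_path_space pathin_def)
  have sext: "s z \<in> maps_into ?I X" if "z \<in> topspace Z" for z
    using continuous_map_funspace[OF s] that by (auto simp: path_space_def)
  show ?thesis
    unfolding continuous_map_def
  proof (intro conjI allI impI)
    show "(\<lambda>(z, t). s z t) \<in> topspace (prod_topology Z ?I) \<rightarrow> topspace X"
      using continuous_map_funspace[OF path] by auto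
    fix V assume V: "openin X V"
    show "openin (prod_topology Z ?I) {x \<in> topspace (prod_topology Z ?I). (case x of (z, t) \<Rightarrow> s z t) \<in> V}"
      unfolding openin_prod_topology_alt
    proof (intro allI impI)
      fix z t
      assume "(z, t) \<in> {x \<in> topspace (prod_topology Z ?I). (case x of (z, t) \<Rightarrow> s z t) \<in> V}"
      then have z: "z \<in> topspace Z" and t: "t \<in> {0..1}" and zt: "s z t \<in> V" by auto
      have "openin ?I {t \<in> {0..1}. s z t \<in> V}"
        using openin_continuous_map_preimage[OF path[OF z] V] by simp
      then obtain e where e: "e > 0" "\<And>t'. t' \<in> {0..1} \<Longrightarrow> dist t' t < e \<Longrightarrow> s z t' \<in> V"
        using t zt unfolding openin_euclidean_subtopology_iff by blast
      \<comment> \<open>With half the radius the closed ball stays inside the open one on which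
        \<open>s z\<close> has values in \<open>V\<close>.\<close>
      define C where "C = {0..1} \<inter> cball t (e/2)"
      have C: "compactin ?I C"
        by (simp add: C_def compactin_subtopology compact_Int)
      define F where "F = {f \<in> maps_into ?I X. f ` C \<subseteq> V}"
      have "openin (path_space X) F"
        unfolding path_space_def compact_open_topology_def F_def
        by (rule topology_generated_by_Basis) (use C V in blast)
      then have "openin Z {z \<in> topspace Z. s z \<in> F}"
        by (rule openin_continuous_map_preimage[OF s])
      moreover have "openin ?I ({0..1} \<inter> ball t (e/2))"
        by (simp add: openin_open_Int)
      moreover have "z \<in> {z \<in> topspace Z. s z \<in> F}"
        using z e sext[OF z] by (auto simp: F_def C_def dist_commute)
      moreover have "t \<in> {0..1} \<inter> ball t (e/2)" using t e by simp
      moreover have "{z \<in> topspace Z. s z \<in> F} \<times> ({0..1} \<inter> ball t (e/2)) \<subseteq>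
          {x \<in> topspace (prod_topology Z ?I). (case x of (z, t) \<Rightarrow> s z t) \<in> V}"
        by (auto simp: F_def C_def image_subset_iff)
      ultimately show "\<exists>U W. openin Z U \<and> openin ?I W \<and> z \<in> U \<and> t \<in> W \<and>
          U \<times> W \<subseteq> {x \<in> topspace (prod_topology Z ?I). (case x of (z, t) \<Rightarrow> s z t) \<in> V}"
        by blast
    qed
  qed
qed

text \<open>The other half, by the tube lemma: the parameters \<open>z\<close> whose whole slice
  \<open>{z} \<times> C\<close> lies in an open set form an open set.\<close>

lemma continuous_map_path_space_curry:
  assumes h: "continuous_map (prod_topology Z (top_of_set {0..1})) X (\<lambda>(z, t). h z t)"
  shows "continuous_map Z (path_space X) (\<lambda>z. restrict (h z) {0..1})"
proof -
  let ?I = "top_of_set {0..1::real}"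
  have path: "continuous_map ?I X (restrict (h z) {0..1})" if z: "z \<in> topspace Z" for z
  proof -
    have "continuous_map ?I (prod_topology Z ?I) (\<lambda>t. (z, t))"
      by (intro continuous_map_pairedI) (use z in auto)
    from continuous_map_compose[OF this h] show ?thesis
      by (rule continuous_map_eq) auto
  qed
  have into: "restrict (h z) {0..1} \<in> maps_into ?I X" if "z \<in> topspace Z" for z
    using path[OF that] by (simp add: maps_into_def)
  show ?thesis
    unfolding path_space_def compact_open_topology_def
  proof (rule continuous_on_generated_topo)
    fix F assume "F \<in> {{f \<in> maps_into ?I X. f ` C \<subseteq> U} |C U. compactin ?I C \<and> openin X U}"
    then obtain C V where F: "F = {f \<in> maps_into ?I X. f ` C \<subseteq> V}" and C: "compactin ?I C" and V: "openin X V"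
      by blast
    have C01: "C \<subseteq> {0..1}" using compactin_subset_topspace[OF C] by simp
    define O' where "O' = {x \<in> topspace (prod_topology Z ?I). (case x of (z, t) \<Rightarrow> h z t) \<in> V}"
    have O': "openin (prod_topology Z ?I) O'"
      unfolding O'_def by (rule openin_continuous_map_preimage[OF h V])
    have "restrict (h z) {0..1} ` C = h z ` C" for z
      by (rule image_cong) (use C01 in auto)
    then have pre: "(\<lambda>z. restrict (h z) {0..1}) -` F \<inter> topspace Z = {z \<in> topspace Z. {z} \<times> C \<subseteq> O'}"
      using C01 into by (auto simp: F O'_def simp del: image_restrict_eq)
    show "openin Z ((\<lambda>z. restrict (h z) {0..1}) -` F \<inter> topspace Z)"
      unfolding pre
    proof (subst openin_subopen, intro ballI)
      fix z assume z: "z \<in> {z \<in> topspace Z. {z} \<times> C \<subseteq> O'}"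
      then have "compactin Z {z}" by simp
      moreover have "{z} \<times> C \<subseteq> O'" using z by simp
      ultimately obtain U W where UW: "openin Z U" "{z} \<subseteq> U" "C \<subseteq> W" "U \<times> W \<subseteq> O'"
        by (metis C O' Wallace_theorem_prod_topology)
      have "U \<subseteq> {z \<in> topspace Z. {z} \<times> C \<subseteq> O'}"
        using UW openin_subset[OF UW(1)] by blast
      then show "\<exists>T. openin Z T \<and> z \<in> T \<and> T \<subseteq> {z \<in> topspace Z. {z} \<times> C \<subseteq> O'}"
        using UW(1,2) by blast
    qed
  next
    have "maps_into ?I X = topspace (compact_open_topology ?I X)" by simp
    then show "(\<lambda>z. restrict (h z) {0..1}) ` topspace Z \<subseteq> \<Union> {{f \<in> maps_into ?I X. f ` C \<subseteq> U} |C U. compactin ?I C \<and> openin X U}"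
      using into unfolding compact_open_topology_def by (metis (mono_tags) image_subsetI topology_generated_by_topspace)
  qed
qed

section \<open>Sectional category and retracts\<close>

lemma secat_leI:
  assumes "\<And>i. i \<le> n \<Longrightarrow> openin B (U i)" "(\<Union>i\<le>n. U i) = topspace B"
    "\<And>i. i \<le> n \<Longrightarrow> \<exists>s. local_section E B p (U i) s"
  shows "secat E B p \<le> enat n"
  unfolding secat_def using assms by (intro Inf_lower) blast

lemma secat_geI:
  assumes "\<And>n U. enat n < d \<Longrightarrow> (\<And>i. i \<le> n \<Longrightarrow> openin B (U i)) \<Longrightarrow> (\<Union>i\<le>n. U i) = topspace B \<Longrightarrow>
    (\<And>i. i \<le> n \<Longrightarrow> \<exists>s. local_section E B p (U i) s) \<Longrightarrow> False"
  shows "d \<le> secat E B p"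
  unfolding secat_def
proof (rule Inf_greatest)
  fix x assume "x \<in> {enat n |n. \<exists>U. (\<forall>i\<le>n. openin B (U i)) \<and> (\<Union>i\<le>n. U i) = topspace B \<and> (\<forall>i\<le>n. \<exists>s. local_section E B p (U i) s)}"
  then obtain n U where "x = enat n" "\<forall>i\<le>n. openin B (U i)" "(\<Union>i\<le>n. U i) = topspace B" "\<forall>i\<le>n. \<exists>s. local_section E B p (U i) s"
    by blast
  then show "d \<le> x" using assms[of n U] by (meson not_le)
qed

lemma multi_eval_eq_iff:
  "\<beta> \<in> extensional {..<r} \<Longrightarrow> multi_eval r \<alpha> = \<beta> \<longleftrightarrow> (\<forall>j<r. \<alpha> (real j / (real r - 1)) = \<beta> j)"
  by (auto simp: multi_eval_def fun_eq_iff extensional_def)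

text \<open>Open sets are pulled back along \<open>i\<close> in every coordinate; a path through the
  points \<open>i (x j)\<close> is pushed by \<open>\<rho>\<close> to one through the points
  \<open>x j\<close>.\<close>

lemma TC_le_of_retract:
  assumes i: "continuous_map X Y i" and \<rho>: "continuous_map Y X \<rho>" and "\<And>x. x \<in> topspace X \<Longrightarrow> \<rho> (i x) = x"
    and r: "r \<ge> 2"
  shows "TC r X \<le> TC r Y"
  unfolding TC_def
proof (subst (2) secat_def, rule Inf_greatest)
  let ?PX = "product_topology (\<lambda>_. X) {..<r}" and ?PY = "product_topology (\<lambda>_. Y) {..<r}"
  fix x assume "x \<in> {enat n |n. \<exists>U. (\<forall>i\<le>n. openin ?PY (U i)) \<and> (\<Union>i\<le>n. U i) = topspace ?PY \<and>
    (\<forall>i\<le>n. \<exists>s. local_section (path_space Y) ?PY (multi_eval r) (U i) s)}"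
  then obtain n U where n: "x = enat n" and U: "\<And>k. k \<le> n \<Longrightarrow> openin ?PY (U k)" "(\<Union>i\<le>n. U i) = topspace ?PY"
    and sec: "\<And>k. k \<le> n \<Longrightarrow> \<exists>s. local_section (path_space Y) ?PY (multi_eval r) (U k) s"
    by blast
  define I where "I x = (\<lambda>j\<in>{..<r}. i (x j))" for x
  have I: "continuous_map ?PX ?PY I"
    unfolding I_def continuous_map_componentwise
    by (auto intro!: continuous_map_compose[OF continuous_map_product_projection[of _ _ "\<lambda>_. X"] i, unfolded comp_def])
  define V where "V k = {x \<in> topspace ?PX. I x \<in> U k}" for k
  have "secat (path_space X) ?PX (multi_eval r) \<le> enat n"
  proof (rule secat_leI)
    show "openin ?PX (V k)" if "k \<le> n" for k
      unfolding V_def by (rule openin_continuous_map_preimage[OF I U(1)[OF that]])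
    show "(\<Union>k\<le>n. V k) = topspace ?PX"
    proof -
      have "I x \<in> (\<Union>k\<le>n. U k)" if "x \<in> topspace ?PX" for x
        unfolding U(2) using continuous_map_funspace[OF I] that by blast
      then show ?thesis by (auto simp: V_def)
    qed
    fix k assume "k \<le> n"
    then obtain s where s: "continuous_map (subtopology ?PY (U k)) (path_space Y) s"
      and sU: "\<And>y. y \<in> U k \<Longrightarrow> multi_eval r (s y) = y"
      using sec unfolding local_section_def by blast
    have IV: "continuous_map (subtopology ?PX (V k)) (subtopology ?PY (U k)) I"
      using I by (auto simp: continuous_map_in_subtopology V_def intro: continuous_map_from_subtopology)
    have "continuous_map (prod_topology (subtopology ?PX (V k)) (top_of_set {0..1})) X (\<rho> \<circ> (\<lambda>(z, t). (s \<circ> I) z t))"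
      by (rule continuous_map_compose[OF continuous_map_path_space_eval[OF continuous_map_compose[OF IV s]] \<rho>])
    then have "continuous_map (prod_topology (subtopology ?PX (V k)) (top_of_set {0..1})) X (\<lambda>(z, t). \<rho> (s (I z) t))"
      by (simp add: comp_def case_prod_unfold)
    from continuous_map_path_space_curry[OF this]
    have c: "continuous_map (subtopology ?PX (V k)) (path_space X) (\<lambda>z. restrict (\<lambda>t. \<rho> (s (I z) t)) {0..1})" .
    show "\<exists>s. local_section (path_space X) ?PX (multi_eval r) (V k) s"
      unfolding local_section_def
    proof (rule exI[of _ "\<lambda>z. restrict (\<lambda>t. \<rho> (s (I z) t)) {0..1}"], rule conjI, rule c, rule ballI)
      fix x assume x: "x \<in> V k"
      then have "x \<in> (\<Pi>\<^sub>E j\<in>{..<r}. topspace X)"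
        by (simp add: V_def)
      then have xX: "x \<in> extensional {..<r}" "\<And>j. j < r \<Longrightarrow> x j \<in> topspace X"
        by (simp_all add: PiE_iff)
      have "multi_eval r (s (I x)) = I x" using sU x by (simp add: V_def)
      moreover have "I x \<in> extensional {..<r}" by (simp add: I_def)
      ultimately have "\<forall>j<r. s (I x) (real j / (real r - 1)) = I x j"
        using multi_eval_eq_iff by metis
      then have "s (I x) (real j / (real r - 1)) = i (x j)" if "j < r" for j
        using that by (simp add: I_def)
      moreover have "real j / (real r - 1) \<in> {0..1}" if "j < r" for j
        using that r by (auto simp: field_simps)
      ultimately show "multi_eval r (restrict (\<lambda>t. \<rho> (s (I x) t)) {0..1}) = x"
        using xX assms(3) by (auto simp: multi_eval_eq_iff)
    qed
  qed
  then show "secat (path_space X) ?PX (multi_eval r) \<le> x" by (simp add: n)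
qed

section \<open>Faces as images of products of spheres, and the lower bounds\<close>

definition include_face ::
  "'i set \<Rightarrow> ('i \<Rightarrow> (nat \<Rightarrow> real) set) \<Rightarrow> 'i set \<Rightarrow> ('i \<Rightarrow> nat \<Rightarrow> real) \<Rightarrow> 'i \<Rightarrow> (nat \<Rightarrow> real) set" where
  "include_face V b \<sigma> v = (\<lambda>i\<in>V. if i \<in> \<sigma> then antipodal_class (v i) else b i)"

abbreviation projective_polyhedral_product :: "'i set \<Rightarrow> ('i \<Rightarrow> nat) \<Rightarrow> ('i \<Rightarrow> (nat \<Rightarrow> real) set) \<Rightarrow> 'i set set \<Rightarrow> ('i \<Rightarrow> (nat \<Rightarrow> real) set) topology" where
  "projective_polyhedral_product V n b K \<equiv> polyhedral_product V (\<lambda>i. real_projective_space (n i)) b K"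

lemma continuous_map_include_face:
  assumes "\<sigma> \<in> K" "\<sigma> \<subseteq> V" and b: "\<And>i. i \<in> V \<Longrightarrow> b i \<in> topspace (real_projective_space (n i))"
    and v: "\<And>i. i \<in> \<sigma> \<Longrightarrow> continuous_map Z (nsphere (n i)) (\<lambda>z. v z i)"
  shows "continuous_map Z (projective_polyhedral_product V n b K) (\<lambda>z. include_face V b \<sigma> (v z))"
proof -
  have comp: "continuous_map Z (real_projective_space (n i)) (\<lambda>z. if i \<in> \<sigma> then antipodal_class (v z i) else b i)" if "i \<in> V" for i
    using continuous_map_compose[OF v continuous_map_antipodal_class] b[OF that]
    by (cases "i \<in> \<sigma>") (auto simp: comp_def)
  have "include_face V b \<sigma> (v z) \<in> (\<Pi>\<^sub>E i\<in>V. if i \<in> \<sigma> then topspace (real_projective_space (n i)) else {b i})" if z: "z \<in> topspace Z" for z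
  proof (rule PiE_I)
    fix i assume i: "i \<in> V"
    show "include_face V b \<sigma> (v z) i \<in> (if i \<in> \<sigma> then topspace (real_projective_space (n i)) else {b i})"
      using funcset_mem[OF continuous_map_funspace[OF comp[OF i]] z] i by (auto simp: include_face_def)
  qed (simp add: include_face_def)
  moreover have "continuous_map Z (product_topology (\<lambda>i. real_projective_space (n i)) V) (\<lambda>z. include_face V b \<sigma> (v z))"
    unfolding include_face_def continuous_map_componentwise using comp by auto
  ultimately show ?thesis
    unfolding polyhedral_product_def continuous_map_in_subtopology using assms(1) by blast
qed

lemma continuous_map_polyhedral_product_projection:
  "i \<in> V \<Longrightarrow> continuous_map (polyhedral_product V X b K) (X i) (\<lambda>x. x i)"
  unfolding polyhedral_product_def
  by (intro continuous_map_from_subtopology continuous_map_product_projection)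

text \<open>A section joins the base point to coordinate \<open>i\<close>. The constant lift
  \<open>\<beta>\<close> at one end and the coordinate at the other give the character
  \<open>{i}\<close>, and taking it \<open>n i\<close> times for each \<open>i\<close> gives the top
  monomial with coefficient 1.\<close>

lemma LS_cat_projective_ge:
  fixes n :: "'i::countable \<Rightarrow> nat"
  assumes V: "finite V" and \<sigma>: "\<sigma> \<in> K" "\<sigma> \<subseteq> V"
    and b: "\<And>i. i \<in> V \<Longrightarrow> b i \<in> topspace (real_projective_space (n i))"
  shows "enat (\<Sum>i\<in>\<sigma>. n i) \<le> LS_cat (projective_polyhedral_product V n b K) (restrict b V)"
  unfolding LS_cat_def
proof (rule secat_geI)
  let ?P = "projective_polyhedral_product V n b K"
  fix q and U :: "nat \<Rightarrow> ('i \<Rightarrow> (nat \<Rightarrow> real) set) set"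
  assume q: "enat q < enat (\<Sum>i\<in>\<sigma>. n i)"
    and U: "\<And>k. k \<le> q \<Longrightarrow> openin ?P (U k)" "(\<Union>k\<le>q. U k) = topspace ?P"
    and sec: "\<And>k. k \<le> q \<Longrightarrow> \<exists>s. local_section (based_path_space ?P (restrict b V)) ?P (\<lambda>\<alpha>. \<alpha> 1) (U k) s"
  have fin: "finite \<sigma>" using V \<sigma>(2) by (rule finite_subset[rotated])
  then obtain il where il: "set il = \<sigma>" "distinct il" using finite_distinct_list by blast
  define Xs where "Xs = concat (map (\<lambda>i. replicate (n i) {i}) il)"
  have len: "length Xs = (\<Sum>i\<in>\<sigma>. n i)"
    unfolding Xs_def length_concat using il by (simp add: comp_def sum_list_distinct_conv_sum_set)
  have coeff: "forms_coeff \<sigma> n Xs = 1"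
    using forms_coeff_singletons[of il \<sigma> n "[]"] il by (simp add: Xs_def)
  let ?\<psi> = "include_face V b \<sigma>"
  have proj: "continuous_map (sphere_product \<sigma> n) (nsphere (n i)) (\<lambda>m. m i)" if "i \<in> \<sigma>" for i
    using continuous_map_product_projection[OF that, of "\<lambda>a. nsphere (n a)"] .
  have \<psi>: "continuous_map (sphere_product \<sigma> n) ?P ?\<psi>"
    by (rule continuous_map_include_face[where v = "\<lambda>z. z", OF \<sigma> b proj])
  show False
  proof (rule no_small_trivialising_cover[OF fin len coeff \<psi> _ U])
    show "?\<psi> (antipode_at a m) = ?\<psi> m" for a m
      by (auto simp: include_face_def antipode_at_def fun_eq_iff)
    show "q < length Xs" using q len by simp
    fix k X assume k: "k \<le> q" and "X \<in> set Xs"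
    then obtain i where i: "i \<in> \<sigma>" "X = {i}" using il by (auto simp: Xs_def)
    obtain \<beta> where \<beta>: "\<beta> \<in> topspace (nsphere (n i))" "b i = antipodal_class \<beta>"
      using b[of i] i(1) \<sigma>(2) by (meson real_projective_spaceE subsetD)
    obtain s where ls: "local_section (based_path_space ?P (restrict b V)) ?P (\<lambda>\<alpha>. \<alpha> 1) (U k) s"
      using sec[OF k] by blast
    then have s: "continuous_map (subtopology ?P (U k)) (path_space ?P) s"
      and s1: "\<And>y. y \<in> U k \<Longrightarrow> s y 1 = y"
      by (simp_all add: local_section_def based_path_space_def continuous_map_in_subtopology)
    have "s \<in> topspace (subtopology ?P (U k)) \<rightarrow> {\<alpha>. \<alpha> 0 = restrict b V}"
      using ls by (simp add: local_section_def based_path_space_def continuous_map_in_subtopology)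
    then have s0: "\<And>y. y \<in> topspace ?P \<Longrightarrow> y \<in> U k \<Longrightarrow> s y 0 = restrict b V"
      by (simp add: Pi_iff)
    have "continuous_map (prod_topology (subtopology ?P (U k)) (top_of_set {0..1})) (real_projective_space (n i)) ((\<lambda>x. x i) \<circ> (\<lambda>(z, t). s z t))"
      by (rule continuous_map_compose[OF continuous_map_path_space_eval[OF s]],
          rule continuous_map_polyhedral_product_projection) (use i \<sigma> in auto)
    then have H: "continuous_map (prod_topology (subtopology ?P (U k)) (top_of_set {0..1})) (real_projective_space (n i)) (\<lambda>(z, t). s z t i)"
      by (simp add: comp_def case_prod_unfold)
    show "trivialises \<sigma> n ?P ?\<psi> (U k) X"
      unfolding trivialises_def
    proof (intro exI conjI ballI impI)
      show "continuous_map (sphere_product \<sigma> n) (nsphere (n i)) (\<lambda>_. \<beta>)" using \<beta>(1) by simp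
      show "continuous_map (sphere_product \<sigma> n) (nsphere (n i)) (\<lambda>m. m i)"
        by (rule proj[OF i(1)])
      show "continuous_map (prod_topology (subtopology ?P (U k)) (top_of_set {0..1})) (real_projective_space (n i)) (\<lambda>(z, t). s z t i)"
        by (rule H)
      fix m assume m: "m \<in> topspace (sphere_product \<sigma> n)" "?\<psi> m \<in> U k"
      have mP: "?\<psi> m \<in> topspace ?P" using continuous_map_funspace[OF \<psi>] m(1) by blast
      have iV: "i \<in> V" using i \<sigma> by blast
      show "antipodal_class \<beta> = s (?\<psi> m) 0 i"
        using s0[OF mP m(2)] iV \<beta> by simp
      show "antipodal_class (m i) = s (?\<psi> m) 1 i"
        using s1[OF m(2)] iV i by (simp add: include_face_def)
    next
      fix a assume "a \<in> \<sigma>"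
      show "(a \<in> X) = (False \<noteq> (a = i))" using i by simp
      show "flips a (topspace (sphere_product \<sigma> n)) False (\<lambda>_. \<beta>)" by (simp add: flips_def)
      show "flips a (topspace (sphere_product \<sigma> n)) (a = i) (\<lambda>m. m i)"
        by (auto simp: flips_def antipode_at_def)
    qed
  qed
qed

text \<open>Between sampling time \<open>j\<close> and the last one, a section joins the classes of
  \<open>m (j, i)\<close> and \<open>m (c, i)\<close>. Either antipode flips one end, so the
  character is \<open>{(j, i), (c, i)}\<close>, as \<open>TC_forms\<close> requires.\<close>

lemma TC_projective_ge:
  fixes n :: "'i::countable \<Rightarrow> nat"
  assumes V: "finite V" and \<sigma>: "\<sigma> \<in> K" "\<sigma> \<subseteq> V"
    and b: "\<And>i. i \<in> V \<Longrightarrow> b i \<in> topspace (real_projective_space (n i))"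
    and r: "r \<ge> 2" and even: "\<And>i. i \<in> \<sigma> \<Longrightarrow> even (n i)" and large: "\<And>i. i \<in> \<sigma> \<Longrightarrow> n i < r"
  shows "enat (r * (\<Sum>i\<in>\<sigma>. n i)) \<le> TC r (projective_polyhedral_product V n b K)"
  unfolding TC_def
proof (rule secat_geI)
  let ?P = "projective_polyhedral_product V n b K"
  let ?B = "product_topology (\<lambda>_. ?P) {..<r}"
  fix q and U :: "nat \<Rightarrow> (nat \<Rightarrow> 'i \<Rightarrow> (nat \<Rightarrow> real) set) set"
  assume q: "enat q < enat (r * (\<Sum>i\<in>\<sigma>. n i))"
    and U: "\<And>k. k \<le> q \<Longrightarrow> openin ?B (U k)" "(\<Union>k\<le>q. U k) = topspace ?B"
    and sec: "\<And>k. k \<le> q \<Longrightarrow> \<exists>s. local_section (path_space ?P) ?B (multi_eval r) (U k) s"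
  define c where "c = r - 1"
  have rc: "r = Suc c" "c \<ge> 1" using r by (simp_all add: c_def)
  have fin: "finite \<sigma>" using V \<sigma>(2) by (rule finite_subset[rotated])
  then obtain il where il: "set il = \<sigma>" "distinct il" using finite_distinct_list by blast
  define A where "A = {..<r} \<times> \<sigma>"
  define N where "N = (\<lambda>(j :: nat, i). if i \<in> \<sigma> then n i else 0)"
  define Xs where "Xs = TC_forms n c il"
  have finA: "finite A" using fin by (simp add: A_def)
  have len: "length Xs = (\<Sum>a\<in>A. N a)"
  proof -
    have "length Xs = Suc c * (\<Sum>i\<in>\<sigma>. n i)"
      unfolding Xs_def using length_TC_forms[of il n c] il large rc by (simp add: less_Suc_eq_le)
    also have "\<dots> = (\<Sum>(j, i)\<in>{..<r} \<times> \<sigma>. n i)"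
      by (simp add: sum.cartesian_product[symmetric] rc)
    also have "\<dots> = (\<Sum>a\<in>A. N a)"
      by (intro sum.cong) (auto simp: A_def N_def)
    finally show ?thesis .
  qed
  have coeff: "forms_coeff A N Xs = 1"
    unfolding Xs_def
    by (rule forms_coeff_TC_forms[where B = \<sigma>]) (use il even large rc in \<open>auto simp: A_def N_def less_Suc_eq_le\<close>)
  define \<psi> where "\<psi> m = (\<lambda>j\<in>{..<r}. include_face V b \<sigma> (\<lambda>i. m (j, i)))" for m :: "nat \<times> 'i \<Rightarrow> nat \<Rightarrow> real"
  have proj: "continuous_map (sphere_product A N) (nsphere (n i)) (\<lambda>m. m (j, i))" if "i \<in> \<sigma>" "j < r" for i j
    using continuous_map_product_projection[of "(j, i)" A "\<lambda>a. nsphere (N a)"] that by (simp add: A_def N_def)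
  have "continuous_map (sphere_product A N) ?P (\<lambda>m. include_face V b \<sigma> (\<lambda>i. m (j, i)))" if "j < r" for j
    by (rule continuous_map_include_face[OF \<sigma> b]) (use proj that in auto)
  then have \<psi>: "continuous_map (sphere_product A N) ?B \<psi>"
    unfolding \<psi>_def continuous_map_componentwise by auto
  show False
  proof (rule no_small_trivialising_cover[OF finA len coeff \<psi> _ U])
    show "\<psi> (antipode_at a m) = \<psi> m" for a m
      by (auto simp: \<psi>_def include_face_def antipode_at_def fun_eq_iff)
    have "length Xs = r * (\<Sum>i\<in>\<sigma>. n i)"
      unfolding Xs_def using length_TC_forms[of il n c] il large rc by (simp add: less_Suc_eq_le)
    then show "q < length Xs" using q by simp
    fix k X assume k: "k \<le> q" and "X \<in> set Xs"
    then obtain i j where i: "i \<in> \<sigma>" and j: "j < c" and X: "X = {(j, i), (c, i)}"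
      using il by (auto simp: Xs_def TC_forms_def star_forms_def split: if_splits)
    have jc: "j < r" "c < r" using j rc by simp_all
    obtain s where s: "continuous_map (subtopology ?B (U k)) (path_space ?P) s"
      and sU: "\<And>y. y \<in> U k \<Longrightarrow> multi_eval r (s y) = y"
      using sec[OF k] unfolding local_section_def by blast
    \<comment> \<open>Affine parametrisation of the time interval from \<open>j / c\<close> to
      1.\<close>
    define \<tau> where "\<tau> t = (1 - t) * (real j / real c) + t" for t :: real
    have \<tau>: "\<tau> t \<in> {0..1}" if "t \<in> {0..1}" for t
    proof -
      have "real j / real c \<le> 1" "0 \<le> real j / real c" using j by (auto simp: field_simps)
      then have "(1 - t) * (real j / real c) \<le> (1 - t) * 1" "0 \<le> (1 - t) * (real j / real c)"
        using that by (intro mult_left_mono mult_nonneg_nonneg; simp)+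
      then show ?thesis using that by (auto simp: \<tau>_def)
    qed
    have "continuous_map (top_of_set {0..1}) (top_of_set {0..1}) \<tau>"
      using \<tau> rc(2) unfolding \<tau>_def by (auto intro!: continuous_intros simp: Pi_iff)
    then have "continuous_map (prod_topology (subtopology ?B (U k)) (top_of_set {0..1})) (prod_topology (subtopology ?B (U k)) (top_of_set {0..1})) (\<lambda>(z, t). (z, \<tau> t))"
      unfolding case_prod_unfold
      by (intro continuous_map_pairedI continuous_map_fst continuous_map_compose[OF continuous_map_snd, unfolded comp_def])
    from continuous_map_compose[OF this continuous_map_path_space_eval[OF s]]
    have "continuous_map (prod_topology (subtopology ?B (U k)) (top_of_set {0..1})) (real_projective_space (n i)) ((\<lambda>x. x i) \<circ> ((\<lambda>(z, t). s z t) \<circ> (\<lambda>(z, t). (z, \<tau> t))))"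
      by (rule continuous_map_compose)
        (rule continuous_map_polyhedral_product_projection, use i \<sigma> in blast)
    then have H: "continuous_map (prod_topology (subtopology ?B (U k)) (top_of_set {0..1})) (real_projective_space (n i)) (\<lambda>(z, t). s z (\<tau> t) i)"
      by (simp add: comp_def case_prod_unfold)
    show "trivialises A N ?B \<psi> (U k) X"
      unfolding trivialises_def
    proof (intro exI conjI ballI impI)
      show "continuous_map (sphere_product A N) (nsphere (n i)) (\<lambda>m. m (j, i))" by (rule proj[OF i jc(1)])
      show "continuous_map (sphere_product A N) (nsphere (n i)) (\<lambda>m. m (c, i))" by (rule proj[OF i jc(2)])
      show "continuous_map (prod_topology (subtopology ?B (U k)) (top_of_set {0..1})) (real_projective_space (n i)) (\<lambda>(z, t). s z (\<tau> t) i)"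
        by (rule H)
      fix m assume m: "m \<in> topspace (sphere_product A N)" "\<psi> m \<in> U k"
      have iV: "i \<in> V" using i \<sigma> by blast
      have "\<forall>j<r. s (\<psi> m) (real j / (real r - 1)) = \<psi> m j"
        using sU[OF m(2)] multi_eval_eq_iff[of "\<psi> m" r "s (\<psi> m)"] by (simp add: \<psi>_def)
      then have e: "s (\<psi> m) (real l / real c) i = antipodal_class (m (l, i))" if "l < r" for l
        using that iV i rc by (simp add: \<psi>_def include_face_def)
      show "antipodal_class (m (j, i)) = s (\<psi> m) (\<tau> 0) i"
        using e[OF jc(1)] by (simp add: \<tau>_def)
      show "antipodal_class (m (c, i)) = s (\<psi> m) (\<tau> 1) i"
        using e[OF jc(2)] rc by (simp add: \<tau>_def)
    next
      fix a assume "a \<in> A"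
      show "(a \<in> X) = ((a = (j, i)) \<noteq> (a = (c, i)))" using X j by auto
      show "flips a (topspace (sphere_product A N)) (a = (j, i)) (\<lambda>m. m (j, i))"
        "flips a (topspace (sphere_product A N)) (a = (c, i)) (\<lambda>m. m (c, i))"
        by (auto simp: flips_def antipode_at_def)
    qed
  qed
qed

subsection \<open>Affine charts and coverings by multi-indices\<close>

text \<open>Form 0 is a multiple of a coordinate that does not vanish at \<open>b\<close>. The
  others are 2 by 2 minors of the pair of vectors \<open>v\<close> and \<open>b\<close>, so they
  vanish at \<open>b\<close>.\<close>

lemma separating_linear_forms:
  assumes b: "b \<in> topspace (nsphere N)"
  obtains \<eta> :: "nat \<Rightarrow> nat \<Rightarrow> real" where
    "\<And>l. 0 < l \<Longrightarrow> l \<le> N \<Longrightarrow> (\<Sum>i\<le>N. b i * \<eta> l i) = 0" "(\<Sum>i\<le>N. b i * \<eta> 0 i) > 0"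
    "\<And>v. v \<in> topspace (nsphere N) \<Longrightarrow> \<exists>l\<le>N. (\<Sum>i\<le>N. v i * \<eta> l i) \<noteq> 0"
proof -
  have "\<exists>p\<le>N. b p \<noteq> 0"
  proof (rule ccontr)
    assume "\<not> ?thesis"
    then have "(\<Sum>i\<le>N. (b i)\<^sup>2) = 0" by simp
    then show False using b by (simp add: in_nsphere_iff)
  qed
  then obtain p where p: "p \<le> N" "b p \<noteq> 0" by blast
  \<comment> \<open>A bijection from \<open>1, ..., N\<close> onto the indices other than
    \<open>p\<close>.\<close>
  define \<pi> where "\<pi> l = (if l = p then 0 else l)" for l
  define \<eta> where "\<eta> l i = (if l = 0 then (if i = p then b p else 0)
    else (if i = \<pi> l then b p else 0) - (if i = p then b (\<pi> l) else 0))" for l i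
  have e0: "(\<Sum>i\<le>N. v i * \<eta> 0 i) = v p * b p" for v
    using p(1) by (simp add: \<eta>_def if_distrib cong: if_cong)
  have e: "(\<Sum>i\<le>N. v i * \<eta> l i) = v (\<pi> l) * b p - v p * b (\<pi> l)" if "0 < l" "l \<le> N" for v l
  proof -
    have "\<pi> l \<le> N" using that by (simp add: \<pi>_def)
    moreover have "v i * \<eta> l i = (if i = \<pi> l then v i * b p else 0) - (if i = p then v i * b (\<pi> l) else 0)" for i
      using that(1) by (simp add: \<eta>_def right_diff_distrib)
    ultimately show ?thesis
      using p(1) by (simp add: sum_subtractf)
  qed
  show ?thesis
  proof (rule that[of \<eta>])
    show "(\<Sum>i\<le>N. b i * \<eta> l i) = 0" if "0 < l" "l \<le> N" for l
      using e[OF that, of b] by simp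
    show "(\<Sum>i\<le>N. b i * \<eta> 0 i) > 0"
      unfolding e0 using p(2) by (metis not_real_square_gt_zero)
    show "\<exists>l\<le>N. (\<Sum>i\<le>N. v i * \<eta> l i) \<noteq> 0" if v: "v \<in> topspace (nsphere N)" for v
    proof (rule ccontr)
      assume "\<not> ?thesis"
      then have z: "(\<Sum>i\<le>N. v i * \<eta> l i) = 0" if "l \<le> N" for l using that by blast
      have vp: "v p = 0" using z[of 0] e0[of v] p(2) by simp
      have "v i = 0" if "i \<le> N" for i
      proof (cases "i = p")
        case False
        define l where "l = (if i = 0 then p else i)"
        have "0 < l" "l \<le> N" "\<pi> l = i" using False that p(1) by (auto simp: l_def \<pi>_def)
        then show ?thesis using z[of l] e[of l v] vp p(2) by simp
      qed (simp add: vp)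
      then have "(\<Sum>i\<le>N. (v i)\<^sup>2) = 0" by simp
      then show False using v by (simp add: in_nsphere_iff)
    qed
  qed
qed

lemma normalize_in_nsphere:
  assumes "(\<Sum>i\<le>N. (u i)\<^sup>2) \<noteq> 0" "\<And>i. i > N \<Longrightarrow> u i = 0"
  shows "(\<lambda>i. u i / sqrt (\<Sum>i\<le>N. (u i)\<^sup>2)) \<in> topspace (nsphere N)"
proof -
  have "(\<Sum>i\<le>N. (u i)\<^sup>2) \<ge> 0" by (intro sum_nonneg) auto
  then have "(\<Sum>i\<le>N. (u i / sqrt (\<Sum>i\<le>N. (u i)\<^sup>2))\<^sup>2) = 1"
    using assms(1) by (simp add: power_divide sum_divide_distrib[symmetric])
  then show ?thesis using assms(2) by (simp add: in_nsphere_iff)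
qed

text \<open>The open sets \<open>a l > 0\<close> are affine charts; each is contracted to \<open>b\<close> along straight lines, which
  avoid the origin because the \<open>l\<close>-th linear form is positive on one end and nonnegative on \<open>b\<close>.\<close>

lemma projective_contractions:
  assumes b: "b \<in> topspace (real_projective_space N)"
  obtains a :: "nat \<Rightarrow> (nat \<Rightarrow> real) set \<Rightarrow> real" and h :: "nat \<Rightarrow> (nat \<Rightarrow> real) set \<Rightarrow> real \<Rightarrow> (nat \<Rightarrow> real) set"
  where "\<And>l. continuous_map (real_projective_space N) euclideanreal (a l)"
    "\<And>l c. c \<in> topspace (real_projective_space N) \<Longrightarrow> a l c \<ge> 0"
    "\<And>c. c \<in> topspace (real_projective_space N) \<Longrightarrow> \<exists>l\<le>N. a l c > 0"
    "\<And>l. l \<le> N \<Longrightarrow> a l b > 0 \<Longrightarrow> l = 0"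
    "\<And>l. l \<le> N \<Longrightarrow> continuous_map (prod_topology (subtopology (real_projective_space N) {c. a l c > 0}) (top_of_set {0..1}))
       (real_projective_space N) (\<lambda>(c, t). h l c t)"
    "\<And>l c. c \<in> topspace (real_projective_space N) \<Longrightarrow> a l c > 0 \<Longrightarrow> h l c 0 = c"
    "\<And>l c. h l c 1 = b" "\<And>t. h 0 b t = b"
proof -
  obtain \<beta> where \<beta>: "\<beta> \<in> topspace (nsphere N)" "b = antipodal_class \<beta>"
    using b by (rule real_projective_spaceE)
  obtain \<eta> :: "nat \<Rightarrow> nat \<Rightarrow> real" where \<eta>:
    "\<And>l. 0 < l \<Longrightarrow> l \<le> N \<Longrightarrow> (\<Sum>i\<le>N. \<beta> i * \<eta> l i) = 0" "(\<Sum>i\<le>N. \<beta> i * \<eta> 0 i) > 0"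
    "\<And>v. v \<in> topspace (nsphere N) \<Longrightarrow> \<exists>l\<le>N. (\<Sum>i\<le>N. v i * \<eta> l i) \<noteq> 0"
    by (rule separating_linear_forms[OF \<beta>(1)]) (rule that)
  let ?P = "real_projective_space N"
  \<comment> \<open>The square of the \<open>l\<close>-th form at a unit representative; the form
    itself is defined only up to sign on a class.\<close>
  define a where "a l c = (\<Sum>i\<le>N. \<Sum>j\<le>N. proj_matrix c i j * \<eta> l i * \<eta> l j)" for l c
  define x where "x l c = nearest_rep N c (\<eta> l)" for l c
  define u where "u l c t i = (1 - t) * x l c i + t * \<beta> i" for l c i and t :: real
  define w where "w l c t = (\<lambda>i. u l c t i / sqrt (\<Sum>i\<le>N. (u l c t i)\<^sup>2))" for l c t
  define h where "h l c t = antipodal_class (w l c t)" for l c t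
  have a_class: "a l (antipodal_class v) = (\<Sum>i\<le>N. v i * \<eta> l i)\<^sup>2" for l v
    unfolding a_def by (rule quadratic_form_class)
  have wself: "w l c t = v" if "u l c t = v" "v \<in> topspace (nsphere N)" for l c t v
    using that by (simp add: w_def in_nsphere_iff)
  have \<beta>pos: "(\<Sum>i\<le>N. \<beta> i * \<eta> l i) \<ge> 0" if "l \<le> N" for l
    using \<eta>(1)[of l] \<eta>(2) that by (cases "l = 0") auto
  have x_props: "antipodal_class (x l c) = c" "x l c \<in> topspace (nsphere N)" "(\<Sum>i\<le>N. x l c i * \<eta> l i) > 0"
    if "c \<in> topspace ?P" "a l c > 0" for l c
    using nearest_rep_props[OF that(1), of "\<eta> l"] that(2) by (simp_all add: a_def x_def)
  have unz: "(\<Sum>i\<le>N. (u l c t i)\<^sup>2) \<noteq> 0" if c: "c \<in> topspace ?P" "a l c > 0" and l: "l \<le> N" and t: "t \<in> {0..1}" for l c t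
  proof (cases "t = 1")
    case True
    then show ?thesis using \<beta>(1) by (simp add: u_def in_nsphere_iff)
  next
    case False
    then have "(1 - t) * (\<Sum>i\<le>N. x l c i * \<eta> l i) > 0"
      using t x_props(3)[OF c] by (intro mult_pos_pos) auto
    moreover have "t * (\<Sum>i\<le>N. \<beta> i * \<eta> l i) \<ge> 0"
      using t \<beta>pos[OF l] by simp
    ultimately have "(\<Sum>i\<le>N. u l c t i * \<eta> l i) > 0"
      by (simp add: u_def distrib_right sum.distrib sum_distrib_left mult.assoc)
    moreover have "(\<Sum>i\<le>N. u l c t i * \<eta> l i) = 0" if "(\<Sum>i\<le>N. (u l c t i)\<^sup>2) = 0"
    proof -
      have "u l c t i = 0" if "i \<le> N" for i
        using \<open>(\<Sum>i\<le>N. (u l c t i)\<^sup>2) = 0\<close> that by (simp add: sum_nonneg_eq_0_iff)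
      then show ?thesis by simp
    qed
    ultimately show ?thesis by auto
  qed
  have win: "w l c t \<in> topspace (nsphere N)" if c: "c \<in> topspace ?P" "a l c > 0" "l \<le> N" "t \<in> {0..1}" for l c t
    unfolding w_def
  proof (rule normalize_in_nsphere[OF unz[OF c]])
    fix i assume "i > N"
    then show "u l c t i = 0"
      using x_props(2)[OF c(1,2)] \<beta>(1) by (simp add: u_def in_nsphere_iff)
  qed
  show ?thesis
  proof (rule that[of a h])
    show ca: "continuous_map ?P euclideanreal (a l)" for l
      unfolding a_def
      by (intro continuous_map_sum continuous_map_real_mult continuous_map_proj_matrix continuous_map_canonical_const) auto
    show "a l c \<ge> 0" if "c \<in> topspace ?P" for l c
      using that by (auto elim!: real_projective_spaceE simp: a_class)
    show "\<exists>l\<le>N. a l c > 0" if c: "c \<in> topspace ?P" for c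
    proof -
      obtain v where v: "v \<in> topspace (nsphere N)" "c = antipodal_class v"
        using c by (rule real_projective_spaceE)
      then show ?thesis using \<eta>(3)[OF v(1)] by (auto simp: a_class)
    qed
    show "l = 0" if "l \<le> N" "a l b > 0" for l
      using that \<eta>(1)[of l] by (cases "l = 0") (auto simp: \<beta>(2) a_class)
    show "h l c 0 = c" if "c \<in> topspace ?P" "a l c > 0" for l c
    proof -
      have "u l c 0 = x l c" by (simp add: u_def fun_eq_iff)
      then show ?thesis using x_props[OF that] wself by (simp add: h_def)
    qed
    show "h l c 1 = b" for l c
    proof -
      have "u l c 1 = \<beta>" by (simp add: u_def fun_eq_iff)
      then show ?thesis using \<beta> wself by (simp add: h_def)
    qed
    \<comment> \<open>Chart 0 is the only one containing the base point. Fixing the base point there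
      later keeps contractions inside the polyhedral product.\<close>
    show "h 0 b t = b" for t
    proof -
      have "x 0 b = \<beta>" using \<eta>(2) by (simp add: x_def \<beta>(2) nearest_rep_class)
      then have "u 0 b t = \<beta>" by (simp add: u_def fun_eq_iff algebra_simps)
      then show ?thesis using wself[of 0 b t \<beta>] \<beta> by (simp add: h_def)
    qed
    show "continuous_map (prod_topology (subtopology ?P {c. a l c > 0}) (top_of_set {0..1})) ?P (\<lambda>(c, t). h l c t)" if l: "l \<le> N" for l
    proof -
      let ?Q = "prod_topology (subtopology ?P {c. a l c > 0}) (top_of_set {0..1::real})"
      have fst: "continuous_map ?Q ?P fst"
        using continuous_map_fst[of "subtopology ?P {c. a l c > 0}" "top_of_set {0..1::real}"]
        by (simp add: continuous_map_in_subtopology)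
      have snd: "continuous_map ?Q euclideanreal snd"
        using continuous_map_snd[of "subtopology ?P {c. a l c > 0}" "top_of_set {0..1::real}"]
        by (simp add: continuous_map_in_subtopology)
      have pm: "continuous_map ?Q euclideanreal (\<lambda>q. proj_matrix (fst q) i j)" for i j
        using continuous_map_compose[OF fst continuous_map_proj_matrix[of N i j]] by (simp add: comp_def)
      have xc: "continuous_map ?Q euclideanreal (\<lambda>q. x l (fst q) i)" for i
        unfolding x_def nearest_rep_def
        by (intro continuous_map_real_divide continuous_map_sqrt continuous_map_sum continuous_map_real_mult pm continuous_map_canonical_const)
          (auto simp: a_def)
      have uc: "continuous_map ?Q euclideanreal (\<lambda>q. u l (fst q) (snd q) i)" for i
        unfolding u_def
        by (intro continuous_map_add continuous_map_diff continuous_map_real_mult xc snd continuous_map_canonical_const)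
      have "continuous_map ?Q (nsphere N) (\<lambda>q. w l (fst q) (snd q))"
        unfolding continuous_map_nsphere_iff
      proof (intro conjI allI ballI)
        show "continuous_map ?Q euclideanreal (\<lambda>q. w l (fst q) (snd q) i)" for i
          unfolding w_def
          by (intro continuous_map_real_divide continuous_map_sqrt continuous_map_sum continuous_map_real_pow uc)
            (use unz l in auto)
        show "w l (fst q) (snd q) \<in> topspace (nsphere N)" if "q \<in> topspace ?Q" for q
          using that l by (intro win) auto
      qed
      from continuous_map_compose[OF this continuous_map_antipodal_class]
      show ?thesis by (simp add: h_def comp_def case_prod_unfold)
    qed
  qed
qed

text \<open>An open neighbourhood of the cell where \<open>I e\<close> is the last index whose
  function does not vanish. The sum of \<open>I\<close> is the dimension of the cell, and the strict
  comparison among equal sums separates cells of one dimension.\<close>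

definition dominance_set ::
  "'z topology \<Rightarrow> 'l set \<Rightarrow> ('l \<Rightarrow> nat) \<Rightarrow> ('l \<Rightarrow> nat \<Rightarrow> 'z \<Rightarrow> real) \<Rightarrow> ('l \<Rightarrow> nat) \<Rightarrow> 'z set" where
  "dominance_set Z \<Lambda> N a I = {z \<in> topspace Z. (\<Prod>e\<in>\<Lambda>. a e (I e) z) > 0 \<and>
     (\<forall>I'\<in>PiE \<Lambda> (\<lambda>e. {..N e}). I' \<noteq> I \<longrightarrow> sum I' \<Lambda> = sum I \<Lambda> \<longrightarrow>
        (\<Prod>e\<in>\<Lambda>. a e (I' e) z) < (\<Prod>e\<in>\<Lambda>. a e (I e) z))}"

lemma openin_dominance_set:
  assumes "finite \<Lambda>" "\<And>e l. e \<in> \<Lambda> \<Longrightarrow> continuous_map Z euclideanreal (a e l)"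
  shows "openin Z (dominance_set Z \<Lambda> N a I)"
proof -
  define g where "g I z = (\<Prod>e\<in>\<Lambda>. a e (I e) z)" for I z
  define \<I> where "\<I> = {I' \<in> PiE \<Lambda> (\<lambda>e. {..N e}). I' \<noteq> I \<and> sum I' \<Lambda> = sum I \<Lambda>}"
  have fin: "finite \<I>" using assms(1) by (simp add: \<I>_def finite_PiE)
  have g: "continuous_map Z euclideanreal (g I)" for I
    unfolding g_def using assms by (intro continuous_map_prod) auto
  have o: "openin Z {z \<in> topspace Z. f z \<in> {0<..}}" if "continuous_map Z euclideanreal f" for f :: "_ \<Rightarrow> real"
    by (rule openin_continuous_map_preimage[OF that]) simp
  have o2: "openin Z {z \<in> topspace Z. g I z - g I' z \<in> {0<..}}" for I'
    by (intro o continuous_map_diff g)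
  have "dominance_set Z \<Lambda> N a I = {z \<in> topspace Z. g I z \<in> {0<..}} \<inter>
    (topspace Z \<inter> (\<Inter>I'\<in>\<I>. {z \<in> topspace Z. g I z - g I' z \<in> {0<..}}))"
    by (auto simp: dominance_set_def g_def \<I>_def)
  moreover have "openin Z (topspace Z \<inter> (\<Inter>I'\<in>\<I>. {z \<in> topspace Z. g I z - g I' z \<in> {0<..}}))"
  proof (cases "\<I> = {}")
    case False
    then have "openin Z (\<Inter>I'\<in>\<I>. {z \<in> topspace Z. g I z - g I' z \<in> {0<..}})"
      using fin o2 by (intro openin_INT2) auto
    then show ?thesis by (simp add: openin_Int)
  qed simp
  ultimately show ?thesis using o[OF g] by (simp add: openin_Int)
qed

lemma dominance_set_pos:
  assumes "finite \<Lambda>" "\<And>e l. e \<in> \<Lambda> \<Longrightarrow> z \<in> topspace Z \<Longrightarrow> a e l z \<ge> 0" "z \<in> dominance_set Z \<Lambda> N a I" "e \<in> \<Lambda>"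
  shows "a e (I e) z > 0"
proof -
  have z: "z \<in> topspace Z" "(\<Prod>e\<in>\<Lambda>. a e (I e) z) > 0"
    using assms(3) by (auto simp: dominance_set_def)
  then have "a e (I e) z \<noteq> 0"
    using assms(1,4) by (metis less_irrefl prod_zero)
  then show ?thesis using assms(2)[OF assms(4) z(1), of "I e"] by simp
qed

lemma dominance_set_disjoint:
  assumes "I \<in> PiE \<Lambda> (\<lambda>e. {..N e})" "I' \<in> PiE \<Lambda> (\<lambda>e. {..N e})" "sum I \<Lambda> = sum I' \<Lambda>"
    "z \<in> dominance_set Z \<Lambda> N a I" "z \<in> dominance_set Z \<Lambda> N a I'"
  shows "I = I'"
proof (rule ccontr)
  assume "I \<noteq> I'"
  then have "(\<Prod>e\<in>\<Lambda>. a e (I' e) z) < (\<Prod>e\<in>\<Lambda>. a e (I e) z)" "(\<Prod>e\<in>\<Lambda>. a e (I e) z) < (\<Prod>e\<in>\<Lambda>. a e (I' e) z)"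
    using assms by (auto simp: dominance_set_def)
  then show False by simp
qed

text \<open>Take the last index at which the functions do not vanish: a different multi-index with the same sum
  exceeds it somewhere.\<close>

lemma dominance_sets_cover:
  assumes fin: "finite \<Lambda>" and nonneg: "\<And>e l. e \<in> \<Lambda> \<Longrightarrow> a e l z \<ge> 0"
    and ex: "\<And>e. e \<in> \<Lambda> \<Longrightarrow> \<exists>l\<le>N e. a e l z > 0" and z: "z \<in> topspace Z"
  shows "\<exists>I\<in>PiE \<Lambda> (\<lambda>e. {..N e}). z \<in> dominance_set Z \<Lambda> N a I"
proof -
  define I where "I = (\<lambda>e\<in>\<Lambda>. Max {l. l \<le> N e \<and> a e l z > 0})"
  have I: "I e \<le> N e" "a e (I e) z > 0" "\<And>l. l \<le> N e \<Longrightarrow> a e l z > 0 \<Longrightarrow> l \<le> I e" if "e \<in> \<Lambda>" for e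
  proof -
    have "Max {l. l \<le> N e \<and> a e l z > 0} \<in> {l. l \<le> N e \<and> a e l z > 0}"
      using ex[OF that] by (intro Max_in) auto
    then show "I e \<le> N e" "a e (I e) z > 0" using that by (auto simp: I_def)
    show "l \<le> I e" if "l \<le> N e" "a e l z > 0" for l
      using that \<open>e \<in> \<Lambda>\<close> by (auto simp: I_def)
  qed
  have pos: "(\<Prod>e\<in>\<Lambda>. a e (I e) z) > 0"
    using I(2) by (intro prod_pos) auto
  have "(\<Prod>e\<in>\<Lambda>. a e (I' e) z) < (\<Prod>e\<in>\<Lambda>. a e (I e) z)"
    if I': "I' \<in> PiE \<Lambda> (\<lambda>e. {..N e})" "I' \<noteq> I" "sum I' \<Lambda> = sum I \<Lambda>" for I'
  proof -
    have "\<exists>e\<in>\<Lambda>. I' e > I e"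
    proof (rule ccontr)
      assume "\<not> ?thesis"
      then have le: "I' e \<le> I e" if "e \<in> \<Lambda>" for e using that by force
      have "I' e = I e" if "e \<in> \<Lambda>" for e
        using sum_mono_inv[OF I'(3) le that fin] .
      then have "I' = I"
        using I'(1) by (intro extensionalityI[of _ \<Lambda>]) (auto simp: I_def PiE_def)
      then show False using I'(2) by simp
    qed
    then obtain e where e: "e \<in> \<Lambda>" "I' e > I e" by blast
    then have "\<not> a e (I' e) z > 0"
      using I(3)[of e "I' e"] I'(1) by (auto simp: PiE_iff)
    then have "a e (I' e) z = 0" using nonneg[OF e(1), of "I' e"] by simp
    then have "(\<Prod>e\<in>\<Lambda>. a e (I' e) z) = 0" using fin e(1) by (intro prod_zero) auto
    then show ?thesis using pos by simp
  qed
  then have "z \<in> dominance_set Z \<Lambda> N a I" using z pos by (simp add: dominance_set_def)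
  moreover have "I \<in> PiE \<Lambda> (\<lambda>e. {..N e})" using I(1) by (auto simp: I_def)
  ultimately show ?thesis by blast
qed

subsection \<open>Upper bounds\<close>

text \<open>The maps \<open>x j\<close> are contracted simultaneously: a single one for the
  category, the \<open>r\<close> coordinates for \<open>TC\<close>. Each contributes at most
  \<open>N\<close> to the level, since its coordinates off some face are base points and have index
  0.\<close>

lemma projective_polyhedral_product_cover:
  fixes n :: "'i \<Rightarrow> nat" and N :: nat and Z :: "'z topology"
  assumes V: "finite V" and J: "finite J" and K: "\<And>\<sigma>. \<sigma> \<in> K \<Longrightarrow> \<sigma> \<subseteq> V"
    and b: "\<And>i. i \<in> V \<Longrightarrow> b i \<in> topspace (real_projective_space (n i))"
    and N: "\<And>\<sigma>. \<sigma> \<in> K \<Longrightarrow> (\<Sum>i\<in>\<sigma>. n i) \<le> N"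
    and x: "\<And>j. j \<in> J \<Longrightarrow> continuous_map Z (projective_polyhedral_product V n b K) (x j)"
  obtains W H where
    "\<And>k. openin Z (W k)" "(\<Union>k\<le>card J * N. W k) = topspace Z"
    "\<And>k j. j \<in> J \<Longrightarrow> continuous_map (prod_topology (subtopology Z (W k)) (top_of_set {0..1::real}))
        (projective_polyhedral_product V n b K) (\<lambda>(z, t). H k j z t)"
    "\<And>k j z. j \<in> J \<Longrightarrow> z \<in> W k \<Longrightarrow> H k j z 0 = x j z"
    "\<And>k j z. H k j z 1 = restrict b V"
proof -
  let ?P = "projective_polyhedral_product V n b K"
  let ?R = "\<lambda>i. real_projective_space (n i)"
  \<comment> \<open>The conclusions of \<open>projective_contractions\<close> in one predicate, so
    that charts and contractions can be chosen for all \<open>i\<close> at once.\<close>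
  define good where "good i a h \<longleftrightarrow> (\<forall>l. continuous_map (?R i) euclideanreal (a l)) \<and>
    (\<forall>l. \<forall>c\<in>topspace (?R i). a l c \<ge> 0) \<and>
    (\<forall>c\<in>topspace (?R i). \<exists>l\<le>n i. a l c > 0) \<and>
    (\<forall>l\<le>n i. a l (b i) > 0 \<longrightarrow> l = 0) \<and>
    (\<forall>l\<le>n i. continuous_map (prod_topology (subtopology (?R i) {c. a l c > 0}) (top_of_set {0..1})) (?R i) (\<lambda>(c, t). h l c t)) \<and>
    (\<forall>l. \<forall>c\<in>topspace (?R i). a l c > 0 \<longrightarrow> h l c 0 = c) \<and>
    (\<forall>l c. h l c 1 = b i) \<and> (\<forall>t. h 0 (b i) t = b i)"
    for i and a :: "nat \<Rightarrow> (nat \<Rightarrow> real) set \<Rightarrow> real" and h :: "nat \<Rightarrow> (nat \<Rightarrow> real) set \<Rightarrow> real \<Rightarrow> (nat \<Rightarrow> real) set"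
  have "\<exists>a h. good i a h" if "i \<in> V" for i
    by (rule projective_contractions[OF b[OF that]]) (unfold good_def, blast)
  then have "\<exists>p. good i (fst p) (snd p)" if "i \<in> V" for i using that by auto
  then obtain p where p: "\<And>i. i \<in> V \<Longrightarrow> good i (fst (p i)) (snd (p i))" by metis
  define a h where "a i = fst (p i)" and "h i = snd (p i)" for i
  have ah: "good i (a i) (h i)" if "i \<in> V" for i
    using p[OF that] by (simp add: a_def h_def)
  note g = ah[unfolded good_def]
  have a_cont: "continuous_map (?R i) euclideanreal (a i l)" if "i \<in> V" for i l by (rule g[THEN conjunct1, rule_format, OF that])
  have a_nonneg: "a i l c \<ge> 0" if "i \<in> V" "c \<in> topspace (?R i)" for i l c by (rule g[THEN conjunct2, THEN conjunct1, rule_format, OF that])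
  have a_ex: "\<exists>l\<le>n i. a i l c > 0" if "i \<in> V" "c \<in> topspace (?R i)" for i c by (rule g[THEN conjunct2, THEN conjunct2, THEN conjunct1, rule_format, OF that])
  have a_b: "l = 0" if "i \<in> V" "l \<le> n i" "a i l (b i) > 0" for i l by (rule g[THEN conjunct2, THEN conjunct2, THEN conjunct2, THEN conjunct1, rule_format, OF that])
  have h_cont: "continuous_map (prod_topology (subtopology (?R i) {c. a i l c > 0}) (top_of_set {0..1})) (?R i) (\<lambda>(c, t). h i l c t)"
    if "i \<in> V" "l \<le> n i" for i l by (rule g[THEN conjunct2, THEN conjunct2, THEN conjunct2, THEN conjunct2, THEN conjunct1, rule_format, OF that])
  have h0: "h i l c 0 = c" if "i \<in> V" "c \<in> topspace (?R i)" "a i l c > 0" for i l c by (rule g[THEN conjunct2, THEN conjunct2, THEN conjunct2, THEN conjunct2, THEN conjunct2, THEN conjunct1, rule_format, OF that])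
  have h1: "h i l c 1 = b i" if "i \<in> V" for i l c by (rule g[THEN conjunct2, THEN conjunct2, THEN conjunct2, THEN conjunct2, THEN conjunct2, THEN conjunct2, THEN conjunct1, rule_format, OF that])
  have hb: "h i 0 (b i) t = b i" if "i \<in> V" for i t by (rule g[THEN conjunct2, THEN conjunct2, THEN conjunct2, THEN conjunct2, THEN conjunct2, THEN conjunct2, THEN conjunct2, rule_format, OF that])

  define \<Lambda> where "\<Lambda> = J \<times> V"
  define M where "M = (\<lambda>(j :: 'a, i). n i)"
  define A where "A = (\<lambda>(j, i) l z. a i l (x j z i))"
  define \<I> where "\<I> = PiE \<Lambda> (\<lambda>e. {..M e})"
  define D where "D I = dominance_set Z \<Lambda> M A I" for I
  define W where "W k = (\<Union>I\<in>{I \<in> \<I>. sum I \<Lambda> = k}. D I)" for k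
  \<comment> \<open>Well defined on \<open>W k\<close> because the sets \<open>D I\<close> of equal
    sum are disjoint.\<close>
  define sel where "sel k z = (THE I. I \<in> \<I> \<and> sum I \<Lambda> = k \<and> z \<in> D I)" for k z
  define G where "G I j z t = (\<lambda>i\<in>V. h i (I (j, i)) (x j z i) t)" for I j z t
  \<comment> \<open>The value outside \<open>W k\<close> makes the end point at time 1 correct for
    every \<open>z\<close>.\<close>
  define H where "H k j z t = (if z \<in> W k then G (sel k z) j z t else restrict b V)" for k j z t
  have fin: "finite \<Lambda>" using V J by (simp add: \<Lambda>_def)
  have xc: "continuous_map Z (?R i) (\<lambda>z. x j z i)" if "j \<in> J" "i \<in> V" for i j
    using continuous_map_compose[OF x[OF that(1)] continuous_map_polyhedral_product_projection[of i V ?R b K]] that(2)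
    by (simp add: comp_def)
  have xR: "x j z i \<in> topspace (?R i)" if "j \<in> J" "i \<in> V" "z \<in> topspace Z" for i j z
    using funcset_mem[OF continuous_map_funspace[OF xc] that(3)] that by simp
  have A_cont: "continuous_map Z euclideanreal (A e l)" if "e \<in> \<Lambda>" for e l
  proof -
    obtain j i where e: "e = (j, i)" "j \<in> J" "i \<in> V" using \<open>e \<in> \<Lambda>\<close> by (auto simp: \<Lambda>_def)
    show ?thesis using continuous_map_compose[OF xc[OF e(2,3)] a_cont[OF e(3)]] by (simp add: A_def e(1) comp_def)
  qed
  have A_nonneg: "A e l z \<ge> 0" if "e \<in> \<Lambda>" "z \<in> topspace Z" for e l z
    using that a_nonneg xR by (auto simp: A_def \<Lambda>_def)
  have A_pos: "a i (I (j, i)) (x j z i) > 0" if "z \<in> D I" "j \<in> J" "i \<in> V" for I i j z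
  proof -
    have "A (j, i) (I (j, i)) z > 0"
      using dominance_set_pos[OF fin A_nonneg that(1)[unfolded D_def], of "(j, i)"] that by (simp add: \<Lambda>_def)
    then show ?thesis by (simp add: A_def)
  qed
  have DZ: "D I \<subseteq> topspace Z" for I by (auto simp: D_def dominance_set_def)
  have D_open: "openin Z (D I)" for I
    unfolding D_def by (rule openin_dominance_set[OF fin A_cont])
  have D_disj: "I = I'" if "I \<in> \<I>" "I' \<in> \<I>" "sum I \<Lambda> = sum I' \<Lambda>" "z \<in> D I" "z \<in> D I'" for I I' z
    using dominance_set_disjoint[OF that(1,2)[unfolded \<I>_def] that(3) that(4,5)[unfolded D_def]] .
  have sel: "sel k z = I" if "I \<in> \<I>" "sum I \<Lambda> = k" "z \<in> D I" for k z I
    unfolding sel_def using that D_disj by (intro the_equality) auto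
  have face: "\<exists>\<sigma>\<in>K. \<forall>i\<in>V - \<sigma>. x j z i = b i" if "j \<in> J" "z \<in> topspace Z" for j z
  proof -
    have "x j z \<in> topspace ?P" using funcset_mem[OF continuous_map_funspace[OF x[OF that(1)]] that(2)] .
    then obtain \<sigma> where "\<sigma> \<in> K" "x j z \<in> (\<Pi>\<^sub>E i\<in>V. if i \<in> \<sigma> then topspace (?R i) else {b i})"
      unfolding polyhedral_product_def by auto
    then show ?thesis by (intro bexI[of _ \<sigma>]) (auto simp: PiE_iff split: if_splits)
  qed
  have I_le: "I (j, i) \<le> n i" if "I \<in> \<I>" "j \<in> J" "i \<in> V" for I i j
    using PiE_mem[OF that(1)[unfolded \<I>_def], of "(j, i)"] that by (simp add: \<Lambda>_def M_def)
  have I_0: "I (j, i) = 0" if "I \<in> \<I>" "z \<in> D I" "j \<in> J" "i \<in> V" "x j z i = b i" for I i j z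
    using a_b[OF that(4) I_le[OF that(1,3,4)]] A_pos[OF that(2-4)] that(5) by simp
  have level: "sum I \<Lambda> \<le> card J * N" if I: "I \<in> \<I>" "z \<in> D I" for I z
  proof -
    have "(\<Sum>i\<in>V. I (j, i)) \<le> N" if j: "j \<in> J" for j
    proof -
      obtain \<sigma> where \<sigma>: "\<sigma> \<in> K" "\<forall>i\<in>V - \<sigma>. x j z i = b i"
        using face[OF j] I(2) DZ by blast
      have "(\<Sum>i\<in>V. I (j, i)) = (\<Sum>i\<in>\<sigma>. I (j, i))"
        using V K[OF \<sigma>(1)] \<sigma>(2) I_0[OF I j] by (intro sum.mono_neutral_right) auto
      also have "\<dots> \<le> (\<Sum>i\<in>\<sigma>. n i)"
        using K[OF \<sigma>(1)] I_le[OF I(1) j] by (intro sum_mono) auto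
      also have "\<dots> \<le> N" by (rule N[OF \<sigma>(1)])
      finally show ?thesis .
    qed
    then have "(\<Sum>j\<in>J. \<Sum>i\<in>V. I (j, i)) \<le> (\<Sum>j\<in>J. N)" by (intro sum_mono)
    moreover have "sum I \<Lambda> = (\<Sum>j\<in>J. \<Sum>i\<in>V. I (j, i))"
      unfolding \<Lambda>_def by (simp add: sum.cartesian_product)
    ultimately show ?thesis by simp
  qed
  have G_cont: "continuous_map Q ?P (\<lambda>q. G I j (z q) (t q))"
    if I: "I \<in> \<I>" and j: "j \<in> J" and z: "continuous_map Q Z z" and t: "continuous_map Q (top_of_set {0..1}) t"
      and zD: "\<And>q. q \<in> topspace Q \<Longrightarrow> z q \<in> D I"
    for I j t z and Q :: "('z \<times> real) topology"
  proof -
    have "continuous_map Q (?R i) (\<lambda>q. h i (I (j, i)) (x j (z q) i) (t q))" if i: "i \<in> V" for i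
    proof -
      have "continuous_map Q (?R i) (\<lambda>q. x j (z q) i)"
        using continuous_map_compose[OF z xc[OF j i]] by (simp add: comp_def)
      then have "continuous_map Q (prod_topology (subtopology (?R i) {c. a i (I (j, i)) c > 0}) (top_of_set {0..1})) (\<lambda>q. (x j (z q) i, t q))"
        using t A_pos[OF zD j i] by (intro continuous_map_pairedI) (auto simp: continuous_map_in_subtopology)
      from continuous_map_compose[OF this h_cont[OF i I_le[OF I j i]]]
      show ?thesis by (simp add: comp_def)
    qed
    then have "continuous_map Q (product_topology ?R V) (\<lambda>q. G I j (z q) (t q))"
      unfolding G_def continuous_map_componentwise by auto
    \<comment> \<open>A coordinate at its base point is contracted in chart 0, where it does not
      move; so the point never leaves its face.\<close>
    moreover have "\<exists>\<sigma>\<in>K. G I j (z q) (t q) \<in> (\<Pi>\<^sub>E i\<in>V. if i \<in> \<sigma> then topspace (?R i) else {b i})" if q: "q \<in> topspace Q" for q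
    proof -
      have zZ: "z q \<in> topspace Z" using zD[OF q] DZ by blast
      obtain \<sigma> where \<sigma>: "\<sigma> \<in> K" "\<forall>i\<in>V - \<sigma>. x j (z q) i = b i"
        using face[OF j zZ] by blast
      have tq: "t q \<in> {0..1}" using funcset_mem[OF continuous_map_funspace[OF t] q] by simp
      have "h i (I (j, i)) (x j (z q) i) (t q) \<in> topspace (?R i)" if i: "i \<in> V" for i
      proof -
        have "(x j (z q) i, t q) \<in> topspace (prod_topology (subtopology (?R i) {c. a i (I (j, i)) c > 0}) (top_of_set {0..1}))"
          using tq xR[OF j i zZ] A_pos[OF zD[OF q] j i] by simp
        from funcset_mem[OF continuous_map_funspace[OF h_cont[OF i I_le[OF I j i]]] this]
        show ?thesis by simp
      qed
      moreover have "h i (I (j, i)) (x j (z q) i) (t q) = b i" if "i \<in> V - \<sigma>" for i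
        using that \<sigma>(2) I_0[OF I zD[OF q] j, of i] hb by simp
      ultimately have "G I j (z q) (t q) \<in> (\<Pi>\<^sub>E i\<in>V. if i \<in> \<sigma> then topspace (?R i) else {b i})"
        by (auto simp: G_def)
      then show ?thesis using \<sigma>(1) by blast
    qed
    ultimately show ?thesis
      unfolding polyhedral_product_def continuous_map_in_subtopology by blast
  qed
  show ?thesis
  proof (rule that[of W H])
    show "openin Z (W k)" for k
      unfolding W_def by (intro openin_Union) (auto simp: D_open)
    show "(\<Union>k\<le>card J * N. W k) = topspace Z"
    proof
      show "(\<Union>k\<le>card J * N. W k) \<subseteq> topspace Z" using DZ by (auto simp: W_def)
      show "topspace Z \<subseteq> (\<Union>k\<le>card J * N. W k)"
      proof
        fix z assume z: "z \<in> topspace Z"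
        have ex: "\<exists>l\<le>M e. A e l z > 0" if "e \<in> \<Lambda>" for e
          using that a_ex xR z by (auto simp: \<Lambda>_def M_def A_def)
        have "\<exists>I\<in>\<I>. z \<in> D I"
          unfolding \<I>_def D_def by (rule dominance_sets_cover[where a = A, OF fin A_nonneg[OF _ z] ex z])
        then obtain I where "I \<in> \<I>" "z \<in> D I" by blast
        then show "z \<in> (\<Union>k\<le>card J * N. W k)"
          using level[of I z] by (auto simp: W_def)
      qed
    qed
    fix k j
    show "continuous_map (prod_topology (subtopology Z (W k)) (top_of_set {0..1::real})) ?P (\<lambda>(z, t). H k j z t)" if j: "j \<in> J"
    proof (rule pasting_lemma[where I = "{I \<in> \<I>. sum I \<Lambda> = k}" and T = "\<lambda>I. D I \<times> {0..1}" and f = "\<lambda>I (z, t). G I j z t"])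
      let ?Q = "prod_topology (subtopology Z (W k)) (top_of_set {0..1::real})"
      fix I assume I: "I \<in> {I \<in> \<I>. sum I \<Lambda> = k}"
      have "D I \<subseteq> W k" using I by (auto simp: W_def)
      then have "openin (subtopology Z (W k)) (D I)"
        using D_open[of I] by (metis inf.absorb_iff2 openin_subtopology_Int2)
      then show "openin ?Q (D I \<times> {0..1})"
        by (simp add: openin_prod_Times_iff)
      have z: "continuous_map (subtopology ?Q (D I \<times> {0..1})) Z fst"
        using continuous_map_fst[of "subtopology Z (W k)" "top_of_set {0..1::real}"]
        by (simp add: continuous_map_in_subtopology continuous_map_from_subtopology)
      have t: "continuous_map (subtopology ?Q (D I \<times> {0..1})) (top_of_set {0..1}) snd"
        by (intro continuous_map_from_subtopology continuous_map_snd)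
      have "continuous_map (subtopology ?Q (D I \<times> {0..1})) ?P (\<lambda>q. G I j (fst q) (snd q))"
        by (rule G_cont[OF _ j z t]) (use I in auto)
      then show "continuous_map (subtopology ?Q (D I \<times> {0..1})) ?P (\<lambda>(z, t). G I j z t)"
        by (simp add: case_prod_unfold)
    next
      fix I I' q
      assume I: "I \<in> {I \<in> \<I>. sum I \<Lambda> = k}" and I': "I' \<in> {I \<in> \<I>. sum I \<Lambda> = k}"
        and "q \<in> topspace (prod_topology (subtopology Z (W k)) (top_of_set {0..1::real})) \<inter> D I \<times> {0..1} \<inter> D I' \<times> {0..1}"
      then have "fst q \<in> D I" "fst q \<in> D I'" by (simp_all add: mem_Times_iff)
      moreover have "I \<in> \<I>" "I' \<in> \<I>" "sum I \<Lambda> = sum I' \<Lambda>" using I I' by simp_all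
      ultimately have "I = I'" by (intro D_disj)
      then show "(case q of (z, t) \<Rightarrow> G I j z t) = (case q of (z, t) \<Rightarrow> G I' j z t)" by simp
    next
      fix q assume "q \<in> topspace (prod_topology (subtopology Z (W k)) (top_of_set {0..1::real}))"
      then obtain z t where q: "q = (z, t)" "z \<in> W k" "t \<in> {0..1}" by auto
      then obtain I where I: "I \<in> \<I>" "sum I \<Lambda> = k" "z \<in> D I" by (auto simp: W_def)
      show "\<exists>I. I \<in> {I \<in> \<I>. sum I \<Lambda> = k} \<and> q \<in> D I \<times> {0..1} \<and>
          (case q of (z, t) \<Rightarrow> H k j z t) = (case q of (z, t) \<Rightarrow> G I j z t)"
        using I q sel[OF I] by (intro exI[of _ I]) (simp add: H_def)
    qed
    show "H k j z 0 = x j z" if j: "j \<in> J" and z: "z \<in> W k" for z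
    proof -
      obtain I where I: "I \<in> \<I>" "sum I \<Lambda> = k" "z \<in> D I" using z by (auto simp: W_def)
      have zZ: "z \<in> topspace Z" using I(3) DZ by blast
      have "x j z \<in> topspace ?P" using funcset_mem[OF continuous_map_funspace[OF x[OF j]] zZ] .
      then have ext: "x j z \<in> extensional V" by (simp add: polyhedral_product_def PiE_def)
      have "G I j z 0 = x j z"
      proof (rule extensionalityI[OF _ ext])
        show "G I j z 0 i = x j z i" if "i \<in> V" for i
          using that h0[OF that xR[OF j that zZ] A_pos[OF I(3) j that]] by (simp add: G_def)
      qed (simp add: G_def)
      then show ?thesis using z sel[OF I] by (simp add: H_def)
    qed
    show "H k j z 1 = restrict b V" for z
    proof -
      have "G I j z 1 = restrict b V" for I
        using h1 by (auto simp: G_def fun_eq_iff)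
      then show ?thesis by (simp add: H_def)
    qed
  qed
qed

lemma LS_cat_projective_le:
  assumes V: "finite V" and K: "\<And>\<sigma>. \<sigma> \<in> K \<Longrightarrow> \<sigma> \<subseteq> V"
    and b: "\<And>i. i \<in> V \<Longrightarrow> b i \<in> topspace (real_projective_space (n i))"
    and N: "\<And>\<sigma>. \<sigma> \<in> K \<Longrightarrow> (\<Sum>i\<in>\<sigma>. n i) \<le> N"
  shows "LS_cat (projective_polyhedral_product V n b K) (restrict b V) \<le> enat N"
proof -
  let ?P = "projective_polyhedral_product V n b K"
  have id: "continuous_map ?P ?P (\<lambda>z. z)" by simp
  obtain W and H :: "nat \<Rightarrow> unit \<Rightarrow> _" where W: "\<And>k. openin ?P (W k)" "(\<Union>k\<le>card {()} * N. W k) = topspace ?P"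
    and H: "\<And>k j. j \<in> {()} \<Longrightarrow> continuous_map (prod_topology (subtopology ?P (W k)) (top_of_set {0..1::real})) ?P (\<lambda>(z, t). H k j z t)"
      "\<And>k j z. j \<in> {()} \<Longrightarrow> z \<in> W k \<Longrightarrow> H k j z 0 = z" "\<And>k j z. H k j z 1 = restrict b V"
    by (rule projective_polyhedral_product_cover[where J = "{()}" and x = "\<lambda>_ z. z", OF V _ K b N id]) (assumption | rule finite.intros | (rule that; assumption))+
  show ?thesis
    unfolding LS_cat_def
  proof (rule secat_leI)
    show "openin ?P (W k)" for k by (rule W(1))
    show "(\<Union>k\<le>N. W k) = topspace ?P" using W(2) by simp
    fix k
    \<comment> \<open>The contraction ends at the base point whereas based paths start there, hence
      the reversal of time.\<close>
    have "continuous_map (top_of_set {0..1}) (top_of_set {0..1}) (\<lambda>t::real. 1 - t)"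
      by (auto intro!: continuous_intros)
    then have "continuous_map (prod_topology (subtopology ?P (W k)) (top_of_set {0..1})) (prod_topology (subtopology ?P (W k)) (top_of_set {0..1})) (\<lambda>(z, t). (z, 1 - t :: real))"
      unfolding case_prod_unfold
      by (intro continuous_map_pairedI continuous_map_fst continuous_map_compose[OF continuous_map_snd, unfolded comp_def])
    from continuous_map_compose[OF this H(1), of "()"]
    have "continuous_map (prod_topology (subtopology ?P (W k)) (top_of_set {0..1})) ?P (\<lambda>(z, t). H k () z (1 - t))"
      by (simp add: comp_def case_prod_unfold)
    from continuous_map_path_space_curry[OF this]
    have "local_section (based_path_space ?P (restrict b V)) ?P (\<lambda>\<alpha>. \<alpha> 1) (W k) (\<lambda>z. restrict (\<lambda>t. H k () z (1 - t)) {0..1})"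
      using H(2,3) by (auto simp: local_section_def based_path_space_def continuous_map_in_subtopology)
    then show "\<exists>s. local_section (based_path_space ?P (restrict b V)) ?P (\<lambda>\<alpha>. \<alpha> 1) (W k) s" by blast
  qed
qed

text \<open>The path visiting \<open>x 0, x 1, \<dots>\<close> at integer times and the common end point of all \<open>H j\<close> in between.\<close>

primrec tour :: "(nat \<Rightarrow> 'z \<Rightarrow> real \<Rightarrow> 'x) \<Rightarrow> nat \<Rightarrow> 'z \<Rightarrow> real \<Rightarrow> 'x" where
  "tour H 0 z \<tau> = H 0 z (min 1 (2 * \<bar>\<tau>\<bar>))"
| "tour H (Suc q) z \<tau> = (if \<tau> \<le> real q + 1/2 then tour H q z \<tau> else H (Suc q) z (min 1 (2 * \<bar>\<tau> - real (Suc q)\<bar>)))"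

lemma tour_late: "(\<And>j. j \<le> q \<Longrightarrow> H j z 1 = p) \<Longrightarrow> \<tau> \<ge> real q + 1/2 \<Longrightarrow> tour H q z \<tau> = p"
proof (induction q)
  case 0
  then have "min 1 (2 * \<bar>\<tau>\<bar>) = 1" by simp
  then show ?case using 0 by simp
next
  case (Suc q)
  then have "min 1 (2 * \<bar>\<tau> - real (Suc q)\<bar>) = 1" by simp
  then show ?case using Suc by simp
qed

lemma tour_nat: "j \<le> q \<Longrightarrow> tour H q z (real j) = H j z 0"
proof (induction q)
  case (Suc q)
  then show ?case
  proof (cases "j = Suc q")
    case False
    then have "real j \<le> real q + 1/2" using Suc.prems by linarith
    then show ?thesis using Suc False by simp
  qed simp
qed simp

text \<open>Consecutive legs are glued at half-integer times, when both are at the common end point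
  \<open>p\<close>.\<close>

lemma continuous_map_tour:
  assumes H: "\<And>j. j \<le> q \<Longrightarrow> continuous_map (prod_topology Z (top_of_set {0..1})) X (\<lambda>(z, t). H j z t)"
    and p: "\<And>j z. j \<le> q \<Longrightarrow> H j z 1 = p"
  shows "continuous_map (prod_topology Z euclideanreal) X (\<lambda>(z, \<tau>). tour H q z \<tau>)"
proof -
  have leg: "continuous_map (prod_topology Z euclideanreal) X (\<lambda>x. H j (fst x) (min 1 (2 * \<bar>snd x - c\<bar>)))" if "j \<le> q" for j c
  proof -
    have "continuous_map (prod_topology Z euclideanreal) (top_of_set {0..1}) (\<lambda>x. min 1 (2 * \<bar>snd x - c\<bar>))"
      unfolding continuous_map_in_subtopology
      by (intro conjI continuous_map_real_min continuous_map_real_mult continuous_map_real_abs continuous_map_diff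
          continuous_map_snd continuous_map_canonical_const) auto
    then have "continuous_map (prod_topology Z euclideanreal) (prod_topology Z (top_of_set {0..1})) (\<lambda>x. (fst x, min 1 (2 * \<bar>snd x - c\<bar>)))"
      by (intro continuous_map_pairedI continuous_map_fst)
    from continuous_map_compose[OF this H[OF that]] show ?thesis by (simp add: comp_def)
  qed
  have "continuous_map (prod_topology Z euclideanreal) X (\<lambda>x. tour H k (fst x) (snd x))" if "k \<le> q" for k
    using that
  proof (induction k)
    case 0
    then show ?case using leg[of 0 0] by simp
  next
    case (Suc k)
    have "continuous_map (prod_topology Z euclideanreal) X
      (\<lambda>x. if snd x \<le> real k + 1/2 then tour H k (fst x) (snd x) else H (Suc k) (fst x) (min 1 (2 * \<bar>snd x - real (Suc k)\<bar>)))"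
    proof (rule continuous_map_cases_le)
      show "tour H k (fst x) (snd x) = H (Suc k) (fst x) (min 1 (2 * \<bar>snd x - real (Suc k)\<bar>))" if "snd x = real k + 1/2" for x
      proof -
        have "tour H k (fst x) (snd x) = p"
          by (rule tour_late) (use p Suc.prems that in auto)
        moreover have "min 1 (2 * \<bar>snd x - real (Suc k)\<bar>) = 1" using that by simp
        ultimately show ?thesis using p[OF Suc.prems] by simp
      qed
    qed (use Suc leg[OF Suc.prems] in \<open>auto intro!: continuous_map_from_subtopology continuous_map_snd\<close>)
    then show ?case by simp
  qed
  from this[of q] show ?thesis by (simp add: case_prod_unfold)
qed

lemma TC_projective_le:
  assumes V: "finite V" and K: "\<And>\<sigma>. \<sigma> \<in> K \<Longrightarrow> \<sigma> \<subseteq> V"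
    and b: "\<And>i. i \<in> V \<Longrightarrow> b i \<in> topspace (real_projective_space (n i))"
    and N: "\<And>\<sigma>. \<sigma> \<in> K \<Longrightarrow> (\<Sum>i\<in>\<sigma>. n i) \<le> N" and r: "r \<ge> 2"
  shows "TC r (projective_polyhedral_product V n b K) \<le> enat (r * N)"
proof -
  let ?P = "projective_polyhedral_product V n b K"
  let ?B = "product_topology (\<lambda>_. ?P) {..<r}"
  have x: "continuous_map ?B ?P (\<lambda>z. z j)" if "j \<in> {..<r}" for j
    using continuous_map_product_projection[OF that, of "\<lambda>_. ?P"] .
  obtain W H where W: "\<And>k. openin ?B (W k)" "(\<Union>k\<le>card {..<r} * N. W k) = topspace ?B"
    and H: "\<And>k j. j \<in> {..<r} \<Longrightarrow> continuous_map (prod_topology (subtopology ?B (W k)) (top_of_set {0..1::real})) ?P (\<lambda>(z, t). H k j z t)"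
      "\<And>k j z. j \<in> {..<r} \<Longrightarrow> z \<in> W k \<Longrightarrow> H k j z 0 = z j" "\<And>k j z. H k j z 1 = restrict b V"
    by (rule projective_polyhedral_product_cover[where x = "\<lambda>j z. z j", OF V finite_lessThan K b N x]) (assumption | (rule that; assumption))+
  show ?thesis
    unfolding TC_def
  proof (rule secat_leI)
    show "openin ?B (W k)" for k by (rule W(1))
    show "(\<Union>k\<le>r * N. W k) = topspace ?B" using W(2) by simp
    fix k
    \<comment> \<open>Speed \<open>r - 1\<close> turns the sampling time \<open>j / (r - 1)\<close>
      into the integer time \<open>j\<close>, when the tour is at \<open>z j\<close>.\<close>
    define s where "s z t = tour (H k) (r - 1) z ((real r - 1) * t)" for z t
    have tour: "continuous_map (prod_topology (subtopology ?B (W k)) euclideanreal) ?P (\<lambda>(z, \<tau>). tour (H k) (r - 1) z \<tau>)"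
      by (rule continuous_map_tour) (use H r in auto)
    have "continuous_map (top_of_set {0..1}) euclideanreal (\<lambda>t. (real r - 1) * t)"
      by (auto intro!: continuous_intros)
    then have "continuous_map (prod_topology (subtopology ?B (W k)) (top_of_set {0..1})) (prod_topology (subtopology ?B (W k)) euclideanreal) (\<lambda>(z, t). (z, (real r - 1) * t))"
      unfolding case_prod_unfold
      by (intro continuous_map_pairedI continuous_map_fst continuous_map_compose[OF continuous_map_snd, unfolded comp_def])
    from continuous_map_compose[OF this tour]
    have "continuous_map (prod_topology (subtopology ?B (W k)) (top_of_set {0..1})) ?P (\<lambda>(z, t). s z t)"
      by (simp add: comp_def case_prod_unfold s_def)
    from continuous_map_path_space_curry[OF this]
    have c: "continuous_map (subtopology ?B (W k)) (path_space ?P) (\<lambda>z. restrict (s z) {0..1})" .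
    have "multi_eval r (restrict (s z) {0..1}) = z" if z: "z \<in> W k" for z
    proof -
      have "z \<in> topspace ?B" using z openin_subset[OF W(1)] by blast
      then have "z \<in> extensional {..<r}" by (simp add: PiE_iff)
      moreover have "restrict (s z) {0..1} (real j / (real r - 1)) = z j" if "j < r" for j
      proof -
        have "real j / (real r - 1) \<in> {0..1}" using that r by (auto simp: field_simps)
        moreover have "(real r - 1) * (real j / (real r - 1)) = real j" using r by simp
        ultimately show ?thesis
          using tour_nat[of j "r - 1" "H k" z] that H(2)[of j z k] z by (simp add: s_def)
      qed
      ultimately show ?thesis by (simp add: multi_eval_eq_iff)
    qed
    then show "\<exists>s. local_section (path_space ?P) ?B (multi_eval r) (W k) s"
      unfolding local_section_def using c by blast
  qed
qed

text \<open>A projective space is homeomorphic to the polyhedral product over a single vertex, to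
  which both bounds apply. Each of the two inverse maps exhibits a retract.\<close>

lemma TC_real_projective_space:
  assumes "even k" "r \<ge> 2" "k < r"
  shows "TC r (real_projective_space k) = enat (r * k)"
proof -
  let ?R = "real_projective_space k"
  obtain c where c: "c \<in> topspace ?R"
    using in_topspace_nsphere[of k] by (auto simp: topspace_real_projective_space)
  define P where "P = projective_polyhedral_product {0::nat} (\<lambda>_. k) (\<lambda>_. c) {{}, {0}}"
  have "TC r P = enat (r * k)"
  proof (rule antisym)
    show "TC r P \<le> enat (r * k)"
      unfolding P_def by (rule TC_projective_le) (use c assms in auto)
    show "enat (r * k) \<le> TC r P"
      unfolding P_def using TC_projective_ge[of "{0}" "{0}" "{{}, {0::nat}}" "\<lambda>_. c" "\<lambda>_. k" r] c assms by simp
  qed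
  have i: "continuous_map ?R P (\<lambda>x. \<lambda>i\<in>{0}. x)"
    unfolding P_def polyhedral_product_def continuous_map_in_subtopology continuous_map_componentwise
    by (auto simp: PiE_iff)
  have \<rho>: "continuous_map P ?R (\<lambda>x. x 0)"
    unfolding P_def using continuous_map_polyhedral_product_projection[of 0 "{0::nat}" "\<lambda>_. ?R"] by simp
  have "TC r ?R \<le> TC r P"
    by (rule TC_le_of_retract[OF i \<rho> _ \<open>r \<ge> 2\<close>]) simp
  moreover have "TC r P \<le> TC r ?R"
  proof (rule TC_le_of_retract[OF \<rho> i _ \<open>r \<ge> 2\<close>])
    fix x assume "x \<in> topspace P"
    then have "x \<in> extensional {0}" by (simp add: P_def polyhedral_product_def PiE_def)
    then show "(\<lambda>i\<in>{0}. x 0) = x" by (auto simp: fun_eq_iff extensional_def)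
  qed
  ultimately show ?thesis using \<open>TC r P = enat (r * k)\<close> by simp
qed

theorem theorem1p9:
  fixes m :: nat and n :: "nat \<Rightarrow> nat" and b :: "nat \<Rightarrow> (nat \<Rightarrow> real) set"
    and K :: "nat set set"
  defines "PK \<equiv> polyhedral_product {1..m} (\<lambda>i. real_projective_space (n i)) b K"
  assumes "\<And>i. i \<in> {1..m} \<Longrightarrow> n i > 0"
    and "\<And>i. i \<in> {1..m} \<Longrightarrow> b i \<in> topspace (real_projective_space (n i))"
    and "abstract_simplicial_complex {1..m} K"
    and "\<And>i. i \<in> {1..m} \<Longrightarrow> even (n i)"
  shows "\<exists>R\<ge>2. \<forall>r\<ge>R.
    TC r PK = of_nat r * LS_cat PK (restrict b {1..m}) \<and>
    of_nat r * LS_cat PK (restrict b {1..m}) =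
      Max ((\<lambda>\<sigma>. \<Sum>i\<in>\<sigma>. TC r (real_projective_space (n i))) ` K)"
proof -
  note b = assms(3) and even = assms(5)
  have K: "\<sigma> \<subseteq> {1..m}" if "\<sigma> \<in> K" for \<sigma>
    using assms(4) that by (auto simp: abstract_simplicial_complex_def)
  have "{} \<in> K" using assms(4) by (simp add: abstract_simplicial_complex_def)
  have "finite K" by (rule finite_subset[of _ "Pow {1..m}"]) (use K in auto)
  define d where "d \<sigma> = (\<Sum>i\<in>\<sigma>. n i)" for \<sigma>
  define N where "N = Max (d ` K)"
  have "N \<in> d ` K" unfolding N_def using \<open>finite K\<close> \<open>{} \<in> K\<close> by (intro Max_in) auto
  then obtain \<sigma> where \<sigma>: "\<sigma> \<in> K" "N = d \<sigma>" by blast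
  have N: "(\<Sum>i\<in>\<tau>. n i) \<le> N" if "\<tau> \<in> K" for \<tau>
    unfolding N_def d_def[symmetric] using \<open>finite K\<close> that by (intro Max_ge) auto
  have cat: "LS_cat PK (restrict b {1..m}) = enat N"
  proof (rule antisym)
    show "LS_cat PK (restrict b {1..m}) \<le> enat N"
      unfolding PK_def by (rule LS_cat_projective_le[OF finite_atLeastAtMost K b N])
    show "enat N \<le> LS_cat PK (restrict b {1..m})"
      unfolding PK_def \<sigma>(2) d_def by (rule LS_cat_projective_ge[OF finite_atLeastAtMost \<sigma>(1) K[OF \<sigma>(1)] b])
  qed
  show ?thesis
  \<comment> \<open>This bound is at least 2 and exceeds every \<open>n i\<close>, also when
    \<open>m = 0\<close>.\<close>
  proof (intro exI[of _ "2 + (\<Sum>i\<in>{1..m}. n i)"] conjI allI impI)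
    fix r assume r: "2 + (\<Sum>i\<in>{1..m}. n i) \<le> r"
    have r2: "2 \<le> r" using r by linarith
    have large: "n i < r" if "i \<in> {1..m}" for i
    proof -
      have "n i \<le> (\<Sum>i\<in>{1..m}. n i)" using that by (intro member_le_sum) auto
      then show ?thesis using r by simp
    qed
    have mult: "of_nat r * enat N = enat (r * N)" by (simp add: of_nat_eq_enat)
    have "TC r PK = enat (r * N)"
    proof (rule antisym)
      show "TC r PK \<le> enat (r * N)"
        unfolding PK_def by (rule TC_projective_le[OF finite_atLeastAtMost K b N r2])
      show "enat (r * N) \<le> TC r PK"
        unfolding PK_def \<sigma>(2) d_def
        by (rule TC_projective_ge[OF finite_atLeastAtMost \<sigma>(1) K[OF \<sigma>(1)] b r2])
          (use K[OF \<sigma>(1)] even large in auto)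
    qed
    then show "TC r PK = of_nat r * LS_cat PK (restrict b {1..m})" unfolding cat mult .
    have TC: "(\<Sum>i\<in>\<tau>. TC r (real_projective_space (n i))) = enat (r * d \<tau>)" if "\<tau> \<in> K" for \<tau>
    proof -
      have "(\<Sum>i\<in>\<tau>. TC r (real_projective_space (n i))) = (\<Sum>i\<in>\<tau>. of_nat (r * n i))"
        using K[OF that] even large r2
        by (intro sum.cong refl) (auto simp: TC_real_projective_space of_nat_eq_enat simp del: of_nat_mult)
      also have "\<dots> = enat (r * d \<tau>)"
        unfolding d_def sum_distrib_left of_nat_eq_enat[symmetric] of_nat_sum ..
      finally show ?thesis .
    qed
    \<comment> \<open>By \<open>TC\<close> the maximised quantity is \<open>r * d \<tau>\<close>,
      which is largest where \<open>d\<close> is.\<close>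
    have "Max ((\<lambda>\<sigma>. \<Sum>i\<in>\<sigma>. TC r (real_projective_space (n i))) ` K) = enat (r * N)"
    proof (rule Max_eqI)
      show "y \<le> enat (r * N)" if "y \<in> (\<lambda>\<sigma>. \<Sum>i\<in>\<sigma>. TC r (real_projective_space (n i))) ` K" for y
        using that TC N by (auto simp: d_def)
      show "enat (r * N) \<in> (\<lambda>\<sigma>. \<Sum>i\<in>\<sigma>. TC r (real_projective_space (n i))) ` K"
        using TC[OF \<sigma>(1)] \<sigma> by (metis (no_types, lifting) image_eqI)
    qed (use \<open>finite K\<close> in simp)
    then show "of_nat r * LS_cat PK (restrict b {1..m}) = Max ((\<lambda>\<sigma>. \<Sum>i\<in>\<sigma>. TC r (real_projective_space (n i))) ` K)"
      unfolding cat mult by (rule sym)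
  qed simp
qed

end
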